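(* Let $d\ge1$, let $K$ be a finite index set, let $\{\{I_{j,k}\}_{j\in\mathbb N,k\in K},I_\bullet\}$ be an admissible partition of $\mathbb R^d$, with the contracted sets $I_{-j,k}$ ($j\ge1$) defined from it. For all $s\ge0$, if $\varphi\in L^2(\mathbb R^d)$ is $s$-admissible for the Sobolev seminorm with respect to this partition, then there exists $\nu_0>0$ such that for all $\nu\in(0,\nu_0)$ the system $\{\varphi_{j,k,\lambda}: j\in\mathbb Z,\ k\in K,\ \lambda\in\nu\mathbb Z^d\}$ is a frame representing the $H^s$-seminorm; that is, there exist constants $A,B>0$ such that for all $f\in H^s(\mathbb R^d)$ $$A|f|_s^2\le\sum_{j\in\mathbb Z,\,k\in K,\,\lambda\in\nu\mathbb Z^d}2^{2js}|\langle f,\varphi_{j,k,\lambda}\rangle|^2\le B|f|_s^2 .$$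
   Context: $\mathbb N=\{0,1,2,\dots\}$. Fourier transform: $\widehat u(\omega)=\int e^{-2\pi i x\cdot\omega}u(x)\,dx$. $T_xf(t)=f(t-x)$; $D_af(x)=a^{-d/2}f(x/a)$ for $a>0$. $\langle\cdot,\cdot\rangle$ is the $L^2(\mathbb R^d)$ inner product. $|f|_s=\||\omega|^s\widehat f(\omega)\|_{L^2}$ is the $H^s$-seminorm. $d(\omega,A)$ is the Euclidean distance from $\omega$ to the set $A$. Pointwise conditions on Fourier transforms of $L^2$ functions are understood almost everywhere. Admissible partition of $\mathbb R^d$: a family $\{\{I_{j,k}\}_{j\in\mathbb N,k\in K},I_\bullet\}$ with $K$ finite such that (i) $I_{j,k}$ and $I_\bullet$ are non-empty connected subsets of $\mathbb R^d$; (ii) $\bigcup_{j,k}I_{j,k}\cup I_\bullet=\mathbb R^d$; (iii) $I_\bullet$ is a neighborhood of the origin and $I_{j,k}\cap\mathbb Z^d\ne\emptyset$ for all $j,k$; (iv) there is $N\in\mathbb N$ such that for each $(\bar j,\bar k)$ there are at most $N$ indices $(j,k)$ with $I_{\bar j,\bar k}\cap I_{j,k}\neq\emptyset$; (v) there are $c_{\min},c_{\max}>0$ such that $c_{\min}<|\omega|/2^j<c_{\max}$ for all $\omega\in I_{j,k}$, uniformly in $j,k$. For $j\ge1$, $k\in K$, set $I_{-j,k}=\{x\in\mathbb R^d: 2^{2j}x\in I_{j,k}\}$. For $j\in\mathbb N$ set $Z_{j,k}=I_{j,k}\cap\mathbb Z^d$ and $\Phi_{j,k}(\omega)=\sum_{\eta\in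 Z_{j,k}}\widehat\varphi(\omega-\eta)$; for $j\ge1$ set $\Phi_{-j,k}(\omega)=\Phi_{j,k}(2^{2j}\omega)$. For $\nu>0$, $\lambda\in\nu\mathbb Z^d$, $k\in K$: for $j\in\mathbb N$, $$\varphi_{j,k,\lambda}=T_{\lambda/2^j}\Big(\frac1{2^{jd/2}}\sum_{\eta\in Z_{j,k}}e^{2\pi i\eta\cdot t}\varphi(t)\Big),$$ and for $j\ge1$, $\varphi_{-j,k,\lambda}=T_{\lambda2^j}D_{2^{2j}}\varphi_{j,k,0}=D_{2^{2j}}T_{\lambda/2^j}\varphi_{j,k,0}$. $\varphi$ is $s$-admissible for the Sobolev seminorm if (i) there are $\alpha>d/2$ and $C>0$ such that for all $j\in\mathbb N$, $k\in K$: $|\Phi_{j,k}(\omega)|\le C\,\dfrac{2^{jd/2}\min(1,|\omega|)^s}{(1+d(\omega,I_{j,k}))^{\alpha+s}}$ for $\omega\notin I_{j,k}$, and $|\Phi_{j,k}(\omega)|\le C$ for all $\omega\in\mathbb R^d$; (ii) there is a constant $a>0$ such that for a.e. $\omega\in\mathbb R^d$ there exist $\bar j\in\mathbb Z$ and $\bar k\in K$ with $\omega\in I_{\bar j,\bar k}$ and $|\Phi_{\bar j,\bar k}(\omega)|\ge a$, where $a$ does not depend on $\bar j,\bar k$. *)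

theory Defs
  imports "HOL-Analysis.Analysis"
begin

section \<open>\<open>L\<^sup>2\<close>, Fourier transform and Sobolev seminorms on \<open>\<real>\<^sup>d\<close>\<close>

text \<open>Elements of \<open>L\<^sup>2(\<real>\<^sup>d)\<close> are represented by Lebesgue measurable functions;
  everything below depends only on their almost-everywhere classes. The dimension
  \<open>d = CARD('n)\<close> is arbitrary and automatically at least 1.\<close>

definition L2 :: "(real^'n \<Rightarrow> complex) set" where
  "L2 = {f \<in> borel_measurable lebesgue. integrable lebesgue (\<lambda>x. (cmod (f x))\<^sup>2)}"

definition L2_norm :: "(real^'n \<Rightarrow> complex) \<Rightarrow> real" where
  "L2_norm f = sqrt (LINT x|lebesgue. (cmod (f x))\<^sup>2)"

definition L2_inner :: "(real^'n \<Rightarrow> complex) \<Rightarrow> (real^'n \<Rightarrow> complex) \<Rightarrow> complex" where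
  "L2_inner f g = (LINT x|lebesgue. f x * cnj (g x))"

definition fourier_integral :: "(real^'n \<Rightarrow> complex) \<Rightarrow> real^'n \<Rightarrow> complex" where
  "fourier_integral u \<omega> = (LINT x|lebesgue. exp (- (2 * pi * \<i> * (x \<bullet> \<omega>))) * u x)"

text \<open>For \<open>u \<in> L\<^sup>2\<close> the Fourier integral need not converge. The transform is the
  \<open>L\<^sup>2\<close>-limit of the Fourier integrals of the truncations of \<open>u\<close> to balls, which are integrable.
  The distance is an extended nonnegative integral, so that a difference outside \<open>L\<^sup>2\<close>
  has distance \<open>\<infinity>\<close> and not 0.\<close>

definition is_fourier_transform :: "(real^'n \<Rightarrow> complex) \<Rightarrow> (real^'n \<Rightarrow> complex) \<Rightarrow> bool" where
  "is_fourier_transform u g \<longleftrightarrow> g \<in> L2 \<and>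
     ((\<lambda>R::real. \<integral>\<^sup>+ \<omega>. ennreal ((cmod
          (g \<omega> - fourier_integral (\<lambda>x. indicator (cball 0 R) x * u x) \<omega>))\<^sup>2) \<partial>lebesgue)
       \<longlongrightarrow> 0) at_top"

text \<open>By Plancherel's theorem such a \<open>g\<close> exists for \<open>u \<in> L\<^sup>2\<close>; it is unique almost everywhere.\<close>

definition fourier :: "(real^'n \<Rightarrow> complex) \<Rightarrow> real^'n \<Rightarrow> complex" where
  "fourier u = (SOME g. is_fourier_transform u g)"

definition sobolev_space :: "real \<Rightarrow> (real^'n \<Rightarrow> complex) set" where
  "sobolev_space s = {f \<in> L2.
     integrable lebesgue (\<lambda>\<omega>. (1 + (norm \<omega>)\<^sup>2) powr s * (cmod (fourier f \<omega>))\<^sup>2)}"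

text \<open>Note \<open>0 powr 0 = 0\<close>; here and below this only concerns the null set \<open>{0}\<close>.\<close>

definition sobolev_seminorm :: "real \<Rightarrow> (real^'n \<Rightarrow> complex) \<Rightarrow> real" where
  "sobolev_seminorm s f = L2_norm (\<lambda>\<omega>. of_real (norm \<omega> powr s) * fourier f \<omega>)"

definition translation :: "real^'n \<Rightarrow> (real^'n \<Rightarrow> complex) \<Rightarrow> real^'n \<Rightarrow> complex" where
  "translation x f = (\<lambda>t. f (t - x))"

definition dilation :: "real \<Rightarrow> (real^'n \<Rightarrow> complex) \<Rightarrow> real^'n \<Rightarrow> complex" where
  "dilation a f = (\<lambda>x. of_real (a powr (- real CARD('n) / 2)) * f (x /\<^sub>R a))"


section \<open>Admissible partitions\<close>

definition int_lattice :: "(real^'n) set" where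
  "int_lattice = {\<eta>. \<forall>i. \<eta> $ i \<in> \<int>}"

definition scaled_lattice :: "real \<Rightarrow> (real^'n) set" where
  "scaled_lattice \<nu> = (\<lambda>\<eta>. \<nu> *\<^sub>R \<eta>) ` int_lattice"

text \<open>The sets are only required to have bounded overlap, not to be disjoint. The argument
  \<open>I\<^sub>0\<close> is the central set \<open>I\<^sub>\<bullet>\<close>.\<close>

definition admissible_partition ::
    "'k set \<Rightarrow> (nat \<Rightarrow> 'k \<Rightarrow> (real^'n) set) \<Rightarrow> (real^'n) set \<Rightarrow> bool" where
  "admissible_partition K I I\<^sub>0 \<longleftrightarrow>
     finite K \<and>
     (\<forall>j. \<forall>k\<in>K. I j k \<noteq> {} \<and> connected (I j k)) \<and> I\<^sub>0 \<noteq> {} \<and> connected I\<^sub>0 \<and>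
     (\<Union>j. \<Union>k\<in>K. I j k) \<union> I\<^sub>0 = UNIV \<and>
     0 \<in> interior I\<^sub>0 \<and> (\<forall>j. \<forall>k\<in>K. I j k \<inter> int_lattice \<noteq> {}) \<and>
     (\<exists>N::nat. \<forall>j'. \<forall>k'\<in>K.
        finite {(j, k). k \<in> K \<and> I j' k' \<inter> I j k \<noteq> {}} \<and>
        card {(j, k). k \<in> K \<and> I j' k' \<inter> I j k \<noteq> {}} \<le> N) \<and>
     (\<exists>cmin>0. \<exists>cmax>0. \<forall>j. \<forall>k\<in>K. \<forall>\<omega>\<in>I j k.
        cmin < norm \<omega> / 2 ^ j \<and> norm \<omega> / 2 ^ j < cmax)"

definition extended_set ::
    "(nat \<Rightarrow> 'k \<Rightarrow> (real^'n) set) \<Rightarrow> int \<Rightarrow> 'k \<Rightarrow> (real^'n) set" where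
  "extended_set I j k =
     (if 0 \<le> j then I (nat j) k
      else {x. 2 ^ (2 * nat (- j)) *\<^sub>R x \<in> I (nat (- j)) k})"

text \<open>These sets are finite for admissible partitions, so the sums over them below are
  genuine finite sums.\<close>

definition lattice_points ::
    "(nat \<Rightarrow> 'k \<Rightarrow> (real^'n) set) \<Rightarrow> nat \<Rightarrow> 'k \<Rightarrow> (real^'n) set" where
  "lattice_points I j k = I j k \<inter> int_lattice"

definition Phi_nat ::
    "(nat \<Rightarrow> 'k \<Rightarrow> (real^'n) set) \<Rightarrow> (real^'n \<Rightarrow> complex) \<Rightarrow> nat \<Rightarrow> 'k \<Rightarrow> real^'n \<Rightarrow> complex" where
  "Phi_nat I \<phi> j k \<omega> = (\<Sum>\<eta>\<in>lattice_points I j k. fourier \<phi> (\<omega> - \<eta>))"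

definition Phi ::
    "(nat \<Rightarrow> 'k \<Rightarrow> (real^'n) set) \<Rightarrow> (real^'n \<Rightarrow> complex) \<Rightarrow> int \<Rightarrow> 'k \<Rightarrow> real^'n \<Rightarrow> complex" where
  "Phi I \<phi> j k \<omega> =
     (if 0 \<le> j then Phi_nat I \<phi> (nat j) k \<omega>
      else Phi_nat I \<phi> (nat (- j)) k (2 ^ (2 * nat (- j)) *\<^sub>R \<omega>))"


section \<open>The system and admissibility of the generator\<close>

definition atom_nat ::
    "(nat \<Rightarrow> 'k \<Rightarrow> (real^'n) set) \<Rightarrow> (real^'n \<Rightarrow> complex) \<Rightarrow> nat \<Rightarrow> 'k \<Rightarrow> real^'n
      \<Rightarrow> real^'n \<Rightarrow> complex" where
  "atom_nat I \<phi> j k l = translation (l /\<^sub>R 2 ^ j)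
     (\<lambda>t. of_real (1 / 2 powr (real j * real CARD('n) / 2)) *
          (\<Sum>\<eta>\<in>lattice_points I j k. exp (2 * pi * \<i> * (\<eta> \<bullet> t)) * \<phi> t))"

definition atom ::
    "(nat \<Rightarrow> 'k \<Rightarrow> (real^'n) set) \<Rightarrow> (real^'n \<Rightarrow> complex) \<Rightarrow> int \<Rightarrow> 'k \<Rightarrow> real^'n
      \<Rightarrow> real^'n \<Rightarrow> complex" where
  "atom I \<phi> j k l =
     (if 0 \<le> j then atom_nat I \<phi> (nat j) k l
      else translation (2 ^ nat (- j) *\<^sub>R l)
             (dilation (2 ^ (2 * nat (- j))) (atom_nat I \<phi> (nat (- j)) k 0)))"

definition sobolev_admissible ::
    "real \<Rightarrow> 'k set \<Rightarrow> (nat \<Rightarrow> 'k \<Rightarrow> (real^'n) set) \<Rightarrow> (real^'n \<Rightarrow> complex) \<Rightarrow> bool" where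
  "sobolev_admissible s K I \<phi> \<longleftrightarrow>
     (\<exists>\<alpha> > real CARD('n) / 2. \<exists>C>0. \<forall>j::nat. \<forall>k\<in>K. AE \<omega> in lebesgue.
        (\<omega> \<notin> I j k \<longrightarrow>
           cmod (Phi_nat I \<phi> j k \<omega>) \<le>
             C * (2 powr (real j * real CARD('n) / 2) * (min 1 (norm \<omega>)) powr s
                  / (1 + infdist \<omega> (I j k)) powr (\<alpha> + s))) \<and>
        cmod (Phi_nat I \<phi> j k \<omega>) \<le> C) \<and>
     (\<exists>a>0. AE \<omega> in lebesgue. \<exists>j::int. \<exists>k\<in>K.
        \<omega> \<in> extended_set I j k \<and> a \<le> cmod (Phi I \<phi> j k \<omega>))"

end

theory Submission
  imports Defs
begin

text \<open>The Fourier transform of \<open>\<phi>\<^sub>j\<^sub>,\<^sub>k\<^sub>,\<^sub>\<lambda>\<close> is \<open>2\<^bsup>-jd/2\<^esup> exp (-2\<pi>i \<lambda>\<bullet>\<omega> / 2\<^sup>j) \<Phi>\<^sub>j\<^sub>,\<^sub>k(\<omega>)\<close>, for negative \<open>j\<close>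
  as for the others. By Plancherel's theorem the inner products of \<open>f\<close> with these functions, for fixed
  \<open>j\<close> and \<open>k\<close> and \<open>\<lambda>\<close> running through \<open>\<nu>\<int>\<^sup>d\<close>, are therefore Fourier coefficients of the periodization of
  \<open>f\<^sup>^ \<Phi>\<^sub>j\<^sub>,\<^sub>k\<close> (with a conjugate on one factor) with period \<open>p = 2\<^sup>j/\<nu>\<close>, and by Parseval's identity
  the sum of their squares is \<open>\<nu>\<^bsup>-d\<^esup>\<close> times the integral of the squared periodization over one period
  (\<open>L2_inner_atom\<close>, \<open>periodization\<close>).

  The periodization is split into the function itself on the central period and the sum of the other
  translates. In the variable \<open>x = \<omega>/2\<^sup>j\<close> the quantity \<open>2\<^bsup>js\<^esup>|\<Phi>\<^sub>j\<^sub>,\<^sub>k(\<omega>)| / |\<omega>|\<^sup>s\<close> is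
  \<open>|\<Phi>\<^sub>|\<^sub>j\<^sub>|\<^sub>,\<^sub>k(2\<^bsup>|j|\<^esup>x)| / |x|\<^sup>s\<close>, the same expression for \<open>j\<close> and \<open>-j\<close>. It is bounded where \<open>|x|\<close> is
  comparable to 1, and by admissibility it is elsewhere at most \<open>\<kappa> q\<^bsup>|j|\<^esup>\<close>, and for large \<open>|x|\<close> at most
  \<open>\<kappa> q\<^bsup>|j|\<^esup>|x|\<^bsup>-\<alpha>\<^esup>\<close>, with \<open>q = 2\<^bsup>-(\<alpha>-d/2)\<^esup> < 1\<close> (\<open>band_decay\<close>). On the translates other than the central one
  \<open>|x|\<close> is at least \<open>1/(2\<nu>)\<close>. Since \<open>2\<alpha> > d\<close>, the squares \<open>|x|\<^bsup>-2\<alpha>\<^esup>\<close> are summable over the translates, with a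
  sum of order \<open>\<nu>\<^bsup>2\<alpha>\<^esup>\<close>. So the Cauchy--Schwarz inequality, which pairs these factors with the values of
  \<open>|\<omega>|\<^sup>s|f\<^sup>^|\<close> in \<open>\<ell>\<^sup>2\<close>, bounds their contribution to the band \<open>(j, k)\<close> by a multiple of
  \<open>q\<^bsup>2|j|\<^esup> \<nu>\<^bsup>2\<alpha>\<^esup> |f|\<^sub>s\<^sup>2\<close> (\<open>band_estimate\<close>). The geometric factor makes the total error a multiple of
  \<open>\<nu>\<^bsup>2\<alpha>\<^esup>|f|\<^sub>s\<^sup>2\<close>, which is harmless for small \<open>\<nu>\<close>. The central terms add up to an integral of \<open>|f\<^sup>^|\<^sup>2\<close> against
  \<open>\<Sum> 2\<^bsup>2js\<^esup>|\<Phi>\<^sub>j\<^sub>,\<^sub>k(\<omega>)|\<^sup>2\<close>. This sum is at most a multiple of \<open>|\<omega>|\<^bsup>2s\<^esup>\<close>, because boundedly many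
  bands have \<open>|x|\<close> comparable to 1 and the rest form a geometric series (\<open>band_square_sum\<close>). It is at least
  a multiple of \<open>|\<omega>|\<^bsup>2s\<^esup>\<close> because almost every \<open>\<omega>\<close> lies in a set \<open>I\<^sub>j\<^sub>,\<^sub>k\<close>, so that
  \<open>|\<omega>|\<close> is comparable to \<open>2\<^sup>j\<close>, for which \<open>|\<Phi>\<^sub>j\<^sub>,\<^sub>k(\<omega>)| \<ge> a\<close>.

  Parseval's identity on the unit cell comes from the density of trigonometric polynomials, which is the
  Stone--Weierstrass theorem on the torus followed by a Dynkin argument. Plancherel's theorem follows from it.
  If the support of \<open>f\<close> fits into one period, the identity applied to \<open>f\<close> times the character with frequency
  \<open>\<theta>\<close> says that the values of \<open>|f\<^sup>^|\<^sup>2\<close> on a shifted lattice have a sum independent of the shift,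
  and integrating over all shifts \<open>\<theta>\<close> in a cell gives the integral of \<open>|f\<^sup>^|\<^sup>2\<close> over the whole space.\<close>

section \<open>Tiling space by lattice translates of a cell\<close>

lemma countable_int_lattice: "countable (int_lattice :: (real^'n) set)"
proof -
  have "(int_lattice :: (real^'n) set) \<subseteq> (\<lambda>f. \<chi> i. of_int (f i)) ` (PiE UNIV (\<lambda>_. UNIV :: int set))"
  proof
    fix x :: "real^'n" assume "x \<in> int_lattice"
    then have "x = (\<chi> i. of_int \<lfloor>x $ i\<rfloor>)"
      by (auto simp: int_lattice_def vec_eq_iff elim!: Ints_cases)
    then show "x \<in> (\<lambda>f. \<chi> i. of_int (f i)) ` (PiE UNIV (\<lambda>_. UNIV :: int set))"
      by (intro image_eqI[where x="\<lambda>i. \<lfloor>x $ i\<rfloor>"]) auto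
  qed
  then show ?thesis
    by (rule countable_subset) (intro countable_image countable_PiE, auto)
qed

lemma int_lattice_add: "m \<in> int_lattice \<Longrightarrow> n \<in> int_lattice \<Longrightarrow> m + n \<in> int_lattice"
  and int_lattice_diff: "m \<in> int_lattice \<Longrightarrow> n \<in> int_lattice \<Longrightarrow> m - n \<in> int_lattice"
  and int_lattice_uminus: "m \<in> int_lattice \<Longrightarrow> - m \<in> int_lattice"
  and int_lattice_0: "0 \<in> int_lattice"
  by (auto simp: int_lattice_def)

lemma int_lattice_inner: "m \<in> int_lattice \<Longrightarrow> n \<in> int_lattice \<Longrightarrow> m \<bullet> n \<in> \<int>"
  unfolding inner_vec_def by (intro Ints_sum) (auto simp: int_lattice_def intro!: Ints_mult)

text \<open>Half-open, so that its lattice translates are disjoint, and centred, so that it contains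
  every point of norm less than \<open>1/2\<close>.\<close>

definition unit_cell :: "(real^'n) set" where
  "unit_cell = {x. \<forall>i. - 1/2 \<le> x $ i \<and> x $ i < 1/2}"

lemma sets_unit_cell [measurable]: "unit_cell \<in> sets borel"
proof -
  have "unit_cell = (\<Inter>i::'n. {x :: real^'n. - 1/2 \<le> x $ i \<and> x $ i < 1/2})"
    by (auto simp: unit_cell_def)
  also have "\<dots> \<in> sets borel"
    by (intro sets.finite_INT) (auto)
  finally show ?thesis .
qed

lemma unit_cell_ex1: "\<exists>!n. n \<in> int_lattice \<and> x - n \<in> unit_cell"
proof (rule ex1I[where a="\<chi> i. of_int \<lfloor>x $ i + 1/2\<rfloor>"], intro conjI)
  show "(\<chi> i. of_int \<lfloor>x $ i + 1/2\<rfloor>) \<in> int_lattice"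
    by (auto simp: int_lattice_def)
  show "x - (\<chi> i. of_int \<lfloor>x $ i + 1/2\<rfloor>) \<in> unit_cell"
  proof -
    have "- 1/2 \<le> x $ i - of_int \<lfloor>x $ i + 1/2\<rfloor> \<and> x $ i - of_int \<lfloor>x $ i + 1/2\<rfloor> < 1/2" for i
      by linarith
    then show ?thesis by (auto simp: unit_cell_def)
  qed
next
  fix n assume n: "n \<in> int_lattice \<and> x - n \<in> unit_cell"
  show "n = (\<chi> i. of_int \<lfloor>x $ i + 1/2\<rfloor>)"
  proof (simp add: vec_eq_iff, intro allI)
    fix i
    from n obtain z where z: "n $ i = of_int z" by (auto simp: int_lattice_def elim!: Ints_cases)
    from n have "- 1/2 \<le> x $ i - n $ i" "x $ i - n $ i < 1/2" by (auto simp: unit_cell_def)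
    then have "\<lfloor>x $ i + 1/2\<rfloor> = z" unfolding z by linarith
    then show "n $ i = of_int \<lfloor>x $ i + 1/2\<rfloor>" using z by simp
  qed
qed

lemma nn_integral_unit_cell_indicator:
  fixes x :: "real^'n"
  shows "(\<integral>\<^sup>+n. indicator unit_cell (x - n) \<partial>count_space int_lattice) = 1"
proof -
  obtain m where m: "m \<in> int_lattice" "x - m \<in> unit_cell"
    "\<And>n. n \<in> int_lattice \<Longrightarrow> x - n \<in> unit_cell \<Longrightarrow> n = m"
    using unit_cell_ex1[of x] by blast
  have "(\<integral>\<^sup>+n. indicator unit_cell (x - n) \<partial>count_space int_lattice) =
        (\<integral>\<^sup>+n. indicator {m} n \<partial>count_space int_lattice)"
  proof (intro nn_integral_cong)
    fix n assume "n \<in> space (count_space (int_lattice :: (real^'n) set))"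
    then have "x - n \<in> unit_cell \<longleftrightarrow> n = m" using m(2) m(3)[of n] by auto
    then show "indicator unit_cell (x - n) = (indicator {m} n :: ennreal)" by (simp add: indicator_def)
  qed
  also have "\<dots> = 1" using m(1) by (subst nn_integral_indicator) auto
  finally show ?thesis .
qed

lemma nn_integral_lborel_affine:
  fixes f :: "'a::euclidean_space \<Rightarrow> ennreal"
  assumes [measurable]: "f \<in> borel_measurable borel" and c: "c \<noteq> 0"
  shows "(\<integral>\<^sup>+x. f x \<partial>lborel) = ennreal (\<bar>c\<bar> ^ DIM('a)) * (\<integral>\<^sup>+x. f (t + c *\<^sub>R x) \<partial>lborel)"
proof -
  have "(\<integral>\<^sup>+x. f x \<partial>lborel) =
      (\<integral>\<^sup>+x. f x \<partial>density (distr lborel borel (\<lambda>x. t + c *\<^sub>R x)) (\<lambda>_. ennreal (\<bar>c\<bar> ^ DIM('a))))"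
    using lborel_affine[OF c, of t] by simp
  also have "\<dots> = ennreal (\<bar>c\<bar> ^ DIM('a)) * (\<integral>\<^sup>+x. f (t + c *\<^sub>R x) \<partial>lborel)"
    by (simp add: nn_integral_density nn_integral_distr nn_integral_cmult)
  finally show ?thesis .
qed

lemma lborel_integral_affine:
  fixes f :: "'a::euclidean_space \<Rightarrow> complex"
  assumes [measurable]: "f \<in> borel_measurable borel" and c: "c \<noteq> 0"
  shows "(LINT x|lborel. f x) = of_real (\<bar>c\<bar> ^ DIM('a)) * (LINT x|lborel. f (t + c *\<^sub>R x))"
proof -
  have "(LINT x|lborel. f x) =
      (LINT x|density (distr lborel borel (\<lambda>x. t + c *\<^sub>R x)) (\<lambda>_. ennreal (\<bar>c\<bar> ^ DIM('a))). f x)"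
    using lborel_affine[OF c, of t] by simp
  also have "\<dots> = of_real (\<bar>c\<bar> ^ DIM('a)) * (LINT x|lborel. f (t + c *\<^sub>R x))"
    by (simp add: integral_density integral_distr scaleR_conv_of_real)
  finally show ?thesis .
qed

lemma integrable_lborel_dilation:
  fixes G :: "'a::euclidean_space \<Rightarrow> complex"
  assumes G: "integrable lborel G" and p: "0 < p"
  shows "integrable lborel (\<lambda>x. G (p *\<^sub>R x))"
proof (rule integrableI_bounded)
  have [measurable]: "G \<in> borel_measurable borel" using G by auto
  then show "(\<lambda>x. G (p *\<^sub>R x)) \<in> borel_measurable lborel" by measurable
  have "(\<integral>\<^sup>+x. ennreal (norm (G x)) \<partial>lborel) =
    ennreal (\<bar>p\<bar> ^ DIM('a)) * (\<integral>\<^sup>+x. ennreal (norm (G (0 + p *\<^sub>R x))) \<partial>lborel)"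
    using p by (intro nn_integral_lborel_affine) auto
  with G p show "(\<integral>\<^sup>+x. ennreal (norm (G (p *\<^sub>R x))) \<partial>lborel) < \<infinity>"
    by (auto simp: integrable_iff_bounded ennreal_mult_less_top)
qed

lemma nn_integral_lborel_translate:
  fixes f :: "'a::euclidean_space \<Rightarrow> ennreal"
  assumes [measurable]: "f \<in> borel_measurable borel"
  shows "(\<integral>\<^sup>+x. f (x + t) \<partial>lborel) = (\<integral>\<^sup>+x. f x \<partial>lborel)"
  using nn_integral_lborel_affine[of f 1 t] by (simp add: add.commute)

abbreviation cell_measure :: "(real^'n) measure" where
  "cell_measure \<equiv> restrict_space lborel unit_cell"

lemma measurable_cell [measurable (raw)]:
  "f \<in> borel_measurable borel \<Longrightarrow> f \<in> borel_measurable cell_measure"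
  by (simp add: measurable_restrict_space1)

lemma sigma_finite_cell_measure: "sigma_finite_measure cell_measure"
  by (rule sigma_finite_measure_restrict_space) (auto intro: lborel.sigma_finite_measure_axioms)

lemma sigma_finite_int_lattice: "sigma_finite_measure (count_space int_lattice)"
  by (rule sigma_finite_measure_count_space_countable[OF countable_int_lattice])

lemma measurable_count_lattice:
  fixes h :: "real^'n \<Rightarrow> real^'m \<Rightarrow> 'b"
  assumes "\<And>n. n \<in> int_lattice \<Longrightarrow> (\<lambda>x. h x n) \<in> measurable M N"
  shows "(\<lambda>(x, n). h x n) \<in> measurable (M \<Otimes>\<^sub>M count_space int_lattice) N"
proof -
  have "(\<lambda>z. h (fst z) (snd z)) \<in> measurable (M \<Otimes>\<^sub>M count_space int_lattice) N"
    by (rule measurable_compose_countable'[where f="\<lambda>n z. h (fst z) n" and g=snd, OF _ _ countable_int_lattice])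
       (auto intro: measurable_compose[OF measurable_fst assms])
  then show ?thesis by (simp add: case_prod_unfold)
qed

text \<open>Insert \<open>1 = \<Sum> indicator unit_cell (x - n)\<close> under the integral, exchange
  sum and integral, and translate each term back to the cell.\<close>

lemma nn_integral_tiling:
  fixes h :: "real^'n \<Rightarrow> ennreal"
  assumes [measurable]: "h \<in> borel_measurable borel"
  shows "(\<integral>\<^sup>+x. h x \<partial>lborel) =
         (\<integral>\<^sup>+y. (\<integral>\<^sup>+n. h (y + n) \<partial>count_space int_lattice) \<partial>cell_measure)"
proof -
  interpret P: pair_sigma_finite lborel "count_space (int_lattice :: (real^'n) set)"
    by (intro pair_sigma_finite.intro lborel.sigma_finite_measure_axioms sigma_finite_int_lattice)
  interpret P2: pair_sigma_finite cell_measure "count_space (int_lattice :: (real^'n) set)"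
    by (intro pair_sigma_finite.intro sigma_finite_cell_measure sigma_finite_int_lattice)
  have "(\<integral>\<^sup>+x. h x \<partial>lborel) =
        (\<integral>\<^sup>+x. (\<integral>\<^sup>+n. h x * indicator unit_cell (x - n) \<partial>count_space int_lattice) \<partial>lborel)"
    by (subst nn_integral_cmult) (simp_all add: nn_integral_unit_cell_indicator)
  also have "\<dots> = (\<integral>\<^sup>+n. (\<integral>\<^sup>+x. h x * indicator unit_cell (x - n) \<partial>lborel) \<partial>count_space int_lattice)"
    by (rule P.Fubini'[symmetric, OF measurable_count_lattice]) measurable
  also have "\<dots> = (\<integral>\<^sup>+n. (\<integral>\<^sup>+y. h (y + n) \<partial>cell_measure) \<partial>count_space int_lattice)"
  proof (intro nn_integral_cong)
    fix n :: "real^'n"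
    show "(\<integral>\<^sup>+x. h x * indicator unit_cell (x - n) \<partial>lborel) = (\<integral>\<^sup>+y. h (y + n) \<partial>cell_measure)"
      by (subst nn_integral_lborel_translate[where t=n, symmetric])
         (simp_all add: nn_integral_restrict_space)
  qed
  also have "\<dots> = (\<integral>\<^sup>+y. (\<integral>\<^sup>+n. h (y + n) \<partial>count_space int_lattice) \<partial>cell_measure)"
    by (rule P2.Fubini'[OF measurable_count_lattice]) measurable
  finally show ?thesis .
qed

text \<open>An identity of measures makes Fubini's theorem for complex integrands on the product of cell
  and lattice available.\<close>

lemma lborel_eq_distr_tiling:
  "(lborel :: (real^'n) measure) =
     distr (cell_measure \<Otimes>\<^sub>M count_space int_lattice) borel (\<lambda>(y, n). y + n)"
proof (rule measure_eqI)
  interpret sigma_finite_measure "count_space (int_lattice :: (real^'n) set)"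
    by (rule sigma_finite_int_lattice)
  have [measurable]: "(\<lambda>(y, n). y + n) \<in> (cell_measure \<Otimes>\<^sub>M count_space int_lattice) \<rightarrow>\<^sub>M (borel :: (real^'n) measure)"
    by (rule measurable_count_lattice) (intro measurable_restrict_space1, measurable)
  fix A :: "(real^'n) set" assume "A \<in> sets lborel"
  then have A[measurable]: "A \<in> sets borel" by simp
  have "emeasure lborel A = (\<integral>\<^sup>+x. indicator A x \<partial>lborel)" by simp
  also have "\<dots> = (\<integral>\<^sup>+y. (\<integral>\<^sup>+n. indicator A (y + n) \<partial>count_space int_lattice) \<partial>cell_measure)"
    by (rule nn_integral_tiling) measurable
  also have "\<dots> = (\<integral>\<^sup>+z. (case z of (y, n) \<Rightarrow> indicator A (y + n)) \<partial>(cell_measure \<Otimes>\<^sub>M count_space int_lattice))"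
    by (subst nn_integral_fst[symmetric]) (auto intro!: measurable_count_lattice)
  also have "\<dots> = (\<integral>\<^sup>+z. indicator A ((\<lambda>(y, n). y + n) z) \<partial>(cell_measure \<Otimes>\<^sub>M count_space int_lattice))"
    by (intro nn_integral_cong) (auto split: prod.split)
  also have "\<dots> = (\<integral>\<^sup>+x. indicator A x \<partial>distr (cell_measure \<Otimes>\<^sub>M count_space int_lattice) borel (\<lambda>(y, n). y + n))"
    by (subst nn_integral_distr) simp_all
  also have "\<dots> = emeasure (distr (cell_measure \<Otimes>\<^sub>M count_space int_lattice) borel (\<lambda>(y, n). y + n)) A"
    by (subst nn_integral_indicator) simp_all
  finally show "emeasure lborel A = \<dots>" .
qed simp

lemma integral_tiling:
  fixes G :: "real^'n \<Rightarrow> complex"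
  assumes G: "integrable lborel G"
  shows "integrable cell_measure (\<lambda>y. LINT n|count_space int_lattice. G (y + n))"
    and "(LINT x|lborel. G x) = (LINT y|cell_measure. LINT n|count_space int_lattice. G (y + n))"
proof -
  interpret P: pair_sigma_finite cell_measure "count_space (int_lattice :: (real^'n) set)"
    by (intro pair_sigma_finite.intro sigma_finite_cell_measure sigma_finite_int_lattice)
  have [measurable]: "(\<lambda>(y, n). y + n) \<in> (cell_measure \<Otimes>\<^sub>M count_space int_lattice) \<rightarrow>\<^sub>M (borel :: (real^'n) measure)"
    by (rule measurable_count_lattice) (intro measurable_restrict_space1, measurable)
  have [measurable]: "G \<in> borel_measurable borel" using G by auto
  have I: "integrable (cell_measure \<Otimes>\<^sub>M count_space int_lattice) (\<lambda>z. G ((\<lambda>(y, n). y + n) z))"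
    using G by (subst (asm) lborel_eq_distr_tiling, subst (asm) integrable_distr_eq) auto
  then have I': "integrable (cell_measure \<Otimes>\<^sub>M count_space int_lattice) (\<lambda>(y, n). G (y + n))"
    by (simp add: case_prod_unfold)
  show "integrable cell_measure (\<lambda>y. LINT n|count_space int_lattice. G (y + n))"
    using P.integrable_fst[OF I'] .
  have "(LINT x|lborel. G x) = (LINT z|(cell_measure \<Otimes>\<^sub>M count_space int_lattice). G ((\<lambda>(y, n). y + n) z))"
    by (subst lborel_eq_distr_tiling, subst integral_distr) auto
  also have "\<dots> = (LINT z|(cell_measure \<Otimes>\<^sub>M count_space int_lattice). (case z of (y, n) \<Rightarrow> G (y + n)))"
    by (intro Bochner_Integration.integral_cong) auto
  also have "\<dots> = (LINT y|cell_measure. LINT n|count_space int_lattice. G (y + n))"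
    using P.integral_fst'[OF I'] by simp
  finally show "(LINT x|lborel. G x) = (LINT y|cell_measure. LINT n|count_space int_lattice. G (y + n))" .
qed

lemma emeasure_unit_cell: "emeasure lborel (unit_cell :: (real^'n) set) = 1"
proof -
  let ?a = "(\<chi> i. -1/2) :: real^'n" and ?b = "(\<chi> i. 1/2) :: real^'n"
  have b: "(?b - ?a) \<bullet> b = 1 \<and> ?a \<bullet> b \<le> ?b \<bullet> b" if "b \<in> Basis" for b
  proof -
    from that obtain i where "b = axis i 1" by (auto simp: Basis_vec_def)
    then show ?thesis by (simp add: inner_axis)
  qed
  have "emeasure lborel (box ?a ?b) = ennreal (\<Prod>b\<in>Basis. (?b - ?a) \<bullet> b)"
    using b by (intro emeasure_lborel_box) blast
  also have "(\<Prod>b\<in>Basis. (?b - ?a) \<bullet> b) = 1" using b by (intro prod.neutral) auto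
  finally have 1: "emeasure lborel (box ?a ?b) = 1" by simp
  have "emeasure lborel (cbox ?a ?b) = ennreal (\<Prod>b\<in>Basis. (?b - ?a) \<bullet> b)"
    using b by (intro emeasure_lborel_cbox) blast
  also have "(\<Prod>b\<in>Basis. (?b - ?a) \<bullet> b) = 1" using b by (intro prod.neutral) auto
  finally have 2: "emeasure lborel (cbox ?a ?b) = 1" by simp
  have "emeasure lborel (box ?a ?b) \<le> emeasure lborel (unit_cell :: (real^'n) set)"
    by (intro emeasure_mono) (auto simp: unit_cell_def mem_box_cart less_imp_le)
  moreover have "emeasure lborel (unit_cell :: (real^'n) set) \<le> emeasure lborel (cbox ?a ?b)"
    by (intro emeasure_mono) (auto simp: unit_cell_def mem_box_cart less_imp_le)
  ultimately show ?thesis using 1 2 by simp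
qed

section \<open>Characters and Parseval's identity on the cell\<close>

definition wave :: "real^'n \<Rightarrow> real^'n \<Rightarrow> complex" where
  "wave m x = cis (2 * pi * (m \<bullet> x))"

lemma wave_0 [simp]: "wave 0 x = 1" "wave m 0 = 1"
  and norm_wave [simp]: "cmod (wave m x) = 1"
  and cnj_wave: "cnj (wave m x) = wave (- m) x"
  and wave_mult: "wave m x * wave n x = wave (m + n) x"
  and wave_add: "wave m (x + y) = wave m x * wave m y"
  by (simp_all add: wave_def cis_mult cis_cnj algebra_simps inner_add inner_commute)

lemma wave_lattice: "m \<in> int_lattice \<Longrightarrow> n \<in> int_lattice \<Longrightarrow> wave m n = 1"
  using int_lattice_inner[of m n] by (auto simp: wave_def elim!: Ints_cases intro!: cis_multiple_2pi)

lemma continuous_on_wave [continuous_intros]: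
  "continuous_on S f \<Longrightarrow> continuous_on S (\<lambda>x. wave m (f x))"
  unfolding wave_def by (intro continuous_intros)

lemma borel_measurable_wave [measurable]: "wave m \<in> borel_measurable borel"
  by (intro borel_measurable_continuous_onI continuous_intros)

text \<open>Translating by a vector \<open>a\<close> does not change the integral of a periodic function
  over a cell. If \<open>m \<noteq> 0\<close>, choose \<open>a\<close> with \<open>m \<bullet> a =
  1/2\<close>; then the translation multiplies the character by \<open>-1\<close>, and the integral
  vanishes.\<close>

lemma integral_wave:
  fixes m :: "real^'n"
  assumes m: "m \<in> int_lattice"
  shows "(LINT y|cell_measure. wave m y) = (if m = 0 then 1 else 0)"
proof (cases "m = 0")
  case True
  have "measure cell_measure (unit_cell :: (real^'n) set) = 1"
    by (simp add: measure_def emeasure_restrict_space emeasure_unit_cell)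
  with True show ?thesis by (simp add: space_restrict_space)
next
  case False
  then obtain i where i: "m $ i \<noteq> 0" by (auto simp: vec_eq_iff)
  define a :: "real^'n" where "a = axis i (1 / (2 * m $ i))"
  have "wave m a = -1" using i by (simp add: wave_def a_def inner_axis)
  define G where "G = (\<lambda>x. indicator unit_cell (x - a) *\<^sub>R wave m x)"
  have G[measurable]: "G \<in> borel_measurable borel" unfolding G_def by measurable
  have [measurable]: "(\<lambda>x. x - a) -` unit_cell \<in> sets borel"
    using measurable_sets[OF _ sets_unit_cell, of "\<lambda>x. x - a" borel] by simp
  have fin: "emeasure lborel ((\<lambda>x. x - a) -` unit_cell) < \<infinity>"
  proof -
    have "emeasure lborel ((\<lambda>x. x - a) -` unit_cell) =
          (\<integral>\<^sup>+x. indicator unit_cell (x - a) \<partial>lborel)"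
      by (simp flip: nn_integral_indicator add: indicator_vimage)
    also have "\<dots> = (\<integral>\<^sup>+x. indicator unit_cell (x :: real^'n) \<partial>lborel)"
      using nn_integral_lborel_translate[of "indicator unit_cell" "-a"] by (simp del: nn_integral_indicator)
    also have "\<dots> = 1" by (simp add: emeasure_unit_cell)
    finally show ?thesis by simp
  qed
  have GI: "integrable lborel G"
    unfolding G_def
    by (rule Bochner_Integration.integrable_bound[where f="indicator ((\<lambda>x. x - a) -` unit_cell) :: _ \<Rightarrow> real"])
       (use fin in \<open>auto simp: indicator_def\<close>)
  have "(LINT x|lborel. G x) = (LINT x|lborel. G (a + x))"
    using lborel_integral_affine[OF G, of 1 a] by simp
  also have "\<dots> = (LINT x|lborel. indicator unit_cell x *\<^sub>R (- wave m x))"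
    by (intro Bochner_Integration.integral_cong) (auto simp: G_def wave_add \<open>wave m a = -1\<close>)
  also have "\<dots> = - (LINT y|cell_measure. wave m y)"
    by (subst integral_restrict_space) auto
  finally have 1: "(LINT x|lborel. G x) = - (LINT y|cell_measure. wave m y)" .
  have "(LINT n|count_space int_lattice. G (y + n)) = wave m y" for y
  proof -
    obtain k where k: "k \<in> int_lattice" "(y - a) - k \<in> unit_cell"
      "\<And>n. n \<in> int_lattice \<Longrightarrow> (y - a) - n \<in> unit_cell \<Longrightarrow> n = k"
      using unit_cell_ex1[of "y - a"] by blast
    have eq: "y + n - a \<in> unit_cell \<longleftrightarrow> n = - k" if "n \<in> int_lattice" for n
      using k(2) k(3)[of "- n"] int_lattice_uminus[OF that] by (auto simp: algebra_simps)
    have "(LINT n|count_space int_lattice. G (y + n)) =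
          (LINT n|count_space int_lattice. indicator {- k} n *\<^sub>R wave m y)"
      using eq m by (intro Bochner_Integration.integral_cong)
         (auto simp: G_def indicator_def wave_add wave_lattice)
    also have "\<dots> = wave m y"
    proof -
      have "wave m y \<noteq> 0" using norm_wave[of m y] by force
      then have "{n \<in> int_lattice. indicator {- k} n *\<^sub>R wave m y \<noteq> 0} = {- k}"
        using int_lattice_uminus[OF k(1)] by (auto simp: indicator_def)
      then show ?thesis by (subst lebesgue_integral_count_space_finite_support) auto
    qed
    finally show ?thesis .
  qed
  then have 2: "(LINT x|lborel. G x) = (LINT y|cell_measure. wave m y)"
    using integral_tiling(2)[OF GI] by simp
  show ?thesis using 1 2 False by (simp add: eq_neg_iff_add_eq_0)
qed

inductive_set trig_span :: "(real^'n \<Rightarrow> complex) set" where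
  wave: "m \<in> int_lattice \<Longrightarrow> (\<lambda>x. c * wave m x) \<in> trig_span"
| add: "f \<in> trig_span \<Longrightarrow> g \<in> trig_span \<Longrightarrow> (\<lambda>x. f x + g x) \<in> trig_span"

lemma trig_span_measurable [measurable_dest]: "f \<in> trig_span \<Longrightarrow> f \<in> borel_measurable borel"
  by (induction rule: trig_span.induct) auto

lemma trig_span_const: "(\<lambda>x. c) \<in> trig_span"
  using trig_span.wave[OF int_lattice_0, of c] by simp

lemma trig_span_wave_mult:
  assumes "f \<in> trig_span" "m \<in> int_lattice"
  shows "(\<lambda>x. c * wave m x * f x) \<in> trig_span"
  using assms
proof (induction rule: trig_span.induct)
  case (wave n d)
  have "(\<lambda>x. c * wave m x * (d * wave n x)) = (\<lambda>x. (c * d) * wave (m + n) x)"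
    by (auto simp: fun_eq_iff wave_mult[symmetric])
  then show ?case using wave by (auto intro: trig_span.wave int_lattice_add)
next
  case (add f g)
  then show ?case by (auto simp: ring_distribs intro: trig_span.add)
qed

lemma trig_span_mult:
  assumes "f \<in> trig_span" "g \<in> trig_span"
  shows "(\<lambda>x. f x * g x) \<in> trig_span"
  using assms
proof (induction rule: trig_span.induct)
  case (wave n d)
  then show ?case by (intro trig_span_wave_mult)
next
  case (add f g)
  then show ?case by (auto simp: ring_distribs intro: trig_span.add)
qed

lemma trig_span_cmult: "f \<in> trig_span \<Longrightarrow> (\<lambda>x. c * f x) \<in> trig_span"
  using trig_span_mult[OF trig_span_const] .

lemma trig_span_sum:
  "finite A \<Longrightarrow> (\<And>i. i \<in> A \<Longrightarrow> f i \<in> trig_span) \<Longrightarrow> (\<lambda>x. \<Sum>i\<in>A. f i x) \<in> trig_span"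
  by (induction rule: finite_induct) (auto intro: trig_span.add trig_span_const)

lemma trig_span_finite_sum:
  assumes "f \<in> trig_span"
  shows "\<exists>F a. finite F \<and> F \<subseteq> int_lattice \<and> f = (\<lambda>x. \<Sum>m\<in>F. a m * wave m x)"
  using assms
proof (induction rule: trig_span.induct)
  case (wave m c)
  then show ?case by (intro exI[of _ "{m}"] exI[of _ "\<lambda>_. c"]) auto
next
  case (add f g)
  then obtain F a G b where *: "finite F" "F \<subseteq> int_lattice" "f = (\<lambda>x. \<Sum>m\<in>F. a m * wave m x)"
    "finite G" "G \<subseteq> int_lattice" "g = (\<lambda>x. \<Sum>m\<in>G. b m * wave m x)" by blast
  have "(\<Sum>m\<in>F. a m * wave m x) = (\<Sum>m\<in>F \<union> G. (if m \<in> F then a m else 0) * wave m x)" for x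
    using * by (intro sum.mono_neutral_cong_left) auto
  moreover have "(\<Sum>m\<in>G. b m * wave m x) = (\<Sum>m\<in>F \<union> G. (if m \<in> G then b m else 0) * wave m x)" for x
    using * by (intro sum.mono_neutral_cong_left) auto
  ultimately have "(\<lambda>x. f x + g x) = (\<lambda>x. \<Sum>m\<in>F\<union>G.
      ((if m \<in> F then a m else 0) + (if m \<in> G then b m else 0)) * wave m x)"
    by (simp add: * sum.distrib distrib_right)
  with * show ?case by (intro exI[of _ "F \<union> G"]) auto
qed

abbreviation sq_integral :: "'a measure \<Rightarrow> ('a \<Rightarrow> complex) \<Rightarrow> ennreal" where
  "sq_integral M f \<equiv> (\<integral>\<^sup>+x. ennreal ((cmod (f x))\<^sup>2) \<partial>M)"

lemma cmod_add_sq_le: "(cmod (a + b))\<^sup>2 \<le> 2 * (cmod a)\<^sup>2 + 2 * (cmod b)\<^sup>2"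
proof -
  have "(cmod (a + b))\<^sup>2 \<le> (cmod a + cmod b)\<^sup>2" by (intro power_mono norm_triangle_ineq) auto
  also have "\<dots> \<le> 2 * (cmod a)\<^sup>2 + 2 * (cmod b)\<^sup>2"
    using sum_squares_bound[of "cmod a" "cmod b"] by (simp add: power2_eq_square algebra_simps)
  finally show ?thesis .
qed

lemma nn_integral_sq_add_le:
  assumes [measurable]: "f \<in> borel_measurable M" "g \<in> borel_measurable M"
  shows "(sq_integral M (\<lambda>x. f x + g x)) \<le>
    2 * (sq_integral M f) + 2 * (sq_integral M g)"
proof -
  have "(sq_integral M (\<lambda>x. f x + g x)) \<le>
    (\<integral>\<^sup>+x. 2 * ennreal ((cmod (f x))\<^sup>2) + 2 * ennreal ((cmod (g x))\<^sup>2) \<partial>M)"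
  proof (intro nn_integral_mono)
    fix x
    have "ennreal ((cmod (f x + g x))\<^sup>2) \<le> ennreal (2 * (cmod (f x))\<^sup>2 + 2 * (cmod (g x))\<^sup>2)"
      by (intro ennreal_leI cmod_add_sq_le)
    then show "ennreal ((cmod (f x + g x))\<^sup>2) \<le> 2 * ennreal ((cmod (f x))\<^sup>2) + 2 * ennreal ((cmod (g x))\<^sup>2)"
      by (simp add: ennreal_plus ennreal_mult)
  qed
  also have "\<dots> = 2 * (sq_integral M f) + 2 * (sq_integral M g)"
    by (subst nn_integral_add) (auto simp: nn_integral_cmult)
  finally show ?thesis .
qed

text \<open>Membership in the \<open>L\<^sup>2\<close>-closure of the trigonometric polynomials.\<close>

definition trig_approx :: "(real^'n \<Rightarrow> complex) \<Rightarrow> bool" where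
  "trig_approx f \<longleftrightarrow> f \<in> borel_measurable borel \<and>
     (\<forall>\<epsilon>>0. \<exists>p\<in>trig_span. (sq_integral cell_measure (\<lambda>y. f y - p y)) \<le> ennreal \<epsilon>)"

lemma trig_approx_trig: "p \<in> trig_span \<Longrightarrow> trig_approx p"
  unfolding trig_approx_def by (intro conjI allI impI bexI[of _ p]) (auto dest: trig_span_measurable)

lemma trig_approx_lim:
  assumes f[measurable]: "f \<in> borel_measurable borel"
    and "\<And>\<epsilon>. 0 < \<epsilon> \<Longrightarrow> \<exists>g. trig_approx g \<and> (sq_integral cell_measure (\<lambda>y. f y - g y)) \<le> ennreal \<epsilon>"
  shows "trig_approx f"
  unfolding trig_approx_def
proof (intro conjI f allI impI)
  fix \<epsilon> :: real assume "0 < \<epsilon>"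
  with assms(2)[of "\<epsilon> / 4"] obtain g where g: "trig_approx g"
    "(sq_integral cell_measure (\<lambda>y. f y - g y)) \<le> ennreal (\<epsilon> / 4)" by auto
  from g(1) have [measurable]: "g \<in> borel_measurable borel" by (simp add: trig_approx_def)
  from g(1) \<open>0 < \<epsilon>\<close> obtain p where p: "p \<in> trig_span"
    "(sq_integral cell_measure (\<lambda>y. g y - p y)) \<le> ennreal (\<epsilon> / 4)"
    unfolding trig_approx_def by (meson divide_pos_pos zero_less_numeral)
  note [measurable] = trig_span_measurable[OF p(1)]
  have "(sq_integral cell_measure (\<lambda>y. (f y - g y) + (g y - p y))) \<le>
     2 * (sq_integral cell_measure (\<lambda>y. f y - g y)) + 2 * (sq_integral cell_measure (\<lambda>y. g y - p y))"
    by (rule nn_integral_sq_add_le) auto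
  also have "\<dots> \<le> 2 * ennreal (\<epsilon> / 4) + 2 * ennreal (\<epsilon> / 4)"
    by (intro add_mono mult_left_mono g p) auto
  also have "\<dots> = ennreal \<epsilon>"
    using \<open>0 < \<epsilon>\<close> by (simp add: ennreal_mult'[symmetric] ennreal_plus[symmetric] flip: ennreal_numeral del: ennreal_plus)
  finally show "\<exists>p\<in>trig_span. (sq_integral cell_measure (\<lambda>y. f y - p y)) \<le> ennreal \<epsilon>"
    using p by auto
qed

lemma trig_approx_add:
  assumes "trig_approx f" "trig_approx g"
  shows "trig_approx (\<lambda>x. f x + g x)"
  unfolding trig_approx_def
proof (intro conjI allI impI)
  from assms have [measurable]: "f \<in> borel_measurable borel" "g \<in> borel_measurable borel"
    by (simp_all add: trig_approx_def)
  show "(\<lambda>x. f x + g x) \<in> borel_measurable borel" by measurable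
  fix \<epsilon> :: real assume "0 < \<epsilon>"
  with assms obtain p q where p: "p \<in> trig_span"
    "(sq_integral cell_measure (\<lambda>y. f y - p y)) \<le> ennreal (\<epsilon> / 4)"
    and q: "q \<in> trig_span"
    "(sq_integral cell_measure (\<lambda>y. g y - q y)) \<le> ennreal (\<epsilon> / 4)"
    unfolding trig_approx_def by (meson divide_pos_pos zero_less_numeral)
  note [measurable] = trig_span_measurable[OF p(1)] trig_span_measurable[OF q(1)]
  have "(sq_integral cell_measure (\<lambda>y. (f y - p y) + (g y - q y))) \<le>
     2 * (sq_integral cell_measure (\<lambda>y. f y - p y)) + 2 * (sq_integral cell_measure (\<lambda>y. g y - q y))"
    by (rule nn_integral_sq_add_le) auto
  also have "\<dots> \<le> 2 * ennreal (\<epsilon> / 4) + 2 * ennreal (\<epsilon> / 4)"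
    by (intro add_mono mult_left_mono p q) auto
  also have "\<dots> = ennreal \<epsilon>"
    using \<open>0 < \<epsilon>\<close> by (simp add: ennreal_mult'[symmetric] ennreal_plus[symmetric] flip: ennreal_numeral del: ennreal_plus)
  finally show "\<exists>p\<in>trig_span. (sq_integral cell_measure (\<lambda>y. f y + g y - p y)) \<le> ennreal \<epsilon>"
    using p q by (intro bexI[of _ "\<lambda>x. p x + q x"]) (auto intro: trig_span.add simp: algebra_simps)
qed

lemma trig_approx_cmult:
  assumes "trig_approx f"
  shows "trig_approx (\<lambda>x. c * f x)"
  unfolding trig_approx_def
proof (intro conjI allI impI)
  from assms have [measurable]: "f \<in> borel_measurable borel"
    by (simp_all add: trig_approx_def)
  show "(\<lambda>x. c * f x) \<in> borel_measurable borel" by measurable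
  fix \<epsilon> :: real assume "0 < \<epsilon>"
  have pos: "0 < (cmod c)\<^sup>2 + 1" by (simp add: add_nonneg_pos)
  with assms \<open>0 < \<epsilon>\<close> obtain p where p: "p \<in> trig_span"
    "(sq_integral cell_measure (\<lambda>y. f y - p y)) \<le> ennreal (\<epsilon> / ((cmod c)\<^sup>2 + 1))"
    unfolding trig_approx_def by (meson divide_pos_pos)
  note [measurable] = trig_span_measurable[OF p(1)]
  have "(sq_integral cell_measure (\<lambda>y. c * f y - c * p y)) =
     (\<integral>\<^sup>+y. ennreal ((cmod c)\<^sup>2) * ennreal ((cmod (f y - p y))\<^sup>2) \<partial>cell_measure)"
    by (simp add: norm_mult power_mult_distrib ennreal_mult flip: right_diff_distrib)
  also have "\<dots> = ennreal ((cmod c)\<^sup>2) * (sq_integral cell_measure (\<lambda>y. f y - p y))"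
    by (subst nn_integral_cmult) auto
  also have "\<dots> \<le> ennreal ((cmod c)\<^sup>2) * ennreal (\<epsilon> / ((cmod c)\<^sup>2 + 1))"
    by (intro mult_left_mono p) auto
  also have "\<dots> = ennreal ((cmod c)\<^sup>2 * (\<epsilon> / ((cmod c)\<^sup>2 + 1)))"
    using pos \<open>0 < \<epsilon>\<close> by (subst ennreal_mult) auto
  also have "\<dots> \<le> ennreal \<epsilon>"
    using pos \<open>0 < \<epsilon>\<close> by (intro ennreal_leI) (simp add: field_simps)
  finally show "\<exists>p\<in>trig_span. (sq_integral cell_measure (\<lambda>y. c * f y - p y)) \<le> ennreal \<epsilon>"
    using p by (intro bexI[of _ "\<lambda>x. c * p x"]) (auto intro: trig_span_cmult)
qed

lemma trig_approx_cong:
  assumes "trig_approx f" "g \<in> borel_measurable borel" "\<And>x. x \<in> unit_cell \<Longrightarrow> f x = g x"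
  shows "trig_approx g"
proof -
  have "(sq_integral cell_measure (\<lambda>y. g y - p y)) = (sq_integral cell_measure (\<lambda>y. f y - p y))" for p
    using assms(3) by (intro nn_integral_cong) (auto simp: space_restrict_space)
  with assms(1,2) show ?thesis by (simp add: trig_approx_def)
qed

lemma trig_approx_dominated:
  fixes f :: "real^'n \<Rightarrow> complex"
  assumes f[measurable]: "f \<in> borel_measurable borel"
    and g: "\<And>i. trig_approx (g i)"
    and lim: "\<And>y. y \<in> unit_cell \<Longrightarrow> (\<lambda>i. g i y) \<longlonglongrightarrow> f y"
    and bound: "\<And>i y. y \<in> unit_cell \<Longrightarrow> (cmod (f y - g i y))\<^sup>2 \<le> w y"
    and w[measurable]: "w \<in> borel_measurable borel" and fin: "(\<integral>\<^sup>+y. ennreal (w y) \<partial>cell_measure) < \<infinity>"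
  shows "trig_approx f"
proof (rule trig_approx_lim[OF f])
  have [measurable]: "g i \<in> borel_measurable borel" for i using g by (simp add: trig_approx_def)
  fix \<epsilon> :: real assume "0 < \<epsilon>"
  have "(\<lambda>i. \<integral>\<^sup>+y. ennreal ((cmod (f y - g i y))\<^sup>2) \<partial>cell_measure) \<longlonglongrightarrow> (\<integral>\<^sup>+y. 0 \<partial>(cell_measure :: (real^'n) measure))"
  proof (rule nn_integral_dominated_convergence[where w="\<lambda>y. ennreal (w y)"])
    show "AE y in cell_measure. ennreal ((cmod (f y - g i y))\<^sup>2) \<le> ennreal (w y)" for i
      by (rule AE_I2) (auto simp: space_restrict_space intro!: ennreal_leI bound)
    show "AE y in cell_measure. (\<lambda>i. ennreal ((cmod (f y - g i y))\<^sup>2)) \<longlonglongrightarrow> 0"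
    proof (rule AE_I2)
      fix y :: "real^'n" assume "y \<in> space cell_measure"
      then have "(\<lambda>i. g i y) \<longlonglongrightarrow> f y" by (auto simp: space_restrict_space intro: lim)
      then have "(\<lambda>i. (cmod (f y - g i y))\<^sup>2) \<longlonglongrightarrow> (cmod (f y - f y))\<^sup>2" by (intro tendsto_intros)
      then show "(\<lambda>i. ennreal ((cmod (f y - g i y))\<^sup>2)) \<longlonglongrightarrow> 0" using tendsto_ennrealI by fastforce
    qed
  qed (use fin in auto)
  then have "\<forall>\<^sub>F i in sequentially. (sq_integral cell_measure (\<lambda>y. f y - g i y)) < ennreal \<epsilon>"
    using \<open>0 < \<epsilon>\<close> by (intro order_tendstoD) auto
  then obtain i where "(sq_integral cell_measure (\<lambda>y. f y - g i y)) < ennreal \<epsilon>"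
    by (auto simp: eventually_sequentially)
  with g show "\<exists>g. trig_approx g \<and> (sq_integral cell_measure (\<lambda>y. f y - g y)) \<le> ennreal \<epsilon>"
    by (intro exI[of _ "g i"]) (auto intro: less_imp_le)
qed

text \<open>Trigonometric polynomials on the cell are the polynomials in the coordinates of this map, so
  the Stone--Weierstrass theorem on its compact range gives their density.\<close>

definition torus_map :: "real^'n \<Rightarrow> complex^'n" where
  "torus_map x = (\<chi> i. cis (2 * pi * x $ i))"

definition torus_set :: "(complex^'n) set" where
  "torus_set = {z. \<forall>i. cmod (z $ i) = 1}"

lemma torus_map_in [simp]: "torus_map x \<in> torus_set"
  by (simp add: torus_map_def torus_set_def)

lemma torus_map_measurable [measurable]: "torus_map \<in> borel_measurable borel"
  unfolding torus_map_def by (intro borel_measurable_continuous_onI continuous_intros)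

lemma compact_torus_set: "compact (torus_set :: (complex^'n) set)"
  unfolding compact_eq_bounded_closed
proof
  show "bounded (torus_set :: (complex^'n) set)"
  proof (rule boundedI)
    fix z :: "complex^'n" assume "z \<in> torus_set"
    then have "L2_set (\<lambda>i. cmod (z $ i)) UNIV \<le> (\<Sum>i\<in>(UNIV::'n set). 1)"
      by (intro order_trans[OF L2_set_le_sum]) (auto simp: torus_set_def)
    then show "norm z \<le> (\<Sum>i\<in>(UNIV::'n set). 1)" by (simp add: norm_vec_def)
  qed
  show "closed (torus_set :: (complex^'n) set)"
    unfolding torus_set_def by (intro closed_Collect_all closed_Collect_eq continuous_intros)
qed

lemma trig_span_cos: "(\<lambda>x :: real^'n. of_real (cos (2 * pi * x $ i))) \<in> trig_span"
  and trig_span_sin: "(\<lambda>x :: real^'n. of_real (sin (2 * pi * x $ i))) \<in> trig_span"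
proof -
  let ?m = "axis i 1 :: real^'n"
  have m: "?m \<in> int_lattice" by (auto simp: int_lattice_def axis_def)
  have *: "(\<lambda>x. c * wave ?m x + d * wave (- ?m) x) \<in> trig_span" for c d
    by (intro trig_span.add trig_span.wave m int_lattice_uminus)
  have "(\<lambda>x :: real^'n. of_real (cos (2 * pi * x $ i))) = (\<lambda>x. 1/2 * wave ?m x + 1/2 * wave (- ?m) x)"
    by (auto simp: fun_eq_iff wave_def inner_axis inner_commute[of "axis i 1"] complex_eq_iff)
  then show "(\<lambda>x :: real^'n. of_real (cos (2 * pi * x $ i))) \<in> trig_span" using *[of "1/2" "1/2"] by simp
  have "(\<lambda>x :: real^'n. of_real (sin (2 * pi * x $ i))) = (\<lambda>x. (-\<i>/2) * wave ?m x + (\<i>/2) * wave (- ?m) x)"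
    by (auto simp: fun_eq_iff wave_def inner_axis inner_commute[of "axis i 1"] complex_eq_iff)
  then show "(\<lambda>x :: real^'n. of_real (sin (2 * pi * x $ i))) \<in> trig_span" using *[of "-\<i>/2" "\<i>/2"] by simp
qed

lemma trig_span_polynomial:
  assumes "real_polynomial_function g"
  shows "(\<lambda>x :: real^'n. of_real (g (torus_map x))) \<in> trig_span"
  using assms
proof (induction rule: real_polynomial_function.induct)
  case (linear f)
  interpret bounded_linear f by fact
  have rep: "f z = (\<Sum>b\<in>Basis. f b * (z \<bullet> b))" for z
  proof -
    have "f z = f (\<Sum>b\<in>Basis. (z \<bullet> b) *\<^sub>R b)" by (simp add: euclidean_representation)
    then show ?thesis by (simp add: sum scaleR mult.commute)
  qed
  have basis: "(\<lambda>x :: real^'n. of_real (torus_map x \<bullet> b) :: complex) \<in> trig_span" if b: "b \<in> Basis" for b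
  proof -
    from b obtain i u where u: "b = axis i u" "u \<in> Basis" by (auto simp: Basis_vec_def)
    then have "u = 1 \<or> u = \<i>" by (auto simp: Basis_complex_def)
    then show ?thesis
      using trig_span_cos[of i] trig_span_sin[of i] by (auto simp: u inner_axis torus_map_def inner_complex_def)
  qed
  have "(\<lambda>x :: real^'n. of_real (f (torus_map x))) =
      (\<lambda>x. \<Sum>b\<in>Basis. of_real (f b) * (of_real (torus_map x \<bullet> b) :: complex))"
    by (rule ext, subst rep) simp
  also have "\<dots> \<in> trig_span"
    by (intro trig_span_sum trig_span_cmult basis) auto
  finally show ?case .
next
  case (const c)
  show ?case by (rule trig_span_const)
next
  case (add f g)
  then show ?case using trig_span.add by fastforce
next
  case (mult f g)
  then show ?case using trig_span_mult by fastforce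
qed

lemma trig_approx_continuous:
  fixes g :: "complex^'n \<Rightarrow> real"
  assumes g: "continuous_on UNIV g"
  shows "trig_approx (\<lambda>x. of_real (g (torus_map x)))"
proof (rule trig_approx_lim)
  have [measurable]: "g \<in> borel_measurable borel" by (rule borel_measurable_continuous_onI[OF g])
  show "(\<lambda>x. complex_of_real (g (torus_map x))) \<in> borel_measurable borel" by measurable
  fix \<epsilon> :: real assume "0 < \<epsilon>"
  then obtain h where h: "real_polynomial_function h" "\<And>z. z \<in> torus_set \<Longrightarrow> \<bar>g z - h z\<bar> < sqrt \<epsilon>"
    using Stone_Weierstrass_real_polynomial_function[OF compact_torus_set continuous_on_subset[OF g], of "sqrt \<epsilon>"]
    by auto
  have "(cmod (of_real (g (torus_map y)) - of_real (h (torus_map y))))\<^sup>2 \<le> \<epsilon>" for y :: "real^'n"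
  proof -
    have "\<bar>g (torus_map y) - h (torus_map y)\<bar>\<^sup>2 \<le> (sqrt \<epsilon>)\<^sup>2"
      using h(2)[of "torus_map y"] by (intro power_mono) auto
    then show ?thesis using \<open>0 < \<epsilon>\<close> by (simp flip: of_real_diff)
  qed
  then have "(sq_integral (cell_measure :: (real^'n) measure) (\<lambda>y. of_real (g (torus_map y)) - of_real (h (torus_map y))))
      \<le> (\<integral>\<^sup>+y. ennreal \<epsilon> \<partial>(cell_measure :: (real^'n) measure))"
    by (intro nn_integral_mono ennreal_leI)
  also have "\<dots> = ennreal \<epsilon>"
    by (simp add: emeasure_restrict_space space_restrict_space emeasure_unit_cell)
  finally show "\<exists>h. trig_approx h \<and> (sq_integral (cell_measure :: (real^'n) measure) (\<lambda>y. of_real (g (torus_map y)) - h y)) \<le> ennreal \<epsilon>"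
    using trig_approx_trig[OF trig_span_polynomial[OF h(1)]] by blast
qed

lemma emeasure_cell_measure [simp]: "emeasure (cell_measure :: (real^'n) measure) unit_cell = 1"
  by (simp add: emeasure_restrict_space space_restrict_space emeasure_unit_cell)

text \<open>The indicator of an open set is the bounded pointwise limit of the continuous functions
  \<open>min 1 (i * infdist z (- U))\<close>.\<close>

lemma trig_approx_torus_open:
  fixes U :: "(complex^'n) set"
  assumes "open U"
  shows "trig_approx (\<lambda>x. indicator U (torus_map x))"
proof (cases "U = UNIV")
  case True
  then show ?thesis using trig_approx_trig[OF trig_span_const[of 1]] by simp
next
  case False
  then have ne: "- U \<noteq> {}" by auto
  have [measurable]: "U \<in> sets borel" using assms by simp
  define g where "g = (\<lambda>(i::nat) z. min 1 (real i * infdist z (- U)))"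
  show ?thesis
  proof (rule trig_approx_dominated[where w="\<lambda>_. 1" and g="\<lambda>i x. of_real (g i (torus_map x))"])
    show "(\<lambda>x :: real^'n. indicator U (torus_map x) :: complex) \<in> borel_measurable borel" by measurable
    show "trig_approx (\<lambda>x :: real^'n. of_real (g i (torus_map x)))" for i
      unfolding g_def by (intro trig_approx_continuous continuous_intros)
    show "(\<lambda>i. of_real (g i (torus_map y))) \<longlonglongrightarrow> (indicator U (torus_map y) :: complex)" for y :: "real^'n"
    proof (cases "torus_map y \<in> U")
      case True
      then have d: "infdist (torus_map y) (- U) > 0"
        using infdist_pos_not_in_closed[of "- U" "torus_map y"] assms ne by auto
      obtain N :: nat where N: "1 / infdist (torus_map y) (- U) < real N" using reals_Archimedean2 by blast
      have "g i (torus_map y) = 1" if "i \<ge> N" for i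
      proof -
        have "1 / infdist (torus_map y) (- U) \<le> real i" using N that by linarith
        then have "1 \<le> real i * infdist (torus_map y) (- U)" using d by (simp add: field_simps)
        then show ?thesis by (simp add: g_def)
      qed
      then show ?thesis using True
        by (intro tendsto_eventually eventually_sequentiallyI[of N]) auto
    next
      case False
      then have "infdist (torus_map y) (- U) = 0" by simp
      then show ?thesis using False by (simp add: g_def)
    qed
    show "(cmod (indicator U (torus_map y) - of_real (g i (torus_map y))))\<^sup>2 \<le> 1" for i and y :: "real^'n"
    proof -
      have g: "0 \<le> g i (torus_map y)" "g i (torus_map y) \<le> 1"
        unfolding g_def by (simp_all add: infdist_nonneg)
      have "cmod (indicator U (torus_map y) - of_real (g i (torus_map y))) \<le> 1"
      proof (cases "torus_map y \<in> U")
        case True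
        then have "cmod (indicator U (torus_map y) - of_real (g i (torus_map y))) =
            cmod (of_real (1 - g i (torus_map y)))" by simp
        also have "\<dots> \<le> 1" unfolding norm_of_real using g by simp
        finally show ?thesis .
      qed (use g in simp)
      then show ?thesis by (simp add: power_le_one)
    qed
  qed (auto simp: space_restrict_space)
qed

lemma trig_approx_torus_borel:
  fixes A :: "(complex^'n) set"
  assumes "A \<in> sets borel"
  shows "trig_approx (\<lambda>x. indicator A (torus_map x))"
proof -
  have "Int_stable {S :: (complex^'n) set. open S}" by (auto simp: Int_stable_def)
  moreover have "{S :: (complex^'n) set. open S} \<subseteq> Pow UNIV" by simp
  moreover have "A \<in> sigma_sets UNIV {S. open S}" using assms by (simp add: borel_def)
  ultimately show ?thesis
  proof (induction A rule: sigma_sets_induct_disjoint)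
    case (basic A)
    then show ?case using trig_approx_torus_open by auto
  next
    case empty
    then show ?case using trig_approx_trig[OF trig_span_const[of 0]] by simp
  next
    case (compl A)
    have "trig_approx (\<lambda>x :: real^'n. 1 + (-1) * indicator A (torus_map x))"
      using compl by (intro trig_approx_add trig_approx_cmult trig_approx_trig[OF trig_span_const[of 1]])
    moreover have "1 + (-1) * indicator A (torus_map x) = (indicator (UNIV - A) (torus_map x) :: complex)" for x :: "real^'n"
      by (auto simp: indicator_def)
    ultimately show ?case by simp
  next
    case (union A)
    have fin: "trig_approx (\<lambda>x :: real^'n. \<Sum>i<n. indicator (A i) (torus_map x))" for n
    proof (induction n)
      case 0 show ?case using trig_approx_trig[OF trig_span_const[of 0]] by simp
    next
      case (Suc n) then show ?case using union by (auto intro: trig_approx_add)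
    qed
    have [measurable]: "A i \<in> sets borel" for i using union.hyps(2) by (auto simp: borel_def)
    have eq: "(\<Sum>i<n. indicator (A i) z :: complex) = indicator (\<Union>i<n. A i) z" for n z
      using union.hyps(1) by (subst indicator_UN_disjoint) (auto intro: disjoint_family_on_mono)
    have [measurable]: "(\<Union>i. A i) \<in> sets borel" by auto
    show ?case
    proof (rule trig_approx_dominated[where w="\<lambda>_. 1" and g="\<lambda>i x. \<Sum>j<i. indicator (A j) (torus_map x)"])
      show "(\<lambda>x :: real^'n. indicator (\<Union>i. A i) (torus_map x) :: complex) \<in> borel_measurable borel" by measurable
      show "trig_approx (\<lambda>x :: real^'n. \<Sum>j<i. indicator (A j) (torus_map x))" for i by (rule fin)
      show "(\<lambda>i. \<Sum>j<i. indicator (A j) (torus_map y)) \<longlonglongrightarrow> (indicator (\<Union>i. A i) (torus_map y) :: complex)" for y :: "real^'n"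
        unfolding eq by (rule LIMSEQ_indicator_UN)
      show "(cmod (indicator (\<Union>i. A i) (torus_map y) - (\<Sum>j<i. indicator (A j) (torus_map y))))\<^sup>2 \<le> 1" for i and y :: "real^'n"
        unfolding eq by (auto simp: indicator_def)
    qed (auto simp: space_restrict_space)
  qed
qed

text \<open>The inverse of the torus map on the cell, expressed by the arccosine so that it is visibly
  Borel measurable. At \<open>-1\<close> it takes the value \<open>-1/2\<close>, the end point that
  belongs to the cell.\<close>

definition torus_inverse :: "complex^'n \<Rightarrow> real^'n" where
  "torus_inverse z = (\<chi> i. (if Im (z $ i) > 0 then 1 else -1) * arccos (max (-1) (min 1 (Re (z $ i)))) / (2 * pi))"

lemma torus_inverse_measurable [measurable]: "torus_inverse \<in> borel_measurable borel"
proof -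
  have [measurable]: "(\<lambda>t :: real. arccos (max (-1) (min 1 t))) \<in> borel_measurable borel"
    by (intro borel_measurable_continuous_onI continuous_intros) auto
  have [measurable]: "(\<lambda>z :: complex^'n. z $ i) \<in> borel_measurable borel" for i
    by (intro borel_measurable_continuous_onI continuous_intros)
  have "(\<lambda>z :: complex^'n. torus_inverse z $ i) \<in> borel_measurable borel" for i
    unfolding torus_inverse_def by simp
  then show ?thesis
    by (intro borel_measurable_euclidean_space[THEN iffD2]) (auto simp: Basis_vec_def inner_axis)
qed

lemma torus_inverse_torus_map:
  assumes "x \<in> unit_cell"
  shows "torus_inverse (torus_map x) = x"
proof -
  have "(if sin (2 * pi * t) > 0 then 1 else -1) * arccos (cos (2 * pi * t)) / (2 * pi) = t"
    if t: "- 1/2 \<le> t" "t < 1/2" for t :: real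
  proof (cases "t > 0")
    case True
    have "2 * pi * t < pi" using t by (simp add: field_simps)
    then have "sin (2 * pi * t) > 0" using True by (intro sin_gt_zero) auto
    moreover have "arccos (cos (2 * pi * t)) = 2 * pi * t" using True \<open>2 * pi * t < pi\<close> by (intro arccos_cos) auto
    ultimately show ?thesis by simp
  next
    case False
    have le: "2 * pi * (-t) \<le> pi" using t mult_left_mono[of "- (2 * t)" 1 pi] by simp
    have "sin (2 * pi * (-t)) \<ge> 0" using False le by (intro sin_ge_zero) (auto simp: mult_nonneg_nonpos)
    then have "\<not> sin (2 * pi * t) > 0" by simp
    moreover have "arccos (cos (2 * pi * (-t))) = 2 * pi * (-t)"
      using False le by (intro arccos_cos) (auto simp: mult_nonneg_nonpos)
    ultimately show ?thesis by simp
  qed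
  moreover have "max (-1) (min 1 (cos t)) = cos t" for t :: real
    using cos_ge_minus_one[of t] cos_le_one[of t] by (simp add: max_absorb2 min_absorb2)
  ultimately show ?thesis using assms
    by (auto simp: torus_inverse_def torus_map_def vec_eq_iff unit_cell_def)
qed

text \<open>On the cell, \<open>A\<close> is the preimage under the torus map of the Borel set
  \<open>torus_inverse -` A\<close>.\<close>

lemma trig_approx_indicator:
  fixes A :: "(real^'n) set"
  assumes [measurable]: "A \<in> sets borel"
  shows "trig_approx (indicator A)"
proof (rule trig_approx_cong)
  have "torus_inverse -` A \<in> sets borel"
    using measurable_sets[OF torus_inverse_measurable assms] by simp
  then show "trig_approx (\<lambda>x. indicator (torus_inverse -` A) (torus_map x))"
    by (rule trig_approx_torus_borel)
qed (auto simp: torus_inverse_torus_map indicator_def)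

lemma trig_approx_nonneg:
  fixes u :: "real^'n \<Rightarrow> real"
  assumes "u \<in> borel_measurable borel" "\<And>x. 0 \<le> u x"
    and "(\<integral>\<^sup>+y. ennreal ((u y)\<^sup>2) \<partial>cell_measure) < \<infinity>"
  shows "trig_approx (\<lambda>x. of_real (u x))"
  using assms
proof (induction rule: borel_measurable_induct_real)
  case (set A)
  then show ?case using trig_approx_indicator[of A]
    by (auto simp: indicator_def[abs_def] of_bool_def if_distrib cong: if_cong)
next
  case (mult u c)
  show ?case
  proof (cases "c = 0")
    case True then show ?thesis using trig_approx_trig[OF trig_span_const[of 0]] by simp
  next
    case False
    have [measurable]: "u \<in> borel_measurable borel" by fact
    have "(\<integral>\<^sup>+y. ennreal ((c * u y)\<^sup>2) \<partial>cell_measure) = ennreal (c\<^sup>2) * (\<integral>\<^sup>+y. ennreal ((u y)\<^sup>2) \<partial>cell_measure)"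
      by (subst nn_integral_cmult[symmetric]) (auto simp: power_mult_distrib ennreal_mult)
    with mult.prems False have "(\<integral>\<^sup>+y. ennreal ((u y)\<^sup>2) \<partial>cell_measure) < \<infinity>"
      by (auto simp: ennreal_mult_less_top)
    with mult show ?thesis using trig_approx_cmult[of "\<lambda>x. of_real (u x)" "of_real c"] by simp
  qed
next
  case (add u v)
  have "(\<integral>\<^sup>+y. ennreal ((u y)\<^sup>2) \<partial>cell_measure) \<le> (\<integral>\<^sup>+y. ennreal ((v y + u y)\<^sup>2) \<partial>cell_measure)"
    "(\<integral>\<^sup>+y. ennreal ((v y)\<^sup>2) \<partial>cell_measure) \<le> (\<integral>\<^sup>+y. ennreal ((v y + u y)\<^sup>2) \<partial>cell_measure)"
    using add by (auto intro!: nn_integral_mono ennreal_leI power_mono)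
  with add show ?case using trig_approx_add[of "\<lambda>x. of_real (v x)" "\<lambda>x. of_real (u x)"]
    by (simp add: order.strict_trans1)
next
  case (seq U)
  have [measurable]: "u \<in> borel_measurable borel" by fact
  have le: "U i x \<le> u x" for i x
    using seq.hyps(4)[of x] seq.hyps(3) by (intro incseq_le) (auto simp: incseq_def le_fun_def)
  have sq: "(U i x)\<^sup>2 \<le> (u x)\<^sup>2" for i x using le seq.hyps(2) by (intro power_mono) auto
  have "(\<integral>\<^sup>+y. ennreal ((U i y)\<^sup>2) \<partial>cell_measure) \<le> (\<integral>\<^sup>+y. ennreal ((u y)\<^sup>2) \<partial>cell_measure)" for i
    by (intro nn_integral_mono ennreal_leI sq)
  then have "trig_approx (\<lambda>x. of_real (U i x))" for i
    using seq.prems by (intro seq.IH) (rule le_less_trans)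
  then show ?case
  proof (rule trig_approx_dominated[where w="\<lambda>y. (u y)\<^sup>2", rotated 1])
    show "(\<lambda>i. complex_of_real (U i y)) \<longlonglongrightarrow> of_real (u y)" for y
      using seq.hyps(4)[of y] by (intro tendsto_of_real) auto
    show "(cmod (complex_of_real (u y) - of_real (U i y)))\<^sup>2 \<le> (u y)\<^sup>2" for i y
      using le[of i y] seq.hyps(2)[of i y] by (simp flip: of_real_diff)
  qed (use seq.prems in auto)
qed

lemma trig_approx_L2:
  fixes f :: "real^'n \<Rightarrow> complex"
  assumes [measurable]: "f \<in> borel_measurable borel"
    and fin: "(sq_integral cell_measure f) < \<infinity>"
  shows "trig_approx f"
proof -
  have "trig_approx (\<lambda>x. of_real (max 0 (h (f x))))" if h[measurable]: "h \<in> borel_measurable borel"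
    and b: "\<And>z. \<bar>h z\<bar> \<le> cmod z" for h :: "complex \<Rightarrow> real"
  proof (rule trig_approx_nonneg)
    have "(\<integral>\<^sup>+y. ennreal ((max 0 (h (f y)))\<^sup>2) \<partial>cell_measure) \<le> (sq_integral cell_measure f)"
    proof (intro nn_integral_mono ennreal_leI power_mono)
      fix y show "max 0 (h (f y)) \<le> cmod (f y)" using b[of "f y"] by auto
    qed auto
    with fin show "(\<integral>\<^sup>+y. ennreal ((max 0 (h (f y)))\<^sup>2) \<partial>cell_measure) < \<infinity>" by (simp add: order.strict_trans1)
  qed auto
  note * = this
  have "trig_approx (\<lambda>x. (of_real (max 0 (Re (f x))) + (-1) * of_real (max 0 (- Re (f x)))) +
     (\<i> * of_real (max 0 (Im (f x))) + (- \<i>) * of_real (max 0 (- Im (f x)))))"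
    using *[of Re] *[of "\<lambda>z. - Re z"] *[of Im] *[of "\<lambda>z. - Im z"]
    by (intro trig_approx_add trig_approx_cmult)
       (auto simp: abs_Re_le_cmod abs_Im_le_cmod)
  also have "(\<lambda>x. (of_real (max 0 (Re (f x))) + (-1) * of_real (max 0 (- Re (f x)))) +
     (\<i> * of_real (max 0 (Im (f x))) + (- \<i>) * of_real (max 0 (- Im (f x))))) = f"
    by (auto simp: fun_eq_iff complex_eq_iff max_def)
  finally show ?thesis .
qed

lemma borel_measurable_cnj [measurable (raw)]:
  assumes "f \<in> borel_measurable M"
  shows "(\<lambda>x. cnj (f x)) \<in> borel_measurable M"
  by (rule measurable_compose[OF assms]) (intro borel_measurable_continuous_onI continuous_intros)

lemma L2_mult_integrable:
  fixes f g :: "'a \<Rightarrow> complex"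
  assumes [measurable]: "f \<in> borel_measurable M" "g \<in> borel_measurable M"
    and fin: "(sq_integral M f) < \<infinity>" "(sq_integral M g) < \<infinity>"
  shows "integrable M (\<lambda>x. f x * g x)"
proof (rule integrableI_bounded)
  have "(\<integral>\<^sup>+x. ennreal (norm (f x * g x)) \<partial>M) \<le>
      (\<integral>\<^sup>+x. ennreal ((cmod (f x))\<^sup>2) + ennreal ((cmod (g x))\<^sup>2) \<partial>M)"
  proof (intro nn_integral_mono)
    fix x
    have "norm (f x * g x) \<le> (cmod (f x))\<^sup>2 + (cmod (g x))\<^sup>2"
    proof -
      have "2 * (cmod (f x) * cmod (g x)) \<le> (cmod (f x))\<^sup>2 + (cmod (g x))\<^sup>2"
        using sum_squares_bound[of "cmod (f x)" "cmod (g x)"] by simp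
      moreover have "0 \<le> cmod (f x) * cmod (g x)" by simp
      ultimately show ?thesis unfolding norm_mult by linarith
    qed
    then show "ennreal (norm (f x * g x)) \<le> ennreal ((cmod (f x))\<^sup>2) + ennreal ((cmod (g x))\<^sup>2)"
      by (metis ennreal_leI ennreal_plus zero_le_power2)
  qed
  also have "\<dots> < \<infinity>" using fin by (simp add: nn_integral_add)
  finally show "(\<integral>\<^sup>+x. ennreal (norm (f x * g x)) \<partial>M) < \<infinity>" .
qed measurable

lemma L2_sq_integrable:
  fixes f :: "'a \<Rightarrow> complex"
  assumes [measurable]: "f \<in> borel_measurable M"
    and fin: "(sq_integral M f) < \<infinity>"
  shows "integrable M (\<lambda>x. (cmod (f x))\<^sup>2)"
  using fin by (intro integrableI_bounded) auto

lemma L2_cnj_integrable: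
  fixes f g :: "'a \<Rightarrow> complex"
  assumes [measurable]: "f \<in> borel_measurable M" "g \<in> borel_measurable M"
    and fin: "(sq_integral M f) < \<infinity>" "(sq_integral M g) < \<infinity>"
  shows "integrable M (\<lambda>x. f x * cnj (g x))"
  using fin by (intro L2_mult_integrable) auto

definition cell_coeff :: "(real^'n \<Rightarrow> complex) \<Rightarrow> real^'n \<Rightarrow> complex" where
  "cell_coeff f m = (LINT y|cell_measure. f y * wave (- m) y)"

text \<open>Pythagoras: the deviation of the coefficients \<open>a\<close> from the Fourier coefficients
  only adds to the distance. The choice \<open>a = cell_coeff f\<close> gives Bessel's inequality and
  the best approximation.\<close>

lemma cell_dist_sq:
  fixes f :: "real^'n \<Rightarrow> complex"
  assumes f[measurable]: "f \<in> borel_measurable borel"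
    and fin: "(sq_integral cell_measure f) < \<infinity>"
    and F: "finite F" "F \<subseteq> int_lattice"
  shows "(LINT y|cell_measure. (cmod (f y - (\<Sum>m\<in>F. a m * wave m y)))\<^sup>2) =
    (LINT y|cell_measure. (cmod (f y))\<^sup>2) - (\<Sum>m\<in>F. (cmod (cell_coeff f m))\<^sup>2) +
    (\<Sum>m\<in>F. (cmod (cell_coeff f m - a m))\<^sup>2)"
proof -
  let ?p = "\<lambda>y. \<Sum>m\<in>F. a m * wave m y"
  let ?c = "cell_coeff f"
  have wfin: "(sq_integral cell_measure (\<lambda>y. c * wave m y)) < \<infinity>" for c and m :: "real^'n"
    by (simp add: norm_mult space_restrict_space)
  have fw: "integrable cell_measure (\<lambda>y. f y * wave m y)" for m
    using L2_mult_integrable[of f cell_measure "wave m"] fin wfin[of 1 m] by simp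
  have ww: "integrable cell_measure (wave m)" for m :: "real^'n"
    using L2_mult_integrable[of "wave m" cell_measure "wave 0"] wfin[of 1 m] wfin[of 1 0] by simp
  have ff: "integrable cell_measure (\<lambda>y. f y * cnj (f y))"
    by (rule L2_cnj_integrable) (use fin in auto)
  have fwc: "integrable cell_measure (\<lambda>y. cnj (f y) * wave m y)" for m
    using integrable_cnj[OF fw[of "- m"]] by (simp add: cnj_wave)
  have i1: "(LINT y|cell_measure. f y * cnj (?p y)) = (\<Sum>m\<in>F. cnj (a m) * ?c m)"
  proof -
    have "(LINT y|cell_measure. f y * cnj (?p y)) = (LINT y|cell_measure. (\<Sum>m\<in>F. cnj (a m) * (f y * wave (-m) y)))"
      by (intro Bochner_Integration.integral_cong) (auto simp: cnj_wave sum_distrib_left ac_simps)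
    also have "\<dots> = (\<Sum>m\<in>F. cnj (a m) * ?c m)"
      unfolding cell_coeff_def by (subst Bochner_Integration.integral_sum) (auto intro!: fw integrable_mult_right)
    finally show ?thesis .
  qed
  have I1: "integrable cell_measure (\<lambda>y. f y * cnj (?p y))"
  proof -
    have "(\<lambda>y. f y * cnj (?p y)) = (\<lambda>y. (\<Sum>m\<in>F. cnj (a m) * (f y * wave (-m) y)))"
      by (auto simp: cnj_wave sum_distrib_left ac_simps)
    then show ?thesis by (auto intro!: fw integrable_mult_right)
  qed
  have i2: "(LINT y|cell_measure. cnj (f y) * ?p y) = cnj (\<Sum>m\<in>F. cnj (a m) * ?c m)"
    using Bochner_Integration.integral_cnj[of cell_measure "\<lambda>y. f y * cnj (?p y)"] unfolding i1 by simp
  have I2: "integrable cell_measure (\<lambda>y. cnj (f y) * ?p y)"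
    using integrable_cnj[OF I1] by simp
  have eq3: "(\<lambda>y. ?p y * cnj (?p y)) = (\<lambda>y. \<Sum>m\<in>F. \<Sum>n\<in>F. a m * cnj (a n) * wave (m - n) y)"
  proof
    fix y
    have *: "a m * wave m y * (cnj (a n) * wave (- n) y) = a m * cnj (a n) * wave (m - n) y" for m n
      using wave_mult[of m y "- n"] by (simp add: ac_simps)
    then show "?p y * cnj (?p y) = (\<Sum>m\<in>F. \<Sum>n\<in>F. a m * cnj (a n) * wave (m - n) y)"
      unfolding cnj_sum complex_cnj_mult cnj_wave sum_product by (intro sum.cong refl *)
  qed
  have i3: "(LINT y|cell_measure. ?p y * cnj (?p y)) = (\<Sum>m\<in>F. a m * cnj (a m))"
  proof -
    have "(LINT y|cell_measure. ?p y * cnj (?p y)) =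
      (\<Sum>m\<in>F. \<Sum>n\<in>F. a m * cnj (a n) * (LINT y|cell_measure. wave (m - n) y))"
      unfolding eq3 by (simp add: ww)
    also have "\<dots> = (\<Sum>m\<in>F. \<Sum>n\<in>F. if m = n then a m * cnj (a n) else 0)"
      using F by (intro sum.cong refl) (auto simp: integral_wave int_lattice_diff subset_iff)
    also have "\<dots> = (\<Sum>m\<in>F. a m * cnj (a m))" using F by simp
    finally show ?thesis .
  qed
  have I3: "integrable cell_measure (\<lambda>y. ?p y * cnj (?p y))"
    unfolding eq3 by (simp add: ww)
  have dist: "complex_of_real ((cmod (z - w))\<^sup>2) = z * cnj z - z * cnj w - cnj z * w + w * cnj w" for z w
    unfolding complex_norm_square by (simp add: algebra_simps)
  have "complex_of_real (LINT y|cell_measure. (cmod (f y - ?p y))\<^sup>2) =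
    (LINT y|cell_measure. complex_of_real ((cmod (f y - ?p y))\<^sup>2))"
    by (rule integral_complex_of_real[symmetric])
  also have "\<dots> = (LINT y|cell_measure. f y * cnj (f y) - f y * cnj (?p y) - cnj (f y) * ?p y + ?p y * cnj (?p y))"
    by (intro Bochner_Integration.integral_cong refl dist)
  also have "\<dots> = (LINT y|cell_measure. f y * cnj (f y)) - (\<Sum>m\<in>F. cnj (a m) * ?c m) -
      cnj (\<Sum>m\<in>F. cnj (a m) * ?c m) + (\<Sum>m\<in>F. a m * cnj (a m))"
    using ff I1 I2 I3 by (simp add: i1 i2 i3 del: cnj_sum complex_cnj_mult)
  also have "(LINT y|cell_measure. f y * cnj (f y)) = (LINT y|cell_measure. complex_of_real ((cmod (f y))\<^sup>2))"
    by (simp add: complex_norm_square del: of_real_power)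
  also have "\<dots> = of_real (LINT y|cell_measure. (cmod (f y))\<^sup>2)"
    by (rule integral_complex_of_real)
  also have "of_real (LINT y|cell_measure. (cmod (f y))\<^sup>2) - (\<Sum>m\<in>F. cnj (a m) * ?c m) -
      cnj (\<Sum>m\<in>F. cnj (a m) * ?c m) + (\<Sum>m\<in>F. a m * cnj (a m)) =
      of_real (LINT y|cell_measure. (cmod (f y))\<^sup>2) - (\<Sum>m\<in>F. complex_of_real ((cmod (?c m))\<^sup>2)) +
       (\<Sum>m\<in>F. complex_of_real ((cmod (?c m - a m))\<^sup>2))"
  proof -
    have "complex_of_real ((cmod (?c m - a m))\<^sup>2) = complex_of_real ((cmod (?c m))\<^sup>2) - cnj (a m) * ?c m - cnj (cnj (a m) * ?c m) + a m * cnj (a m)" for m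
      unfolding dist complex_norm_square by (simp add: algebra_simps)
    then show ?thesis by (simp add: sum.distrib sum_subtractf del: of_real_power)
  qed
  also have "\<dots> = complex_of_real ((LINT y|cell_measure. (cmod (f y))\<^sup>2) - (\<Sum>m\<in>F. (cmod (?c m))\<^sup>2) + (\<Sum>m\<in>F. (cmod (?c m - a m))\<^sup>2))"
    by simp
  finally show ?thesis using of_real_eq_iff by blast
qed

text \<open>Some trigonometric polynomial is close to \<open>f\<close>, and the partial Fourier sum over
  any finite set of frequencies that contains its own is at least as close.\<close>

lemma parseval_cell:
  fixes f :: "real^'n \<Rightarrow> complex"
  assumes f[measurable]: "f \<in> borel_measurable borel"
    and fin: "(sq_integral cell_measure f) < \<infinity>"
  shows "((\<lambda>m. (cmod (cell_coeff f m))\<^sup>2) has_sum (LINT y|cell_measure. (cmod (f y))\<^sup>2)) int_lattice"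
  unfolding has_sum_def
proof (rule tendstoI)
  let ?c = "cell_coeff f" and ?N = "LINT y|cell_measure. (cmod (f y))\<^sup>2"
  fix \<epsilon> :: real assume \<epsilon>: "0 < \<epsilon>"
  from trig_approx_L2[OF f fin] \<epsilon> obtain p where p: "p \<in> trig_span"
    "(sq_integral cell_measure (\<lambda>y. f y - p y)) \<le> ennreal (\<epsilon> / 2)"
    unfolding trig_approx_def by (meson half_gt_zero)
  note [measurable] = trig_span_measurable[OF p(1)]
  from trig_span_finite_sum[OF p(1)] obtain F a where F: "finite F" "F \<subseteq> int_lattice"
    "p = (\<lambda>x. \<Sum>m\<in>F. a m * wave m x)" by blast
  have pI: "(LINT y|cell_measure. (cmod (f y - p y))\<^sup>2) \<le> \<epsilon> / 2"
  proof -
    have "(LINT y|cell_measure. (cmod (f y - p y))\<^sup>2) = enn2real (sq_integral cell_measure (\<lambda>y. f y - p y))"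
      by (rule integral_eq_nn_integral) auto
    also have "\<dots> \<le> \<epsilon> / 2" using p(2) \<epsilon> by (intro enn2real_leI) auto
    finally show ?thesis .
  qed
  have "dist (sum (\<lambda>m. (cmod (?c m))\<^sup>2) X) ?N < \<epsilon>" if X: "finite X" "F \<subseteq> X" "X \<subseteq> int_lattice" for X
  proof -
    have "0 \<le> (LINT y|cell_measure. (cmod (f y - (\<Sum>m\<in>X. ?c m * wave m y)))\<^sup>2)" by simp
    also have "\<dots> = ?N - (\<Sum>m\<in>X. (cmod (?c m))\<^sup>2)"
      by (subst cell_dist_sq[OF f fin X(1,3)]) simp
    finally have 1: "(\<Sum>m\<in>X. (cmod (?c m))\<^sup>2) \<le> ?N" by simp
    have "p = (\<lambda>y. \<Sum>m\<in>X. (if m \<in> F then a m else 0) * wave m y)"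
      unfolding F(3) using X F by (intro ext sum.mono_neutral_cong_left) auto
    then have "(LINT y|cell_measure. (cmod (f y - p y))\<^sup>2) =
      ?N - (\<Sum>m\<in>X. (cmod (?c m))\<^sup>2) + (\<Sum>m\<in>X. (cmod (?c m - (if m \<in> F then a m else 0)))\<^sup>2)"
      using cell_dist_sq[OF f fin X(1,3), of "\<lambda>m. if m \<in> F then a m else 0"] by simp
    moreover have "0 \<le> (\<Sum>m\<in>X. (cmod (?c m - (if m \<in> F then a m else 0)))\<^sup>2)"
      by (intro sum_nonneg) auto
    ultimately have "?N - (\<Sum>m\<in>X. (cmod (?c m))\<^sup>2) \<le> \<epsilon> / 2" using pI by linarith
    with 1 \<epsilon> show ?thesis by (simp add: dist_real_def)
  qed
  then show "\<forall>\<^sub>F X in finite_subsets_at_top int_lattice. dist (sum (\<lambda>m. (cmod (?c m))\<^sup>2) X) ?N < \<epsilon>"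
    unfolding eventually_finite_subsets_at_top using F by blast
qed

lemma has_sum_imp_nn_integral_count_space:
  fixes f :: "'a \<Rightarrow> real"
  assumes "(f has_sum S) A" "\<And>x. x \<in> A \<Longrightarrow> 0 \<le> f x"
  shows "(\<integral>\<^sup>+x. ennreal (f x) \<partial>count_space A) = ennreal S"
proof -
  have "f summable_on A" using assms(1) by (rule has_sum_imp_summable)
  then have "(\<lambda>x. norm (f x)) summable_on A"
    by (rule summable_on_cong[THEN iffD1, rotated]) (use assms(2) in auto)
  note abs = abs_summable_equivalent[THEN iffD1, OF this]
  have "integrable (count_space A) f" using abs by (simp add: Infinite_Set_Sum.abs_summable_on_def)
  then have "(\<integral>\<^sup>+x. ennreal (f x) \<partial>count_space A) = ennreal (LINT x|count_space A. f x)"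
    by (intro nn_integral_eq_integral) (auto simp: AE_count_space assms(2))
  also have "(LINT x|count_space A. f x) = infsum f A"
    using infsetsum_infsum[OF abs] by (simp add: infsetsum_def)
  also have "\<dots> = S" using assms(1) by (rule infsumI)
  finally show ?thesis .
qed

lemma nn_integral_count_space_imp_has_sum:
  fixes f :: "'a \<Rightarrow> real"
  assumes eq: "(\<integral>\<^sup>+x. ennreal (f x) \<partial>count_space A) = ennreal S" and nn: "\<And>x. x \<in> A \<Longrightarrow> 0 \<le> f x" and S: "0 \<le> S"
  shows "(f has_sum S) A"
proof -
  have "(\<integral>\<^sup>+x. ennreal (norm (f x)) \<partial>count_space A) = (\<integral>\<^sup>+x. ennreal (f x) \<partial>count_space A)"
    by (intro nn_integral_cong) (auto simp: nn)
  then have I: "integrable (count_space A) f" using eq by (intro integrableI_bounded) auto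
  note abs = I[folded Infinite_Set_Sum.abs_summable_on_def]
  have "(\<lambda>x. norm (f x)) summable_on A" by (rule abs_summable_equivalent[THEN iffD2, OF abs])
  then have sm: "f summable_on A" by (rule abs_summable_summable)
  have "ennreal S = ennreal (LINT x|count_space A. f x)"
    using nn_integral_eq_integral[OF I] by (simp add: AE_count_space nn eq)
  moreover have "(LINT x|count_space A. f x) = infsum f A"
    using infsetsum_infsum[OF abs] by (simp add: infsetsum_def)
  moreover have "0 \<le> infsum f A" by (rule infsum_nonneg) (rule nn)
  ultimately have "infsum f A = S" using S by simp
  with sm show ?thesis by (metis has_sum_infsum)
qed

lemma parseval_cell_nn:
  fixes f :: "real^'n \<Rightarrow> complex"
  assumes f[measurable]: "f \<in> borel_measurable borel"
    and fin: "(sq_integral cell_measure f) < \<infinity>"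
  shows "(sq_integral (count_space int_lattice) (\<lambda>m. cell_coeff f m)) =
    (sq_integral cell_measure f)"
proof -
  have "(sq_integral (count_space int_lattice) (\<lambda>m. cell_coeff f m)) =
     ennreal (LINT y|cell_measure. (cmod (f y))\<^sup>2)"
    by (rule has_sum_imp_nn_integral_count_space[OF parseval_cell[OF assms]]) auto
  also have "\<dots> = (sq_integral cell_measure f)"
    by (rule nn_integral_eq_integral[symmetric]) (auto intro: L2_sq_integrable fin)
  finally show ?thesis .
qed

section \<open>Periodization\<close>

abbreviation lattice_coeff :: "real \<Rightarrow> (real^'n \<Rightarrow> complex) \<Rightarrow> real^'n \<Rightarrow> complex" where
  "lattice_coeff p G m \<equiv> (LINT x|lborel. G x * wave (- m) (x /\<^sub>R p))"

abbreviation periodic_sum :: "real \<Rightarrow> (real^'n \<Rightarrow> complex) \<Rightarrow> real^'n \<Rightarrow> complex" where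
  "periodic_sum p G y \<equiv> (LINT n|count_space int_lattice. G (p *\<^sub>R (y + n)))"

text \<open>By tiling, the integral of \<open>G\<close> against a lattice character is a Fourier
  coefficient of the periodization of \<open>G\<close>.\<close>

lemma periodization_unit:
  fixes G :: "real^'n \<Rightarrow> complex"
  assumes G: "integrable lborel G"
    and fin: "(sq_integral cell_measure (\<lambda>y. LINT n|count_space int_lattice. G (y + n))) < \<infinity>"
  shows "(sq_integral (count_space int_lattice) (\<lambda>m. LINT x|lborel. G x * wave (- m) x)) =
    (sq_integral cell_measure (\<lambda>y. LINT n|count_space int_lattice. G (y + n)))"
proof -
  define H where "H = (\<lambda>y. LINT n|count_space int_lattice. G (y + n))"
  define h where "h = (\<lambda>y. indicator unit_cell y *\<^sub>R H y)"
  have [measurable]: "G \<in> borel_measurable borel" using G by auto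
  have "H \<in> borel_measurable cell_measure"
    using borel_measurable_integrable[OF integral_tiling(1)[OF G]] by (simp add: H_def)
  then have h[measurable]: "h \<in> borel_measurable borel"
    unfolding h_def by (subst (asm) borel_measurable_restrict_space_iff) auto
  have hH: "h y = H y" if "y \<in> space cell_measure" for y
    using that by (simp add: h_def space_restrict_space)
  have eq: "(sq_integral cell_measure h) = (sq_integral cell_measure H)"
    by (intro nn_integral_cong) (simp add: hH)
  have coeff: "(LINT x|lborel. G x * wave (- m) x) = cell_coeff h m" if m: "m \<in> int_lattice" for m
  proof -
    have "integrable lborel (\<lambda>x. G x * wave (- m) x)"
      by (rule Bochner_Integration.integrable_bound[OF G]) (auto simp: norm_mult)
    from integral_tiling(2)[OF this]
    have "(LINT x|lborel. G x * wave (- m) x) =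
      (LINT y|cell_measure. LINT n|count_space int_lattice. G (y + n) * wave (- m) (y + n))" .
    also have "\<dots> = (LINT y|cell_measure. h y * wave (- m) y)"
    proof (intro Bochner_Integration.integral_cong refl)
      fix y :: "real^'n" assume y: "y \<in> space cell_measure"
      have "(LINT n|count_space int_lattice. G (y + n) * wave (- m) (y + n)) =
        (LINT n|count_space int_lattice. G (y + n) * wave (- m) y)"
        using m by (intro Bochner_Integration.integral_cong refl)
          (auto simp: wave_add wave_lattice int_lattice_uminus)
      also have "\<dots> = H y * wave (- m) y" by (simp add: H_def)
      finally show "(LINT n|count_space int_lattice. G (y + n) * wave (- m) (y + n)) = h y * wave (- m) y"
        using hH[OF y] by simp
    qed
    finally show ?thesis by (simp add: cell_coeff_def)
  qed
  have "(sq_integral (count_space int_lattice) (\<lambda>m. LINT x|lborel. G x * wave (- m) x)) =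
     (sq_integral (count_space int_lattice) (\<lambda>m. cell_coeff h m))"
    by (intro nn_integral_cong) (simp add: coeff)
  also have "\<dots> = (sq_integral cell_measure h)"
    by (rule parseval_cell_nn) (use fin eq in \<open>auto simp: H_def\<close>)
  finally show ?thesis unfolding eq by (simp add: H_def)
qed

lemma periodization:
  fixes G :: "real^'n \<Rightarrow> complex"
  assumes G: "integrable lborel G" and p: "0 < p"
    and fin: "(sq_integral cell_measure (\<lambda>y. periodic_sum p G y)) < \<infinity>"
  shows "(sq_integral (count_space int_lattice) (\<lambda>m. lattice_coeff p G m)) =
    ennreal (p ^ (2 * CARD('n))) *
    (sq_integral cell_measure (\<lambda>y. periodic_sum p G y))"
proof -
  have [measurable]: "G \<in> borel_measurable borel" using G by auto
  have Gp: "integrable lborel (\<lambda>x. G (p *\<^sub>R x))" by (rule integrable_lborel_dilation[OF G p])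
  have "(lattice_coeff p G m) =
     of_real (p ^ CARD('n)) * (LINT x|lborel. G (p *\<^sub>R x) * wave (- m) x)" for m
    using lborel_integral_affine[of "\<lambda>x. G x * wave (- m) (x /\<^sub>R p)" p 0] p by simp
  then have "(sq_integral (count_space int_lattice) (\<lambda>m. lattice_coeff p G m)) =
    (\<integral>\<^sup>+m. ennreal (p ^ (2 * CARD('n))) * ennreal ((cmod (LINT x|lborel. G (p *\<^sub>R x) * wave (- m) x))\<^sup>2) \<partial>count_space int_lattice)"
    using p by (simp add: norm_mult norm_power power_mult_distrib ennreal_mult power_mult power2_eq_square mult_ac power_even_eq)
  also have "\<dots> = ennreal (p ^ (2 * CARD('n))) * (sq_integral (count_space int_lattice) (\<lambda>m. LINT x|lborel. G (p *\<^sub>R x) * wave (- m) x))"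
    by (subst nn_integral_cmult) auto
  also have "(sq_integral (count_space int_lattice) (\<lambda>m. LINT x|lborel. G (p *\<^sub>R x) * wave (- m) x)) =
    (sq_integral cell_measure (\<lambda>y. periodic_sum p G y))"
    using periodization_unit[OF Gp] fin by simp
  finally show ?thesis .
qed

section \<open>Plancherel's theorem for bounded support\<close>

definition energy :: "(real^'n \<Rightarrow> complex) \<Rightarrow> ennreal" where
  "energy f = (sq_integral lborel f)"

text \<open>Square-integrable Borel functions, whose compositions with continuous maps stay
  measurable.\<close>

definition finite_energy :: "(real^'n \<Rightarrow> complex) \<Rightarrow> bool" where
  "finite_energy f \<longleftrightarrow> f \<in> borel_measurable borel \<and> energy f < \<infinity>"

definition pairing :: "(real^'n \<Rightarrow> complex) \<Rightarrow> (real^'n \<Rightarrow> complex) \<Rightarrow> complex" where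
  "pairing f g = (LINT x|lborel. f x * cnj (g x))"

definition bounded_support :: "(real^'n \<Rightarrow> complex) \<Rightarrow> bool" where
  "bounded_support f \<longleftrightarrow> (\<exists>R. \<forall>x. R < norm x \<longrightarrow> f x = 0)"

text \<open>In terms of characters, so that values at dual lattice points are lattice
  coefficients.\<close>

definition fourier_L1 :: "(real^'n \<Rightarrow> complex) \<Rightarrow> real^'n \<Rightarrow> complex" where
  "fourier_L1 u \<omega> = (LINT x|lborel. u x * wave (- \<omega>) x)"

lemma finite_energy_measurable [measurable_dest]: "finite_energy f \<Longrightarrow> f \<in> borel_measurable borel"
  by (simp add: finite_energy_def)

lemma energy_add_le:
  assumes [measurable]: "f \<in> borel_measurable borel" "g \<in> borel_measurable borel"
  shows "energy (\<lambda>x. f x + g x) \<le> 2 * energy f + 2 * energy g"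
  unfolding energy_def by (rule nn_integral_sq_add_le) auto

lemma energy_cmult:
  assumes [measurable]: "f \<in> borel_measurable borel"
  shows "energy (\<lambda>x. c * f x) = ennreal ((cmod c)\<^sup>2) * energy f"
  unfolding energy_def
  by (subst nn_integral_cmult[symmetric]) (auto simp: norm_mult power_mult_distrib ennreal_mult)

lemma energy_diff_commute: "energy (\<lambda>x. f x - g x) = energy (\<lambda>x. g x - f x)"
  by (simp add: energy_def norm_minus_commute)

lemma energy_triangle:
  assumes [measurable]: "f \<in> borel_measurable borel" "g \<in> borel_measurable borel" "h \<in> borel_measurable borel"
  shows "energy (\<lambda>x. f x - h x) \<le> 2 * energy (\<lambda>x. f x - g x) + 2 * energy (\<lambda>x. g x - h x)"
  using energy_add_le[of "\<lambda>x. f x - g x" "\<lambda>x. g x - h x"] by simp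

lemma energy_mono: "(\<And>x. cmod (f x) \<le> cmod (g x)) \<Longrightarrow> energy f \<le> energy g"
  unfolding energy_def by (intro nn_integral_mono ennreal_leI power_mono) auto

lemma finite_energy_add: "finite_energy f \<Longrightarrow> finite_energy g \<Longrightarrow> finite_energy (\<lambda>x. f x + g x)"
  using le_less_trans[OF energy_add_le[of f g], of \<infinity>]
  by (auto simp: finite_energy_def ennreal_mult_less_top)

lemma finite_energy_cmult: "finite_energy f \<Longrightarrow> finite_energy (\<lambda>x. c * f x)"
  by (auto simp: finite_energy_def energy_cmult ennreal_mult_less_top)

lemma finite_energy_diff: "finite_energy f \<Longrightarrow> finite_energy g \<Longrightarrow> finite_energy (\<lambda>x. f x - g x)"
  using finite_energy_add[of f "\<lambda>x. (-1) * g x"] finite_energy_cmult[of g "-1"] by simp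

lemma pairing_integrable:
  "finite_energy f \<Longrightarrow> finite_energy g \<Longrightarrow> integrable lborel (\<lambda>x. f x * cnj (g x))"
  by (rule L2_cnj_integrable) (auto simp: finite_energy_def energy_def)

lemma finite_energy_sq_integrable: "finite_energy f \<Longrightarrow> integrable lborel (\<lambda>x. (cmod (f x))\<^sup>2)"
  by (rule L2_sq_integrable) (auto simp: finite_energy_def energy_def)

lemma energy_eq_integral: "finite_energy f \<Longrightarrow> energy f = ennreal (LINT x|lborel. (cmod (f x))\<^sup>2)"
  unfolding energy_def by (intro nn_integral_eq_integral finite_energy_sq_integrable) auto

lemma pairing_bound:
  assumes "finite_energy f" "finite_energy g"
  shows "cmod (pairing f g) \<le> sqrt (enn2real (energy f)) * sqrt (enn2real (energy g))"
proof -
  have [measurable]: "f \<in> borel_measurable borel" "g \<in> borel_measurable borel"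
    using assms by (auto simp: finite_energy_def)
  note I = pairing_integrable[OF assms]
  have "ennreal (cmod (pairing f g)) \<le> (\<integral>\<^sup>+x. ennreal (cmod (f x * cnj (g x))) \<partial>lborel)"
    unfolding pairing_def by (rule integral_norm_bound_ennreal[OF I])
  also have "\<dots> = (\<integral>\<^sup>+x. ennreal (cmod (f x)) * ennreal (cmod (g x)) \<partial>lborel)"
    by (simp add: norm_mult ennreal_mult)
  finally have "(ennreal (cmod (pairing f g)))\<^sup>2 \<le> (\<integral>\<^sup>+x. ennreal (cmod (f x)) * ennreal (cmod (g x)) \<partial>lborel)\<^sup>2"
    by (intro power_mono) auto
  also have "\<dots> \<le> (\<integral>\<^sup>+x. (ennreal (cmod (f x)))\<^sup>2 \<partial>lborel) * (\<integral>\<^sup>+x. (ennreal (cmod (g x)))\<^sup>2 \<partial>lborel)"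
    by (rule Cauchy_Schwarz_nn_integral) auto
  also have "\<dots> = energy f * energy g"
    by (simp add: energy_def ennreal_power)
  also have "\<dots> = ennreal (enn2real (energy f) * enn2real (energy g))"
    using assms by (simp add: finite_energy_def ennreal_mult)
  finally have "(cmod (pairing f g))\<^sup>2 \<le> enn2real (energy f) * enn2real (energy g)"
    by (simp add: ennreal_power)
  then have "sqrt ((cmod (pairing f g))\<^sup>2) \<le> sqrt (enn2real (energy f) * enn2real (energy g))"
    by (rule real_sqrt_le_mono)
  then show ?thesis by (simp add: real_sqrt_mult)
qed

lemma pairing_diff_left: "finite_energy f \<Longrightarrow> finite_energy g \<Longrightarrow> finite_energy h \<Longrightarrow>
    pairing (\<lambda>x. f x - g x) h = pairing f h - pairing g h"
  unfolding pairing_def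
  by (subst Bochner_Integration.integral_diff[symmetric]) (auto intro: pairing_integrable simp: algebra_simps)

lemma pairing_diff_right: "finite_energy f \<Longrightarrow> finite_energy g \<Longrightarrow> finite_energy h \<Longrightarrow>
    pairing h (\<lambda>x. f x - g x) = pairing h f - pairing h g"
  unfolding pairing_def
  by (subst Bochner_Integration.integral_diff[symmetric]) (auto intro: pairing_integrable simp: algebra_simps)

lemma tendsto_pairing:
  assumes f: "finite_energy f" "\<And>n. finite_energy (f' n)" and g: "finite_energy g" "\<And>n. finite_energy (g' n)"
    and lim: "((\<lambda>n. energy (\<lambda>x. f' n x - f x)) \<longlongrightarrow> 0) F" "((\<lambda>n. energy (\<lambda>x. g' n x - g x)) \<longlongrightarrow> 0) F"
  shows "((\<lambda>n. pairing (f' n) (g' n)) \<longlongrightarrow> pairing f g) F"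
proof -
  have lim': "((\<lambda>n. sqrt (enn2real (energy (\<lambda>x. f' n x - f x)))) \<longlongrightarrow> 0) F"
    "((\<lambda>n. sqrt (enn2real (energy (\<lambda>x. g' n x - g x)))) \<longlongrightarrow> 0) F"
    using tendsto_real_sqrt[OF tendsto_enn2real[OF lim(1)[folded ennreal_0]]]
      tendsto_real_sqrt[OF tendsto_enn2real[OF lim(2)[folded ennreal_0]]] by simp_all
  note d = finite_energy_diff[OF f(2) f(1)] finite_energy_diff[OF g(2) g(1)]
  have eq: "pairing (f' n) (g' n) - pairing f g =
     pairing (\<lambda>x. f' n x - f x) (\<lambda>x. g' n x - g x) + pairing (\<lambda>x. f' n x - f x) g + pairing f (\<lambda>x. g' n x - g x)" for n
    using f g d by (simp add: pairing_diff_left pairing_diff_right)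
  have "((\<lambda>n. pairing (f' n) (g' n) - pairing f g) \<longlongrightarrow> 0) F"
  proof (rule Lim_null_comparison)
    show "\<forall>\<^sub>F n in F. norm (pairing (f' n) (g' n) - pairing f g) \<le>
      sqrt (enn2real (energy (\<lambda>x. f' n x - f x))) * sqrt (enn2real (energy (\<lambda>x. g' n x - g x))) +
      sqrt (enn2real (energy (\<lambda>x. f' n x - f x))) * sqrt (enn2real (energy g)) +
      sqrt (enn2real (energy f)) * sqrt (enn2real (energy (\<lambda>x. g' n x - g x)))"
      unfolding eq
      by (intro always_eventually allI order_trans[OF norm_triangle_ineq] add_mono pairing_bound f g d)
    show "((\<lambda>n. sqrt (enn2real (energy (\<lambda>x. f' n x - f x))) * sqrt (enn2real (energy (\<lambda>x. g' n x - g x))) +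
      sqrt (enn2real (energy (\<lambda>x. f' n x - f x))) * sqrt (enn2real (energy g)) +
      sqrt (enn2real (energy f)) * sqrt (enn2real (energy (\<lambda>x. g' n x - g x)))) \<longlongrightarrow> 0) F"
      using tendsto_add[OF tendsto_add[OF tendsto_mult[OF lim'] tendsto_mult[OF lim'(1) tendsto_const]]
        tendsto_mult[OF tendsto_const lim'(2)]] by simp
  qed
  then show ?thesis by (rule LIM_zero_cancel)
qed

text \<open>Reduces the preservation of inner products by the Fourier transform to that of the
  energy.\<close>

lemma pairing_polarization:
  assumes "finite_energy f" "finite_energy g"
  shows "4 * pairing f g =
    of_real (enn2real (energy (\<lambda>x. f x + 1 * g x))) - of_real (enn2real (energy (\<lambda>x. f x + (-1) * g x))) +
    \<i> * of_real (enn2real (energy (\<lambda>x. f x + \<i> * g x))) - \<i> * of_real (enn2real (energy (\<lambda>x. f x + (-\<i>) * g x)))"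
proof -
  have fe: "finite_energy (\<lambda>x. f x + c * g x)" for c
    by (intro finite_energy_add finite_energy_cmult assms)
  define h where "h = (\<lambda>c x. complex_of_real ((cmod (f x + c * g x))\<^sup>2))"
  have en: "complex_of_real (enn2real (energy (\<lambda>x. f x + c * g x))) = (LINT x|lborel. h c x)" for c
    unfolding energy_eq_integral[OF fe] h_def by (subst integral_complex_of_real) simp
  have I: "integrable lborel (h c)" for c
    unfolding h_def using finite_energy_sq_integrable[OF fe] by (intro integrable_of_real)
  have "(LINT x|lborel. 4 * (f x * cnj (g x))) = (LINT x|lborel. h 1 x - h (-1) x + \<i> * h \<i> x - \<i> * h (-\<i>) x)"
    unfolding h_def complex_norm_square
    by (intro Bochner_Integration.integral_cong refl) (simp add: algebra_simps)
  then show ?thesis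
    unfolding en pairing_def using I by simp
qed

lemma wave_joint_measurable [measurable]:
  "(\<lambda>(\<omega>, x). wave (- \<omega>) x) \<in> borel_measurable (borel \<Otimes>\<^sub>M borel)"
proof -
  have "(\<lambda>z :: (real^'n) \<times> (real^'n). wave (- fst z) (snd z)) \<in> borel_measurable borel"
    unfolding wave_def by (intro borel_measurable_continuous_onI continuous_intros)
  then show ?thesis by (simp add: borel_prod case_prod_unfold)
qed

lemma fourier_L1_measurable:
  assumes [measurable]: "u \<in> borel_measurable borel"
  shows "fourier_L1 u \<in> borel_measurable borel"
proof -
  have "(\<lambda>(\<omega>, x). u x * wave (- \<omega>) x) \<in> borel_measurable (borel \<Otimes>\<^sub>M lborel)"
  proof -
    have 1: "(\<lambda>z. u (snd z)) \<in> borel_measurable (borel \<Otimes>\<^sub>M lborel)" for z by measurable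
    have "(\<lambda>(\<omega>, x). wave (- \<omega>) x) \<in> borel_measurable (borel \<Otimes>\<^sub>M lborel)"
      using wave_joint_measurable by (simp cong: measurable_cong_sets sets_pair_measure_cong)
    then have 2: "(\<lambda>z. wave (- fst z) (snd z)) \<in> borel_measurable (borel \<Otimes>\<^sub>M lborel)"
      by (simp add: case_prod_unfold)
    show ?thesis using borel_measurable_times[OF 1 2] by (simp add: case_prod_unfold)
  qed
  from lborel.borel_measurable_lebesgue_integral[OF this]
  show ?thesis unfolding fourier_L1_def by simp
qed

lemma unit_cell_iff_norm: "norm x < 1/2 \<Longrightarrow> x \<in> unit_cell"
proof -
  assume x: "norm x < 1/2"
  have "- 1/2 \<le> x $ i \<and> x $ i < 1/2" for i
    using component_le_norm_cart[of x i] x by linarith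
  then show ?thesis by (simp add: unit_cell_def)
qed

text \<open>This separates the central period from the others: only the summand \<open>n = 0\<close> of
  a periodization sees values near the origin.\<close>

lemma norm_lattice_translate:
  assumes "y \<in> unit_cell" "n \<in> int_lattice" "n \<noteq> 0"
  shows "1/2 \<le> norm (y + n)"
proof (rule ccontr)
  assume "\<not> 1/2 \<le> norm (y + n)"
  then have "y + n \<in> unit_cell" by (intro unit_cell_iff_norm) auto
  then have "0 = n"
    using unit_cell_ex1[of "y + n"] assms int_lattice_0 by fastforce
  with assms show False by simp
qed

lemma bounded_support_integrable:
  fixes f :: "real^'n \<Rightarrow> complex"
  assumes f: "finite_energy f" and "bounded_support f"
  shows "integrable lborel f"
proof -
  from assms obtain R where R: "\<And>x. R < norm x \<Longrightarrow> f x = 0" by (auto simp: bounded_support_def)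
  let ?g = "\<lambda>x :: real^'n. indicator (cball 0 R) x :: complex"
  have "(sq_integral lborel ?g) = (\<integral>\<^sup>+x. indicator (cball 0 R) x \<partial>(lborel :: (real^'n) measure))"
    by (intro nn_integral_cong) (auto simp: indicator_def)
  also have "\<dots> < \<infinity>" using emeasure_lborel_cball_finite by simp
  finally have fin: "(sq_integral lborel ?g) < \<infinity>" .
  have "?g \<in> borel_measurable lborel" by (rule borel_measurable_indicator) simp
  then have "integrable lborel (\<lambda>x. f x * ?g x)"
    using f fin by (intro L2_mult_integrable) (auto simp: finite_energy_def energy_def)
  also have "(\<lambda>x. f x * ?g x) = f" using R by (auto simp: fun_eq_iff indicator_def not_le)
  finally show ?thesis .
qed

text \<open>With a period larger than the support, the periodization of \<open>f\<close> times a
  character is that product itself, so Parseval's identity evaluates the sum of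
  \<open>|f\<^sup>^|\<^sup>2\<close> over each translate \<open>(\<theta> + \<int>\<^sup>d)/p\<close> of
  the dual lattice. Its value does not depend on \<open>\<theta>\<close>; integrating over
  \<open>\<theta>\<close> and tiling gives the energy of \<open>f\<^sup>^\<close>.\<close>

lemma plancherel_bounded_support:
  fixes f :: "real^'n \<Rightarrow> complex"
  assumes f: "finite_energy f" and bs: "bounded_support f"
  shows "energy (fourier_L1 f) = energy f"
proof -
  from bs obtain R0 where R0: "\<And>x. R0 < norm x \<Longrightarrow> f x = 0" by (auto simp: bounded_support_def)
  define R where "R = max R0 1"
  have R: "R < norm x \<Longrightarrow> f x = 0" for x using R0 by (simp add: R_def)
  \<comment> \<open>the cell of side \<open>p\<close> has to contain the ball of radius \<open>R\<close>\<close>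
  define p where "p = 2 * R + 1"
  have p: "0 < p" by (simp add: p_def R_def)
  note [measurable] = finite_energy_measurable[OF f] fourier_L1_measurable[OF finite_energy_measurable[OF f]]
  have I: "integrable lborel f" by (rule bounded_support_integrable[OF f bs])
  have far: "f (p *\<^sub>R z) = 0" if "1/2 \<le> norm z" for z
  proof (rule R)
    have "R < p * (1/2)" by (simp add: p_def)
    also have "\<dots> \<le> p * norm z" using that p by (intro mult_left_mono) auto
    finally show "R < norm (p *\<^sub>R z)" using p by simp
  qed
  have cell: "(sq_integral cell_measure (\<lambda>y. f (p *\<^sub>R y))) =
     (sq_integral lborel (\<lambda>y. f (p *\<^sub>R y)))"
  proof -
    have "f (p *\<^sub>R y) = 0" if "y \<notin> unit_cell" for y
      using that unit_cell_iff_norm[of y] by (intro far) force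
    then show ?thesis
      by (subst nn_integral_restrict_space) (auto intro!: nn_integral_cong simp: indicator_def)
  qed
  have scale: "ennreal (p ^ CARD('n)) * (sq_integral lborel (\<lambda>y. f (p *\<^sub>R y))) = energy f"
    using nn_integral_lborel_affine[of "\<lambda>x. ennreal ((cmod (f x))\<^sup>2)" p 0] p by (simp add: energy_def)
  have sum: "(sq_integral (count_space int_lattice) (\<lambda>m. fourier_L1 f ((\<theta> + m) /\<^sub>R p))) =
      ennreal (p ^ CARD('n)) * energy f" for \<theta> :: "real^'n"
  proof -
    define G where "G = (\<lambda>x. f x * wave (- (\<theta> /\<^sub>R p)) x)"
    have GI: "integrable lborel G" unfolding G_def
      by (rule Bochner_Integration.integrable_bound[OF I]) (auto simp: norm_mult)
    have per: "(periodic_sum p G y) = G (p *\<^sub>R y)" if y: "y \<in> unit_cell" for y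
    proof -
      have z: "G (p *\<^sub>R (y + n)) = 0" if "n \<in> int_lattice" "n \<noteq> 0" for n
        using far norm_lattice_translate[OF y that] by (simp add: G_def)
      have "(periodic_sum p G y) =
        (LINT n|count_space int_lattice. indicator {0 :: real^'n} n *\<^sub>R G (p *\<^sub>R y))"
        using z by (intro Bochner_Integration.integral_cong) (auto simp: indicator_def)
      also have "\<dots> = G (p *\<^sub>R y)"
      proof -
        have "(LINT n|count_space int_lattice. indicator {0 :: real^'n} n *\<^sub>R G (p *\<^sub>R y)) =
           (LINT n|count_space int_lattice. indicator {0 :: real^'n} n :: real) *\<^sub>R G (p *\<^sub>R y)"
          by (rule integral_scaleR_left) (auto simp: int_lattice_0)
        then show ?thesis by (simp add: int_lattice_0)
      qed
      finally show ?thesis .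
    qed
    have eqG: "(sq_integral cell_measure (\<lambda>y. periodic_sum p G y)) =
       (sq_integral cell_measure (\<lambda>y. f (p *\<^sub>R y)))"
      by (intro nn_integral_cong) (simp add: space_restrict_space per, simp add: G_def norm_mult)
    have "energy f < \<infinity>" using f by (simp add: finite_energy_def)
    then have fin: "(sq_integral cell_measure (\<lambda>y. f (p *\<^sub>R y))) < \<infinity>"
      unfolding cell scale[symmetric] using p by (auto simp: ennreal_mult_less_top)
    have "(sq_integral (count_space int_lattice) (\<lambda>m. fourier_L1 f ((\<theta> + m) /\<^sub>R p))) =
       (sq_integral (count_space int_lattice) (\<lambda>m. lattice_coeff p G m))"
    proof (intro nn_integral_cong)
      fix m :: "real^'n"
      have "wave (- ((\<theta> + m) /\<^sub>R p)) x = wave (- (\<theta> /\<^sub>R p)) x * wave (- m) (x /\<^sub>R p)" for x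
        by (simp add: wave_def cis_mult algebra_simps inner_add)
      then have "fourier_L1 f ((\<theta> + m) /\<^sub>R p) = (lattice_coeff p G m)"
        unfolding fourier_L1_def G_def by (simp add: mult.assoc)
      then show "ennreal ((cmod (fourier_L1 f ((\<theta> + m) /\<^sub>R p)))\<^sup>2) =
        ennreal ((cmod (lattice_coeff p G m))\<^sup>2)" by simp
    qed
    also have "\<dots> = ennreal (p ^ (2 * CARD('n))) * (sq_integral cell_measure (\<lambda>y. f (p *\<^sub>R y)))"
      using periodization[OF GI p] fin unfolding eqG by simp
    also have "\<dots> = ennreal (p ^ CARD('n)) * energy f"
      unfolding cell scale[symmetric] using p by (simp add: mult_2 power_add ennreal_mult mult.assoc)
    finally show ?thesis .
  qed
  have "energy (fourier_L1 f) = ennreal (\<bar>1 / p\<bar> ^ DIM(real^'n)) * (sq_integral lborel (\<lambda>x. fourier_L1 f (0 + (1 / p) *\<^sub>R x)))"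
    unfolding energy_def using p by (intro nn_integral_lborel_affine) auto
  also have "\<dots> = ennreal (1 / p ^ CARD('n)) * (sq_integral lborel (\<lambda>x. fourier_L1 f (x /\<^sub>R p)))"
    using p by (simp add: power_one_over inverse_eq_divide)
  also have "(sq_integral lborel (\<lambda>x. fourier_L1 f (x /\<^sub>R p))) =
     (\<integral>\<^sup>+\<theta>. (sq_integral (count_space int_lattice) (\<lambda>m. fourier_L1 f ((\<theta> + m) /\<^sub>R p))) \<partial>cell_measure)"
    by (rule nn_integral_tiling) measurable
  also have "\<dots> = ennreal (p ^ CARD('n)) * energy f"
    unfolding sum by (simp add: space_restrict_space)
  also have "ennreal (1 / p ^ CARD('n)) * (ennreal (p ^ CARD('n)) * energy f) = energy f"
    using p by (simp add: mult.assoc[symmetric] ennreal_mult[symmetric])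
  finally show ?thesis .
qed

lemma fourier_L1_add_cmult:
  fixes f g :: "real^'n \<Rightarrow> complex"
  assumes "finite_energy f" "bounded_support f" "finite_energy g" "bounded_support g"
  shows "fourier_L1 (\<lambda>x. f x + c * g x) = (\<lambda>\<omega>. fourier_L1 f \<omega> + c * fourier_L1 g \<omega>)"
proof
  fix \<omega> :: "real^'n"
  have I: "integrable lborel (\<lambda>x. h x * wave (- \<omega>) x)" if "finite_energy h" "bounded_support h" for h :: "real^'n \<Rightarrow> complex"
  proof -
    note [measurable] = finite_energy_measurable[OF that(1)]
    show ?thesis
      by (rule Bochner_Integration.integrable_bound[OF bounded_support_integrable[OF that]]) (auto simp: norm_mult)
  qed
  show "fourier_L1 (\<lambda>x. f x + c * g x) \<omega> = fourier_L1 f \<omega> + c * fourier_L1 g \<omega>"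
    unfolding fourier_L1_def using I[OF assms(1,2)] I[OF assms(3,4)] by (simp add: algebra_simps)
qed

lemma bounded_support_add_cmult:
  assumes "bounded_support f" "bounded_support g"
  shows "bounded_support (\<lambda>x. f x + c * g x)"
proof -
  from assms obtain R S where "\<And>x. R < norm x \<Longrightarrow> f x = 0" "\<And>x. S < norm x \<Longrightarrow> g x = 0"
    by (auto simp: bounded_support_def)
  then show ?thesis unfolding bounded_support_def by (intro exI[of _ "max R S"]) auto
qed

lemma finite_energy_fourier_L1:
  "finite_energy f \<Longrightarrow> bounded_support f \<Longrightarrow> finite_energy (fourier_L1 f)"
  using plancherel_bounded_support[of f] by (auto simp: finite_energy_def fourier_L1_measurable)

lemma energy_fourier_L1_diff:
  assumes "finite_energy f" "bounded_support f" "finite_energy g" "bounded_support g"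
  shows "energy (\<lambda>\<omega>. fourier_L1 f \<omega> - fourier_L1 g \<omega>) = energy (\<lambda>x. f x - g x)"
proof -
  have "energy (fourier_L1 (\<lambda>x. f x + (-1) * g x)) = energy (\<lambda>x. f x + (-1) * g x)"
    by (intro plancherel_bounded_support finite_energy_add finite_energy_cmult bounded_support_add_cmult assms)
  then show ?thesis unfolding fourier_L1_add_cmult[OF assms] by simp
qed

lemma pairing_fourier_L1:
  assumes "finite_energy f" "bounded_support f" "finite_energy g" "bounded_support g"
  shows "pairing (fourier_L1 f) (fourier_L1 g) = pairing f g"
proof -
  have "energy (\<lambda>\<omega>. fourier_L1 f \<omega> + c * fourier_L1 g \<omega>) = energy (\<lambda>x. f x + c * g x)" for c
    unfolding fourier_L1_add_cmult[OF assms, symmetric]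
    by (intro plancherel_bounded_support finite_energy_add finite_energy_cmult bounded_support_add_cmult assms)
  then have "4 * pairing (fourier_L1 f) (fourier_L1 g) = 4 * pairing f g"
    using assms by (simp only: pairing_polarization finite_energy_fourier_L1)
  then show ?thesis by simp
qed

section \<open>The Fourier transform of square-integrable functions\<close>

definition trunc :: "real \<Rightarrow> (real^'n \<Rightarrow> complex) \<Rightarrow> real^'n \<Rightarrow> complex" where
  "trunc R f = (\<lambda>x. indicator (cball 0 R) x * f x)"

text \<open>The limit relation that defines the Fourier transform, between Borel functions.\<close>

definition fourier_L2 :: "(real^'n \<Rightarrow> complex) \<Rightarrow> (real^'n \<Rightarrow> complex) \<Rightarrow> bool" where
  "fourier_L2 f g \<longleftrightarrow> finite_energy g \<and>
     ((\<lambda>R. energy (\<lambda>\<omega>. fourier_L1 (trunc R f) \<omega> - g \<omega>)) \<longlongrightarrow> 0) at_top"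

lemma trunc_measurable:
  assumes [measurable]: "f \<in> borel_measurable borel"
  shows "trunc R f \<in> borel_measurable borel"
proof -
  have [measurable]: "(\<lambda>x. indicator (cball 0 R) x :: complex) \<in> borel_measurable borel"
    by (rule borel_measurable_indicator) simp
  show ?thesis unfolding trunc_def by measurable
qed

lemma finite_energy_trunc: "finite_energy f \<Longrightarrow> finite_energy (trunc R f)"
proof -
  assume f: "finite_energy f"
  have "energy (trunc R f) \<le> energy f"
    by (rule energy_mono) (auto simp: trunc_def indicator_def)
  with f show ?thesis by (auto simp: finite_energy_def trunc_measurable)
qed

lemma bounded_support_trunc: "bounded_support (trunc R f)"
  unfolding bounded_support_def trunc_def by (intro exI[of _ R]) (auto simp: indicator_def)

lemma tendsto_zero_antimono:
  fixes e :: "real \<Rightarrow> ennreal"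
  assumes lim: "(\<lambda>n. e (real n)) \<longlonglongrightarrow> 0" and mono: "\<And>R S. R \<le> S \<Longrightarrow> e S \<le> e R"
  shows "(e \<longlongrightarrow> 0) at_top"
proof (rule order_tendstoI)
  fix a :: ennreal assume "0 < a"
  then have "\<forall>\<^sub>F n in sequentially. e (real n) < a" using lim by (rule order_tendstoD(2)[rotated])
  then obtain n where "e (real n) < a" by (auto simp: eventually_sequentially)
  then show "\<forall>\<^sub>F R in at_top. e R < a"
    using mono by (intro eventually_at_top_linorderI[of "real n"]) (auto intro: le_less_trans)
qed auto

lemma trunc_tendsto:
  assumes f: "finite_energy f"
  shows "((\<lambda>R. energy (\<lambda>x. trunc R f x - f x)) \<longlongrightarrow> 0) at_top"
proof (rule tendsto_zero_antimono)
  note [measurable] = finite_energy_measurable[OF f] trunc_measurable[OF finite_energy_measurable[OF f]]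
  show "energy (\<lambda>x. trunc S f x - f x) \<le> energy (\<lambda>x. trunc R f x - f x)" if "R \<le> S" for R S
    using that by (intro energy_mono) (auto simp: trunc_def indicator_def)
  have "(\<lambda>n. \<integral>\<^sup>+x. ennreal ((cmod (trunc (real n) f x - f x))\<^sup>2) \<partial>lborel) \<longlonglongrightarrow> (\<integral>\<^sup>+x. 0 \<partial>(lborel :: (real^'a) measure))"
  proof (rule nn_integral_dominated_convergence[where w="\<lambda>x. ennreal ((cmod (f x))\<^sup>2)"])
    show "AE x in lborel. ennreal ((cmod (trunc (real n) f x - f x))\<^sup>2) \<le> ennreal ((cmod (f x))\<^sup>2)" for n
      by (intro AE_I2 ennreal_leI) (auto simp: trunc_def indicator_def)
    show "AE x in lborel. (\<lambda>n. ennreal ((cmod (trunc (real n) f x - f x))\<^sup>2)) \<longlonglongrightarrow> 0"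
    proof (rule AE_I2)
      fix x :: "real^'a"
      obtain N :: nat where N: "norm x \<le> real N" using real_arch_simple by blast
      have "ennreal ((cmod (trunc (real n) f x - f x))\<^sup>2) = 0" if "n \<ge> N" for n
      proof -
        have "norm x \<le> real n" using N that by linarith
        then show ?thesis by (simp add: trunc_def indicator_def)
      qed
      then show "(\<lambda>n. ennreal ((cmod (trunc (real n) f x - f x))\<^sup>2)) \<longlonglongrightarrow> 0"
        by (intro tendsto_eventually eventually_sequentiallyI[of N])
    qed
    show "(sq_integral lborel f) < \<infinity>"
      using f by (simp add: finite_energy_def energy_def)
  qed auto
  then show "(\<lambda>n. energy (\<lambda>x. trunc (real n) f x - f x)) \<longlonglongrightarrow> 0" by (simp add: energy_def)
qed

text \<open>The increments \<open>u (Suc k) - u k\<close> have energy at most \<open>C /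
  4\<^sup>k\<close>, so the series of their squares weighted by \<open>2\<^sup>k\<close> has a finite
  integral. Hence almost everywhere the increments are dominated by a geometric series, the sequence
  converges pointwise, and Fatou's lemma carries the Cauchy bounds over to the limit.\<close>

lemma L2_complete:
  fixes u :: "nat \<Rightarrow> real^'n \<Rightarrow> complex"
  assumes u: "\<And>k. finite_energy (u k)"
    and cauchy: "\<And>k m. k \<le> m \<Longrightarrow> energy (\<lambda>x. u m x - u k x) \<le> ennreal (C / 4 ^ k)" and C: "0 \<le> C"
  shows "\<exists>g. finite_energy g \<and> (\<forall>k. energy (\<lambda>x. u k x - g x) \<le> ennreal (C / 4 ^ k))"
proof -
  have [measurable]: "u k \<in> borel_measurable borel" for k by (rule finite_energy_measurable[OF u])
  define D where "D = (\<lambda>k x. u (Suc k) x - u k x)"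
  have term_le: "F k \<le> suminf F" for F :: "nat \<Rightarrow> ennreal" and k
    using sum_le_suminf[of F "{k}"] by simp
  have [measurable]: "D k \<in> borel_measurable borel" for k unfolding D_def by measurable
  define T where "T = (\<lambda>x. \<Sum>k. ennreal (2 ^ k * (cmod (D k x))\<^sup>2))"
  have "(\<integral>\<^sup>+x. T x \<partial>lborel) = (\<Sum>k. \<integral>\<^sup>+x. ennreal (2 ^ k * (cmod (D k x))\<^sup>2) \<partial>lborel)"
    unfolding T_def by (rule nn_integral_suminf) measurable
  also have "\<dots> \<le> (\<Sum>k. ennreal (C * (1/2) ^ k))"
  proof (rule suminf_le)
    fix k
    have "(\<integral>\<^sup>+x. ennreal (2 ^ k * (cmod (D k x))\<^sup>2) \<partial>lborel) = ennreal (2 ^ k) * energy (D k)"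
      unfolding energy_def by (subst nn_integral_cmult[symmetric]) (auto simp: ennreal_mult)
    also have "\<dots> \<le> ennreal (2 ^ k) * ennreal (C / 4 ^ k)"
      using cauchy[of k "Suc k"] by (intro mult_left_mono) (auto simp: D_def)
    also have "\<dots> = ennreal (C * (1/2) ^ k)"
    proof -
      have "(2::real) ^ k * (C / 4 ^ k) = C * (1/2) ^ k"
      proof -
        have "(4::real) ^ k = 2 ^ k * 2 ^ k" by (simp flip: power_mult_distrib)
        then show ?thesis by (simp add: power_one_over field_simps)
      qed
      then show ?thesis using C by (simp flip: ennreal_mult)
    qed
    finally show "(\<integral>\<^sup>+x. ennreal (2 ^ k * (cmod (D k x))\<^sup>2) \<partial>lborel) \<le> ennreal (C * (1/2) ^ k)" .
  qed auto
  also have "\<dots> < \<infinity>"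
  proof -
    have "summable (\<lambda>k. C * (1/2::real) ^ k)" by (intro summable_mult summable_geometric) auto
    then have "(\<Sum>k. ennreal (C * (1/2) ^ k)) = ennreal (\<Sum>k. C * (1/2) ^ k)"
      using C by (intro suminf_ennreal2) auto
    then show ?thesis by (simp only: ennreal_less_top infinity_ennreal_def)
  qed
  finally have Tfin: "(\<integral>\<^sup>+x. T x \<partial>lborel) < \<infinity>" .
  have Tm: "T \<in> borel_measurable borel" unfolding T_def by measurable
  have "AE x in lborel. T x \<noteq> \<infinity>"
    using Tm Tfin by (intro nn_integral_PInf_AE) auto
  then have conv: "AE x in lborel. convergent (\<lambda>k. u k x)"
  proof (eventually_elim)
    fix x assume T: "T x \<noteq> \<infinity>"
    define B where "B = enn2real (T x)"
    have B: "T x = ennreal B" "0 \<le> B" using T by (auto simp: B_def less_top)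
    have "cmod (D k x) \<le> sqrt B * (sqrt (1/2)) ^ k" for k
    proof -
      have "ennreal (2 ^ k * (cmod (D k x))\<^sup>2) \<le> T x"
        unfolding T_def by (rule term_le)
      then have "2 ^ k * (cmod (D k x))\<^sup>2 \<le> B" using B by simp
      then have "(cmod (D k x))\<^sup>2 \<le> B * (1/2) ^ k" by (simp add: power_one_over field_simps)
      then have "sqrt ((cmod (D k x))\<^sup>2) \<le> sqrt (B * (1/2) ^ k)" by (rule real_sqrt_le_mono)
      then show ?thesis by (simp add: real_sqrt_mult real_sqrt_power)
    qed
    moreover have "sqrt (1/2) < (1::real)" by (simp add: real_sqrt_divide)
    then have "summable (\<lambda>k. sqrt B * (sqrt (1/2)) ^ k)"
      by (intro summable_mult summable_geometric) (simp del: real_sqrt_divide)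
    ultimately have "summable (\<lambda>k. D k x)"
      using summable_comparison_test'[of "\<lambda>k. sqrt B * (sqrt (1/2)) ^ k" 0 "\<lambda>k. D k x"] by blast
    then have "convergent (\<lambda>n. \<Sum>k<n. D k x)" by (simp add: summable_iff_convergent)
    then have "convergent (\<lambda>n. u 0 x + (\<Sum>k<n. D k x))" by (intro convergent_add convergent_const)
    moreover have "u 0 x + (\<Sum>k<n. D k x) = u n x" for n
      using sum_lessThan_telescope[of "\<lambda>k. u k x" n] by (simp add: D_def)
    ultimately show "convergent (\<lambda>k. u k x)" by simp
  qed
  define g where "g = (\<lambda>x. lim (\<lambda>k. u k x))"
  have [measurable]: "g \<in> borel_measurable borel" unfolding g_def by measurable
  have bound: "energy (\<lambda>x. u k x - g x) \<le> ennreal (C / 4 ^ k)" for k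
  proof -
    have "energy (\<lambda>x. u k x - g x) = (\<integral>\<^sup>+x. liminf (\<lambda>m. ennreal ((cmod (u m x - u k x))\<^sup>2)) \<partial>lborel)"
      unfolding energy_def
    proof (rule nn_integral_cong_AE)
      show "AE x in lborel. ennreal ((cmod (u k x - g x))\<^sup>2) = liminf (\<lambda>m. ennreal ((cmod (u m x - u k x))\<^sup>2))"
        using conv
      proof eventually_elim
        fix x assume "convergent (\<lambda>k. u k x)"
        then have "(\<lambda>m. u m x) \<longlonglongrightarrow> g x" by (simp add: g_def convergent_LIMSEQ_iff)
        then have "(\<lambda>m. ennreal ((cmod (u m x - u k x))\<^sup>2)) \<longlonglongrightarrow> ennreal ((cmod (g x - u k x))\<^sup>2)"
          by (intro tendsto_ennrealI tendsto_intros)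
        then show "ennreal ((cmod (u k x - g x))\<^sup>2) = liminf (\<lambda>m. ennreal ((cmod (u m x - u k x))\<^sup>2))"
          by (subst lim_imp_Liminf) (auto simp: norm_minus_commute)
      qed
    qed
    also have "\<dots> \<le> liminf (\<lambda>m. \<integral>\<^sup>+x. ennreal ((cmod (u m x - u k x))\<^sup>2) \<partial>lborel)"
      by (rule nn_integral_liminf) measurable
    also have "\<dots> \<le> limsup (\<lambda>m. \<integral>\<^sup>+x. ennreal ((cmod (u m x - u k x))\<^sup>2) \<partial>lborel)"
      by (rule Liminf_le_Limsup) simp
    also have "\<dots> \<le> ennreal (C / 4 ^ k)"
      using cauchy[of k] by (intro Limsup_bounded eventually_sequentiallyI[of k]) (auto simp: energy_def)
    finally show ?thesis .
  qed
  have "finite_energy (\<lambda>x. u 0 x - g x)"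
    using bound[of 0] by (auto simp: finite_energy_def intro: le_less_trans)
  then have "finite_energy (\<lambda>x. u 0 x - (u 0 x - g x))" by (rule finite_energy_diff[OF u])
  then have "finite_energy g" by simp
  with bound show ?thesis by blast
qed

text \<open>The transforms of the truncations form a Cauchy family because truncations do and the
  transform is isometric on them. A rapidly convergent sequence of radii supplies the limit, and
  monotonicity of the truncation error extends the convergence to all radii.\<close>

lemma fourier_L2_exists:
  assumes f: "finite_energy f"
  shows "\<exists>g. fourier_L2 f g"
proof -
  let ?t = "\<lambda>R. energy (\<lambda>x. trunc R f x - f x)"
  note [measurable] = finite_energy_measurable[OF f] trunc_measurable[OF finite_energy_measurable[OF f]]
    fourier_L1_measurable[OF trunc_measurable[OF finite_energy_measurable[OF f]]]
  have mono: "?t S \<le> ?t R" if "R \<le> S" for R S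
    using that by (intro energy_mono) (auto simp: trunc_def indicator_def)
  have d: "energy (\<lambda>\<omega>. fourier_L1 (trunc S f) \<omega> - fourier_L1 (trunc R f) \<omega>) \<le> 4 * ?t R" if "R \<le> S" for R S
  proof -
    have "energy (\<lambda>\<omega>. fourier_L1 (trunc S f) \<omega> - fourier_L1 (trunc R f) \<omega>) = energy (\<lambda>x. trunc S f x - trunc R f x)"
      by (intro energy_fourier_L1_diff finite_energy_trunc f bounded_support_trunc)
    also have "\<dots> \<le> 2 * ?t S + 2 * energy (\<lambda>x. f x - trunc R f x)"
      by (rule energy_triangle) auto
    also have "\<dots> \<le> 2 * ?t R + 2 * ?t R"
      using mono[OF that] by (intro add_mono mult_left_mono) (auto simp: energy_diff_commute)
    also have "\<dots> = 4 * ?t R" by (simp flip: distrib_right)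
    finally show ?thesis .
  qed
  have "\<exists>R. ?t R \<le> ennreal (1 / 4 ^ k)" for k
  proof -
    have "\<forall>\<^sub>F R in at_top. ?t R < ennreal (1 / 4 ^ k)"
      using trunc_tendsto[OF f] by (rule order_tendstoD) simp
    then show ?thesis by (metis (mono_tags, lifting) eventually_at_top_linorder less_imp_le order_refl)
  qed
  then obtain r0 where r0: "?t (r0 k) \<le> ennreal (1 / 4 ^ k)" for k by metis
  \<comment> \<open>the radii have to increase for the Cauchy estimate\<close>
  define r where "r = (\<lambda>k. Max (r0 ` {..k}))"
  have r: "?t (r k) \<le> ennreal (1 / 4 ^ k)" for k
    using mono[of "r0 k" "r k"] r0[of k] by (auto simp: r_def intro: order_trans)
  have r_mono: "k \<le> m \<Longrightarrow> r k \<le> r m" for k m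
    unfolding r_def by (intro Max_mono) auto
  obtain g where g: "finite_energy g" "\<And>k. energy (\<lambda>\<omega>. fourier_L1 (trunc (r k) f) \<omega> - g \<omega>) \<le> ennreal (4 / 4 ^ k)"
  proof -
    have "\<exists>g. finite_energy g \<and> (\<forall>k. energy (\<lambda>x. fourier_L1 (trunc (r k) f) x - g x) \<le> ennreal (4 / 4 ^ k))"
    proof (rule L2_complete)
      show "finite_energy (fourier_L1 (trunc (r k) f))" for k
        by (intro finite_energy_fourier_L1 finite_energy_trunc f bounded_support_trunc)
      fix k m :: nat assume "k \<le> m"
      have "energy (\<lambda>\<omega>. fourier_L1 (trunc (r m) f) \<omega> - fourier_L1 (trunc (r k) f) \<omega>) \<le> 4 * ?t (r k)"
        by (rule d[OF r_mono]) fact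
      also have "\<dots> \<le> 4 * ennreal (1 / 4 ^ k)" by (intro mult_left_mono r) auto
      also have "\<dots> = ennreal (4 / 4 ^ k)" by (subst ennreal_numeral[symmetric], subst ennreal_mult[symmetric]) auto
      finally show "energy (\<lambda>\<omega>. fourier_L1 (trunc (r m) f) \<omega> - fourier_L1 (trunc (r k) f) \<omega>) \<le> ennreal (4 / 4 ^ k)" .
    qed simp
    with that show ?thesis by blast
  qed
  note [measurable] = finite_energy_measurable[OF g(1)]
  have "((\<lambda>R. energy (\<lambda>\<omega>. fourier_L1 (trunc R f) \<omega> - g \<omega>)) \<longlongrightarrow> 0) at_top"
  proof (rule order_tendstoI)
    fix a :: ennreal assume a: "0 < a"
    have "(\<lambda>k. ennreal (16 * (1/4) ^ k)) \<longlonglongrightarrow> ennreal (16 * 0)"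
      by (intro tendsto_ennrealI tendsto_mult tendsto_const LIMSEQ_power_zero) auto
    then have "\<forall>\<^sub>F k in sequentially. ennreal (16 * (1/4) ^ k) < a"
      using a by (intro order_tendstoD(2)) auto
    then obtain k where k: "ennreal (16 * (1/4) ^ k) < a" by (auto simp: eventually_sequentially)
    have "energy (\<lambda>\<omega>. fourier_L1 (trunc R f) \<omega> - g \<omega>) < a" if "r k \<le> R" for R
    proof -
      have "energy (\<lambda>\<omega>. fourier_L1 (trunc R f) \<omega> - g \<omega>) \<le>
        2 * energy (\<lambda>\<omega>. fourier_L1 (trunc R f) \<omega> - fourier_L1 (trunc (r k) f) \<omega>) + 2 * energy (\<lambda>\<omega>. fourier_L1 (trunc (r k) f) \<omega> - g \<omega>)"
        by (rule energy_triangle) auto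
      also have "\<dots> \<le> 2 * (4 * ennreal (1 / 4 ^ k)) + 2 * ennreal (4 / 4 ^ k)"
        using order_trans[OF d[OF that] mult_left_mono[OF r[of k]]] g(2)[of k] by (intro add_mono mult_left_mono) auto
      also have "\<dots> = ennreal (16 * (1/4) ^ k)"
      proof -
        have "2 * (4 * ennreal (1 / 4 ^ k)) = ennreal (8 / 4 ^ k)"
          by (simp flip: ennreal_mult' ennreal_numeral)
        moreover have "2 * ennreal (4 / 4 ^ k) = ennreal (8 / 4 ^ k)"
          by (simp flip: ennreal_mult' ennreal_numeral)
        ultimately have "2 * (4 * ennreal (1 / 4 ^ k)) + 2 * ennreal (4 / 4 ^ k) = ennreal (8 / 4 ^ k + 8 / 4 ^ k)"
          by (simp flip: ennreal_plus)
        then show ?thesis by (simp add: power_one_over)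
      qed
      finally show ?thesis using k by simp
    qed
    then show "\<forall>\<^sub>F R in at_top. energy (\<lambda>\<omega>. fourier_L1 (trunc R f) \<omega> - g \<omega>) < a"
      by (rule eventually_at_top_linorderI)
  qed auto
  with g show ?thesis by (auto simp: fourier_L2_def)
qed

lemma pairing_fourier_L2_fourier_L1:
  assumes "fourier_L2 f F" "finite_energy f" "finite_energy u" "bounded_support u"
  shows "pairing F (fourier_L1 u) = pairing f u"
proof -
  have 1: "((\<lambda>R. pairing (fourier_L1 (trunc R f)) (fourier_L1 u)) \<longlongrightarrow> pairing F (fourier_L1 u)) at_top"
    using assms by (intro tendsto_pairing)
      (auto simp: fourier_L2_def finite_energy_fourier_L1 finite_energy_trunc bounded_support_trunc energy_def)
  have 2: "((\<lambda>R. pairing (trunc R f) u) \<longlongrightarrow> pairing f u) at_top"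
    using assms by (intro tendsto_pairing trunc_tendsto)
      (auto simp: finite_energy_trunc energy_def)
  have "pairing (fourier_L1 (trunc R f)) (fourier_L1 u) = pairing (trunc R f) u" for R
    using assms by (intro pairing_fourier_L1 finite_energy_trunc bounded_support_trunc)
  with 1 2 show ?thesis by (simp add: tendsto_unique[OF trivial_limit_at_top_linorder])
qed

section \<open>Wave packets and their Fourier transforms\<close>

text \<open>The functions \<open>\<phi>\<^sub>j\<^sub>,\<^sub>k\<^sub>,\<^sub>\<lambda>\<close> have
  this form for both signs of \<open>j\<close>, with \<open>b = 1\<close> for \<open>j \<ge> 0\<close>
  and \<open>b = 4\<^bsup>|j|\<^esup>\<close> for \<open>j < 0\<close>.\<close>

definition packet :: "complex \<Rightarrow> real \<Rightarrow> real^'n \<Rightarrow> (real^'n) set \<Rightarrow> (real^'n \<Rightarrow> complex) \<Rightarrow> real^'n \<Rightarrow> complex" where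
  "packet c b x0 S \<phi> t = c * (\<Sum>\<eta>\<in>S. wave \<eta> ((t - x0) /\<^sub>R b) * \<phi> ((t - x0) /\<^sub>R b))"

definition packet_hat :: "complex \<Rightarrow> real \<Rightarrow> real^'n \<Rightarrow> (real^'n) set \<Rightarrow> (real^'n \<Rightarrow> complex) \<Rightarrow> real^'n \<Rightarrow> complex" where
  "packet_hat c b x0 S \<psi> \<omega> = c * of_real (b ^ CARD('n)) * wave (- \<omega>) x0 * (\<Sum>\<eta>\<in>S. \<psi> (b *\<^sub>R \<omega> - \<eta>))"

lemma packet_measurable:
  assumes [measurable]: "\<phi> \<in> borel_measurable borel"
  shows "packet c b x0 S \<phi> \<in> borel_measurable borel"
  unfolding packet_def[abs_def] by measurable

lemma packet_hat_measurable:
  assumes [measurable]: "\<psi> \<in> borel_measurable borel"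
  shows "packet_hat c b x0 S \<psi> \<in> borel_measurable borel"
proof -
  have [measurable]: "(\<lambda>\<omega>. wave (- \<omega>) x0) \<in> borel_measurable borel"
    unfolding wave_def by (intro borel_measurable_continuous_onI continuous_intros)
  show ?thesis unfolding packet_hat_def[abs_def] by measurable
qed

lemma energy_affine:
  fixes h :: "real^'n \<Rightarrow> complex"
  assumes [measurable]: "h \<in> borel_measurable borel" and b: "0 < b"
  shows "energy h = ennreal (b ^ CARD('n)) * energy (\<lambda>x. h (t + b *\<^sub>R x))"
  unfolding energy_def
  using nn_integral_lborel_affine[of "\<lambda>x. ennreal ((cmod (h x))\<^sup>2)" b t] b by simp

lemma energy_packet_le:
  fixes h :: "real^'n \<Rightarrow> complex"
  assumes [measurable]: "h \<in> borel_measurable borel" and b: "0 < b"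
  shows "energy (packet c b x0 S h) \<le> ennreal ((cmod c * real (card S))\<^sup>2 * b ^ CARD('n)) * energy h"
proof -
  have le: "cmod (packet c b x0 S h t) \<le> cmod (of_real (cmod c * real (card S)) * h ((t - x0) /\<^sub>R b))" for t
  proof -
    have "cmod (\<Sum>\<eta>\<in>S. wave \<eta> ((t - x0) /\<^sub>R b) * h ((t - x0) /\<^sub>R b)) \<le>
      (\<Sum>\<eta>\<in>S. cmod (wave \<eta> ((t - x0) /\<^sub>R b) * h ((t - x0) /\<^sub>R b)))" by (rule norm_sum)
    also have "\<dots> = real (card S) * cmod (h ((t - x0) /\<^sub>R b))" by (simp add: norm_mult)
    finally have "cmod c * cmod (\<Sum>\<eta>\<in>S. wave \<eta> ((t - x0) /\<^sub>R b) * h ((t - x0) /\<^sub>R b)) \<le>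
       cmod c * (real (card S) * cmod (h ((t - x0) /\<^sub>R b)))" by (rule mult_left_mono) simp
    then show ?thesis by (simp add: packet_def norm_mult)
  qed
  have "energy (packet c b x0 S h) \<le> energy (\<lambda>t. of_real (cmod c * real (card S)) * h ((t - x0) /\<^sub>R b))"
    by (rule energy_mono[OF le])
  also have "\<dots> = ennreal ((cmod c * real (card S))\<^sup>2) * energy (\<lambda>t. h ((t - x0) /\<^sub>R b))"
    by (subst energy_cmult) (auto simp: norm_mult)
  also have "energy (\<lambda>t. h ((t - x0) /\<^sub>R b)) = ennreal (b ^ CARD('n)) * energy h"
    using b by (subst energy_affine[where b=b and t=x0]) auto
  finally show ?thesis using b by (simp add: ennreal_mult mult.assoc)
qed

lemma energy_packet_hat_le:
  fixes h :: "real^'n \<Rightarrow> complex"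
  assumes h[measurable]: "h \<in> borel_measurable borel" and b: "0 < b"
  shows "energy (packet_hat c b x0 S h) \<le> ennreal ((cmod c * real (card S))\<^sup>2 * b ^ CARD('n)) * energy h"
proof -
  have le: "(cmod (packet_hat c b x0 S h \<omega>))\<^sup>2 \<le>
     (cmod c * b ^ CARD('n))\<^sup>2 * real (card S) * (\<Sum>\<eta>\<in>S. (cmod (h (b *\<^sub>R \<omega> - \<eta>)))\<^sup>2)" for \<omega>
  proof -
    have "(cmod (\<Sum>\<eta>\<in>S. h (b *\<^sub>R \<omega> - \<eta>)))\<^sup>2 \<le> (\<Sum>\<eta>\<in>S. 1 * cmod (h (b *\<^sub>R \<omega> - \<eta>)))\<^sup>2"
      using norm_sum[of "\<lambda>\<eta>. h (b *\<^sub>R \<omega> - \<eta>)" S] by (intro power_mono) auto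
    also have "\<dots> \<le> (\<Sum>\<eta>\<in>S. 1\<^sup>2) * (\<Sum>\<eta>\<in>S. (cmod (h (b *\<^sub>R \<omega> - \<eta>)))\<^sup>2)"
      by (rule Cauchy_Schwarz_ineq_sum)
    finally have "(cmod c * b ^ CARD('n))\<^sup>2 * (cmod (\<Sum>\<eta>\<in>S. h (b *\<^sub>R \<omega> - \<eta>)))\<^sup>2 \<le>
      (cmod c * b ^ CARD('n))\<^sup>2 * (real (card S) * (\<Sum>\<eta>\<in>S. (cmod (h (b *\<^sub>R \<omega> - \<eta>)))\<^sup>2))"
      by (intro mult_left_mono) auto
    then show ?thesis using b by (simp add: packet_hat_def norm_mult norm_power power_mult_distrib mult.assoc)
  qed
  let ?K = "(cmod c * b ^ CARD('n))\<^sup>2 * real (card S)"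
  have "energy (packet_hat c b x0 S h) \<le>
    (\<integral>\<^sup>+\<omega>. ennreal (?K * (\<Sum>\<eta>\<in>S. (cmod (h (b *\<^sub>R \<omega> - \<eta>)))\<^sup>2)) \<partial>lborel)"
    unfolding energy_def by (intro nn_integral_mono ennreal_leI le)
  also have "\<dots> = (\<integral>\<^sup>+\<omega>. ennreal ?K * (\<Sum>\<eta>\<in>S. ennreal ((cmod (h (b *\<^sub>R \<omega> - \<eta>)))\<^sup>2)) \<partial>lborel)"
    using b by (simp add: ennreal_mult sum_nonneg)
  also have "\<dots> = ennreal ?K * (\<Sum>\<eta>\<in>S. energy (\<lambda>\<omega>. h (b *\<^sub>R \<omega> - \<eta>)))"
    unfolding energy_def
    by (subst nn_integral_cmult, measurable, subst nn_integral_sum) (auto simp del: sum_ennreal)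
  also have "(\<Sum>\<eta>\<in>S. energy (\<lambda>\<omega>. h (b *\<^sub>R \<omega> - \<eta>))) = (\<Sum>\<eta>\<in>S. ennreal (1 / b ^ CARD('n)) * energy h)"
  proof (intro sum.cong refl)
    fix \<eta>
    have "energy h = ennreal (b ^ CARD('n)) * energy (\<lambda>\<omega>. h (b *\<^sub>R \<omega> - \<eta>))"
      using energy_affine[OF h b, of "- \<eta>"] by simp
    then show "energy (\<lambda>\<omega>. h (b *\<^sub>R \<omega> - \<eta>)) = ennreal (1 / b ^ CARD('n)) * energy h"
      using b by (simp add: mult.assoc[symmetric] ennreal_mult[symmetric])
  qed
  also have "ennreal ?K * \<dots> = ennreal (?K * (real (card S) * (1 / b ^ CARD('n)))) * energy h"
  proof -
    have "(\<Sum>\<eta>\<in>S. ennreal (1 / b ^ CARD('n)) * energy h) = ennreal (real (card S)) * (ennreal (1 / b ^ CARD('n)) * energy h)"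
      by (simp add: ennreal_of_nat_eq_real_of_nat)
    also have "ennreal ?K * \<dots> = (ennreal ?K * (ennreal (real (card S)) * ennreal (1 / b ^ CARD('n)))) * energy h"
      by (simp only: mult.assoc)
    also have "\<dots> = ennreal (?K * (real (card S) * (1 / b ^ CARD('n)))) * energy h"
    proof -
      have "ennreal (x * (y * z)) = ennreal x * (ennreal y * ennreal z)"
        if "0 \<le> x" "0 \<le> y" "0 \<le> z" for x y z
        using that by (simp add: ennreal_mult)
      from this[of ?K "real (card S)" "1 / b ^ CARD('n)"] show ?thesis using b by simp
    qed
    finally show ?thesis .
  qed
  also have "?K * (real (card S) * (1 / b ^ CARD('n))) = (cmod c * real (card S))\<^sup>2 * b ^ CARD('n)"
    using b by (simp add: power2_eq_square field_simps)
  finally show ?thesis .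
qed

lemma packet_diff: "packet c b x0 S f t - packet c b x0 S g t = packet c b x0 S (\<lambda>x. f x - g x) t"
  by (simp add: packet_def right_diff_distrib sum_subtractf)

lemma packet_hat_diff: "packet_hat c b x0 S f t - packet_hat c b x0 S g t = packet_hat c b x0 S (\<lambda>x. f x - g x) t"
  by (simp add: packet_hat_def right_diff_distrib sum_subtractf)

lemma finite_energy_packet:
  assumes "finite_energy h" "0 < b"
  shows "finite_energy (packet c b x0 S h)" and "finite_energy (packet_hat c b x0 S h)"
  using assms le_less_trans[OF energy_packet_le[of h b c x0 S], of \<infinity>]
    le_less_trans[OF energy_packet_hat_le[of h b c x0 S], of \<infinity>]
  by (auto simp: finite_energy_def packet_measurable packet_hat_measurable ennreal_mult_less_top)

lemma bounded_support_packet: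
  assumes "bounded_support h" "0 < b"
  shows "bounded_support (packet c b x0 S h)"
proof -
  from assms(1) obtain R where R: "\<And>x. R < norm x \<Longrightarrow> h x = 0" by (auto simp: bounded_support_def)
  have "packet c b x0 S h t = 0" if "norm x0 + b * R < norm t" for t
  proof -
    have "b * R < norm (t - x0)" using that norm_triangle_ineq2[of t x0] by linarith
    then have "R < norm (t - x0) / b" using assms(2) by (simp add: field_simps)
    also have "\<dots> = norm ((t - x0) /\<^sub>R b)" using assms(2) by (simp add: divide_inverse mult.commute)
    finally have "R < norm ((t - x0) /\<^sub>R b)" .
    then show ?thesis by (simp add: packet_def R)
  qed
  then show ?thesis by (auto simp: bounded_support_def)
qed

lemma fourier_L1_packet:
  fixes h :: "real^'n \<Rightarrow> complex"
  assumes h: "finite_energy h" "bounded_support h" and b: "0 < b"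
  shows "fourier_L1 (packet c b x0 S h) = packet_hat c b x0 S (fourier_L1 h)"
proof
  fix \<omega>
  note [measurable] = finite_energy_measurable[OF h(1)] packet_measurable[OF finite_energy_measurable[OF h(1)]]
  have I: "integrable lborel (\<lambda>x. h x * wave m x)" for m
    by (rule Bochner_Integration.integrable_bound[OF bounded_support_integrable[OF h]]) (auto simp: norm_mult)
  have "fourier_L1 (packet c b x0 S h) \<omega> = of_real (b ^ CARD('n)) *
      (LINT x|lborel. packet c b x0 S h (x0 + b *\<^sub>R x) * wave (- \<omega>) (x0 + b *\<^sub>R x))"
    unfolding fourier_L1_def using b by (subst lborel_integral_affine[where c=b and t=x0]) auto
  also have "(LINT x|lborel. packet c b x0 S h (x0 + b *\<^sub>R x) * wave (- \<omega>) (x0 + b *\<^sub>R x)) =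
      (LINT x|lborel. (c * wave (- \<omega>) x0) * (\<Sum>\<eta>\<in>S. h x * wave (- (b *\<^sub>R \<omega> - \<eta>)) x))"
  proof (intro Bochner_Integration.integral_cong refl)
    fix x
    have w: "wave \<eta> x * wave (- \<omega>) (b *\<^sub>R x) = wave (- (b *\<^sub>R \<omega> - \<eta>)) x" for \<eta>
      by (simp add: wave_def cis_mult algebra_simps inner_add inner_diff)
    show "packet c b x0 S h (x0 + b *\<^sub>R x) * wave (- \<omega>) (x0 + b *\<^sub>R x) =
       (c * wave (- \<omega>) x0) * (\<Sum>\<eta>\<in>S. h x * wave (- (b *\<^sub>R \<omega> - \<eta>)) x)"
      using b unfolding w[symmetric]
      by (simp add: packet_def wave_add sum_distrib_left sum_distrib_right ac_simps)
  qed
  also have "\<dots> = (c * wave (- \<omega>) x0) * (\<Sum>\<eta>\<in>S. fourier_L1 h (b *\<^sub>R \<omega> - \<eta>))"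
    unfolding fourier_L1_def using I by simp
  finally show "fourier_L1 (packet c b x0 S h) \<omega> = packet_hat c b x0 S (fourier_L1 h) \<omega>"
    by (simp add: packet_hat_def ac_simps)
qed

text \<open>For a truncation of \<open>\<phi>\<close> the transform of the packet is an explicit
  integral. Both operations on \<open>\<phi>\<close> and on its transform are bounded for the energy, so
  the identity survives the removal of the truncation.\<close>

lemma pairing_packet:
  assumes f: "finite_energy f" "fourier_L2 f F" and \<phi>: "finite_energy \<phi>" "fourier_L2 \<phi> \<psi>" and b: "0 < b"
  shows "pairing f (packet c b x0 S \<phi>) = pairing F (packet_hat c b x0 S \<psi>)"
proof -
  let ?K = "ennreal ((cmod c * real (card S))\<^sup>2 * b ^ CARD('a))"
  have F: "finite_energy F" and \<psi>: "finite_energy \<psi>" using f \<phi> by (auto simp: fourier_L2_def)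
  have tm: "trunc R \<phi> \<in> borel_measurable borel" for R by (intro trunc_measurable finite_energy_measurable \<phi>)
  have lim1: "((\<lambda>R. energy (\<lambda>x. packet c b x0 S (trunc R \<phi>) x - packet c b x0 S \<phi> x)) \<longlongrightarrow> 0) at_top"
  proof (rule tendsto_sandwich[OF _ _ tendsto_const])
    show "\<forall>\<^sub>F R in at_top. energy (\<lambda>x. packet c b x0 S (trunc R \<phi>) x - packet c b x0 S \<phi> x) \<le>
        ?K * energy (\<lambda>x. trunc R \<phi> x - \<phi> x)"
      unfolding packet_diff
      by (intro always_eventually allI energy_packet_le b borel_measurable_diff tm finite_energy_measurable \<phi>)
    show "((\<lambda>R. ?K * energy (\<lambda>x. trunc R \<phi> x - \<phi> x)) \<longlongrightarrow> 0) at_top"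
      using ennreal_tendsto_cmult[OF _ trunc_tendsto[OF \<phi>(1)], of ?K] by simp
  qed auto
  have lim2: "((\<lambda>R. energy (\<lambda>x. packet_hat c b x0 S (fourier_L1 (trunc R \<phi>)) x - packet_hat c b x0 S \<psi> x)) \<longlongrightarrow> 0) at_top"
  proof (rule tendsto_sandwich[OF _ _ tendsto_const])
    show "\<forall>\<^sub>F R in at_top. energy (\<lambda>x. packet_hat c b x0 S (fourier_L1 (trunc R \<phi>)) x - packet_hat c b x0 S \<psi> x) \<le>
        ?K * energy (\<lambda>x. fourier_L1 (trunc R \<phi>) x - \<psi> x)"
      unfolding packet_hat_diff
      by (intro always_eventually allI energy_packet_hat_le b borel_measurable_diff fourier_L1_measurable tm finite_energy_measurable \<psi>)
    show "((\<lambda>R. ?K * energy (\<lambda>x. fourier_L1 (trunc R \<phi>) x - \<psi> x)) \<longlongrightarrow> 0) at_top"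
      using ennreal_tendsto_cmult[of ?K "\<lambda>R. energy (\<lambda>x. fourier_L1 (trunc R \<phi>) x - \<psi> x)" 0 at_top] \<phi>(2)
      by (simp add: fourier_L2_def)
  qed auto
  note tr = finite_energy_trunc[OF \<phi>(1)] bounded_support_trunc
  have "((\<lambda>R. pairing f (packet c b x0 S (trunc R \<phi>))) \<longlongrightarrow> pairing f (packet c b x0 S \<phi>)) at_top"
    using lim1 by (intro tendsto_pairing f finite_energy_packet b \<phi> tr) (auto simp: energy_def)
  moreover have "((\<lambda>R. pairing F (packet_hat c b x0 S (fourier_L1 (trunc R \<phi>)))) \<longlongrightarrow> pairing F (packet_hat c b x0 S \<psi>)) at_top"
    using lim2 by (intro tendsto_pairing F finite_energy_packet b \<psi> finite_energy_fourier_L1 tr) (auto simp: energy_def)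
  moreover have "pairing F (packet_hat c b x0 S (fourier_L1 (trunc R \<phi>))) = pairing f (packet c b x0 S (trunc R \<phi>))" for R
    using pairing_fourier_L2_fourier_L1[OF f(2,1) finite_energy_packet(1)[OF tr(1) b] bounded_support_packet[OF tr(2) b]]
    by (simp add: fourier_L1_packet[OF tr b])
  ultimately show ?thesis by (simp add: tendsto_unique[OF trivial_limit_at_top_linorder])
qed

section \<open>Borel representatives\<close>

lemma AE_lborel_affine:
  fixes P :: "'a::euclidean_space \<Rightarrow> bool"
  assumes "AE x in lborel. P x" and c: "c \<noteq> 0"
  shows "AE x in lborel. P (t + c *\<^sub>R x)"
proof -
  from assms(1) obtain N where N: "{x. \<not> P x} \<subseteq> N" "N \<in> null_sets lborel"
    by (auto simp: eventually_ae_filter)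
  then have [measurable]: "N \<in> sets borel" by auto
  have [measurable]: "(\<lambda>x. t + c *\<^sub>R x) -` N \<in> sets borel"
    using measurable_sets[of "\<lambda>x. t + c *\<^sub>R x" borel borel N] by simp
  have "ennreal (\<bar>c\<bar> ^ DIM('a)) * emeasure lborel ((\<lambda>x. t + c *\<^sub>R x) -` N) =
    ennreal (\<bar>c\<bar> ^ DIM('a)) * (\<integral>\<^sup>+x. indicator N (t + c *\<^sub>R x) \<partial>lborel)"
    by (simp flip: nn_integral_indicator add: indicator_vimage)
  also have "\<dots> = (\<integral>\<^sup>+x. indicator N x \<partial>lborel)"
    using c by (intro nn_integral_lborel_affine[symmetric]) auto
  also have "\<dots> = 0" using N by auto
  finally have "emeasure lborel ((\<lambda>x. t + c *\<^sub>R x) -` N) = 0" using c by auto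
  then have "(\<lambda>x. t + c *\<^sub>R x) -` N \<in> null_sets lborel" by auto
  moreover have "{x. \<not> P (t + c *\<^sub>R x)} \<subseteq> (\<lambda>x. t + c *\<^sub>R x) -` N" using N by auto
  ultimately show ?thesis by (auto simp: eventually_ae_filter)
qed

lemma L2_Borel_version:
  assumes u: "u \<in> L2"
  shows "\<exists>u0. finite_energy u0 \<and> (AE x in lborel. u x = u0 x)"
proof -
  from u have m: "u \<in> borel_measurable lebesgue" and I: "integrable lebesgue (\<lambda>x. (cmod (u x))\<^sup>2)"
    by (auto simp: L2_def)
  have "(\<lambda>x. Re (u x)) \<in> borel_measurable lebesgue" using m by measurable
  from completion_ex_borel_measurable_real[OF this]
  obtain r where [measurable]: "r \<in> borel_measurable lborel" and r: "AE x in lborel. Re (u x) = r x" by blast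
  have "(\<lambda>x. Im (u x)) \<in> borel_measurable lebesgue" using m by measurable
  from completion_ex_borel_measurable_real[OF this]
  obtain i where [measurable]: "i \<in> borel_measurable lborel" and i: "AE x in lborel. Im (u x) = i x" by blast
  define u0 where "u0 = (\<lambda>x. Complex (r x) (i x))"
  have "(\<lambda>x. complex_of_real (r x) + \<i> * complex_of_real (i x)) \<in> borel_measurable lborel" by measurable
  moreover have "u0 = (\<lambda>x. complex_of_real (r x) + \<i> * complex_of_real (i x))"
    by (simp add: u0_def fun_eq_iff complex_eq_iff)
  ultimately have m0: "u0 \<in> borel_measurable borel" by simp
  have ae: "AE x in lborel. u x = u0 x"
    using r i by eventually_elim (simp add: u0_def complex_eq_iff)
  have "energy u0 = (sq_integral lborel u)"
    unfolding energy_def using ae by (intro nn_integral_cong_AE) (auto elim: AE_mp)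
  also have "\<dots> = (sq_integral lebesgue u)"
    by (rule nn_integral_completion[symmetric])
  also have "\<dots> < \<infinity>" using I by (simp add: integrable_iff_bounded)
  finally show ?thesis using m0 ae by (auto simp: finite_energy_def)
qed

lemma finite_energy_L2: "finite_energy f \<Longrightarrow> f \<in> L2"
  by (auto simp: L2_def finite_energy_def energy_def nn_integral_completion
      intro!: integrableI_bounded measurable_completion)

lemma fourier_integral_eq_fourier_L1:
  assumes [measurable]: "u0 \<in> borel_measurable borel" and ae: "AE x in lborel. u x = u0 x"
  shows "fourier_integral u \<omega> = fourier_L1 u0 \<omega>"
proof -
  have m: "(\<lambda>x. u0 x * wave (- \<omega>) x) \<in> borel_measurable lborel" by measurable
  have ae': "AE x in lebesgue. u0 x * wave (- \<omega>) x = u x * wave (- \<omega>) x"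
    using AE_completion[OF ae] by eventually_elim simp
  have "fourier_integral u \<omega> = (LINT x|lebesgue. u x * wave (- \<omega>) x)"
    unfolding fourier_integral_def
    by (intro Bochner_Integration.integral_cong refl) (simp add: wave_def cis_conv_exp inner_commute mult_ac)
  also have "\<dots> = (LINT x|lebesgue. u0 x * wave (- \<omega>) x)"
    using ae' m by (intro integral_cong_AE borel_measurable_AE[OF _ ae'] measurable_completion) (auto elim: AE_mp)
  also have "\<dots> = (LINT x|lborel. u0 x * wave (- \<omega>) x)"
    by (rule integral_completion[OF m])
  finally show ?thesis by (simp add: fourier_L1_def)
qed

text \<open>Changing \<open>u\<close> and \<open>g\<close> on null sets affects none of the integrals in
  the defining relation.\<close>

lemma is_fourier_transform_iff_fourier_L2:
  assumes u: "finite_energy u0" "AE x in lborel. u x = u0 x"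
    and g: "finite_energy g0" "AE x in lborel. g x = g0 x" and gL: "g \<in> L2"
  shows "is_fourier_transform u g \<longleftrightarrow> fourier_L2 u0 g0"
proof -
  have "(sq_integral lebesgue (\<lambda>\<omega>. g \<omega> - fourier_integral (\<lambda>x. indicator (cball 0 R) x * u x) \<omega>)) =
    energy (\<lambda>\<omega>. fourier_L1 (trunc R u0) \<omega> - g0 \<omega>)" for R
  proof -
    have "AE x in lborel. indicator (cball 0 R) x * u x = trunc R u0 x"
      using u(2) by eventually_elim (simp add: trunc_def)
    from fourier_integral_eq_fourier_L1[OF trunc_measurable[OF finite_energy_measurable[OF u(1)]] this]
    have eq: "fourier_integral (\<lambda>x. indicator (cball 0 R) x * u x) \<omega> = fourier_L1 (trunc R u0) \<omega>" for \<omega> .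
    show ?thesis
      unfolding eq nn_integral_completion energy_def using g(2)
      by (intro nn_integral_cong_AE) (auto elim!: AE_mp simp: norm_minus_commute)
  qed
  then show ?thesis using g(1) gL by (simp add: is_fourier_transform_def fourier_L2_def)
qed

text \<open>The transform is chosen by the Hilbert operator among the functions that satisfy its
  defining relation; existence for the Borel representative shows that the choice is from a nonempty
  set.\<close>

lemma fourier_Borel_version:
  assumes u: "finite_energy u0" "AE x in lborel. u x = u0 x"
  shows "\<exists>\<psi>. finite_energy \<psi> \<and> fourier_L2 u0 \<psi> \<and> (AE x in lborel. fourier u x = \<psi> x)"
proof -
  from fourier_L2_exists[OF u(1)] obtain g where g: "fourier_L2 u0 g" by blast
  then have "finite_energy g" by (simp add: fourier_L2_def)
  then have "is_fourier_transform u g"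
    using is_fourier_transform_iff_fourier_L2[OF u, of g g] g finite_energy_L2[of g] by simp
  then have F: "is_fourier_transform u (fourier u)"
    unfolding fourier_def by (rule someI[where P="is_fourier_transform u"])
  then have L: "fourier u \<in> L2" by (simp add: is_fourier_transform_def)
  from L2_Borel_version[OF L] obtain \<psi> where \<psi>: "finite_energy \<psi>" "AE x in lborel. fourier u x = \<psi> x" by blast
  with is_fourier_transform_iff_fourier_L2[OF u \<psi> L] F show ?thesis by blast
qed

lemma L2_inner_eq_pairing:
  assumes f: "finite_energy f0" "AE x in lborel. f x = f0 x"
    and g: "finite_energy g0" "AE x in lborel. g x = g0 x"
  shows "L2_inner f g = pairing f0 g0"
proof -
  note [measurable] = finite_energy_measurable[OF f(1)] finite_energy_measurable[OF g(1)]
  have m: "(\<lambda>x. f0 x * cnj (g0 x)) \<in> borel_measurable lborel" by measurable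
  have ae: "AE x in lebesgue. f0 x * cnj (g0 x) = f x * cnj (g x)"
    using AE_completion[OF f(2)] AE_completion[OF g(2)] by eventually_elim simp
  have "L2_inner f g = (LINT x|lebesgue. f0 x * cnj (g0 x))"
    unfolding L2_inner_def using ae m
    by (intro integral_cong_AE borel_measurable_AE[OF _ ae] measurable_completion) (auto elim: AE_mp)
  also have "\<dots> = pairing f0 g0"
    unfolding pairing_def by (rule integral_completion[OF m])
  finally show ?thesis .
qed

section \<open>The frame elements as wave packets\<close>

text \<open>For negative \<open>j\<close> the band \<open>j\<close> is the contraction of the band
  \<open>|j|\<close> by this factor. For both signs its frequencies are comparable to
  \<open>2\<^sup>j\<close>.\<close>

definition band_dilation :: "int \<Rightarrow> real" where
  "band_dilation j = (if 0 \<le> j then 1 else 2 ^ (2 * nat (- j)))"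

definition band_scale :: "int \<Rightarrow> real" where
  "band_scale j = 2 powr (real_of_int j)"

lemma band_dilation_pos: "0 < band_dilation j" by (simp add: band_dilation_def)
lemma band_scale_pos: "0 < band_scale j" by (simp add: band_scale_def)

lemma band_dilation_scale: "band_dilation j * band_scale j = 2 ^ nat \<bar>j\<bar>"
proof (cases "0 \<le> j")
  case True
  then show ?thesis by (simp add: band_dilation_def band_scale_def powr_realpow[symmetric])
next
  case False
  define J where "J = nat (- j)"
  have J: "j = - int J" using False by (simp add: J_def)
  have "(2::real) ^ (2 * J) * 2 powr (- real J) = 2 ^ J"
    by (simp add: powr_minus_divide powr_realpow mult_2 power_add)
  then show ?thesis using False by (simp add: band_dilation_def band_scale_def J)
qed

lemma Phi_eq_sum:
  "Phi I \<phi> j k \<omega> = (\<Sum>\<eta>\<in>lattice_points I (nat \<bar>j\<bar>) k. fourier \<phi> (band_dilation j *\<^sub>R \<omega> - \<eta>))"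
  by (cases "0 \<le> j") (simp_all add: Phi_def Phi_nat_def band_dilation_def)

lemma Phi_eq_Phi_nat: "Phi I \<phi> j k \<omega> = Phi_nat I \<phi> (nat \<bar>j\<bar>) k (band_dilation j *\<^sub>R \<omega>)"
  unfolding Phi_eq_sum Phi_nat_def ..

lemma extended_set_iff: "\<omega> \<in> extended_set I j k \<longleftrightarrow> band_dilation j *\<^sub>R \<omega> \<in> I (nat \<bar>j\<bar>) k"
  by (cases "0 \<le> j") (simp_all add: extended_set_def band_dilation_def)

text \<open>Chosen such that the product with \<open>band_dilation j ^ d\<close>, which the Fourier
  transform of a dilation contributes, is \<open>2\<^bsup>-jd/2\<^esup>\<close> for both signs of
  \<open>j\<close>.\<close>

definition atom_factor :: "nat \<Rightarrow> int \<Rightarrow> real" where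
  "atom_factor d j = band_scale j powr (- real d / 2) / band_dilation j ^ d"

lemma atom_eq_packet:
  fixes \<phi> :: "real^'n \<Rightarrow> complex"
  shows "atom I \<phi> j k l = packet (of_real (atom_factor CARD('n) j)) (band_dilation j) (l /\<^sub>R band_scale j)
    (lattice_points I (nat \<bar>j\<bar>) k) \<phi>"
proof
  fix t
  have w: "exp (2 * complex_of_real pi * \<i> * complex_of_real (\<eta> \<bullet> x)) = wave \<eta> x" for \<eta> x :: "real^'n"
    by (simp add: wave_def cis_conv_exp mult_ac)
  show "atom I \<phi> j k l t = packet (of_real (atom_factor CARD('n) j)) (band_dilation j) (l /\<^sub>R band_scale j)
    (lattice_points I (nat \<bar>j\<bar>) k) \<phi> t"
  proof (cases "0 \<le> j")
    case True
    have b: "band_dilation j = 1" "band_scale j = 2 ^ nat j"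
      using True by (simp_all add: band_dilation_def band_scale_def powr_realpow[symmetric])
    have "atom_factor CARD('n) j = 1 / 2 powr (real (nat j) * real CARD('n) / 2)"
      using True by (simp add: atom_factor_def b powr_powr powr_minus_divide powr_realpow[symmetric])
    then show ?thesis
      unfolding packet_def b using True
      by (simp add: atom_def atom_nat_def translation_def w)
  next
    case False
    define J where "J = nat (- j)"
    have J: "j = - int J" "nat \<bar>j\<bar> = J" using False by (simp_all add: J_def)
    have b: "band_dilation j = 2 ^ (2 * J)" "band_scale j = 1 / 2 ^ J"
      using False by (simp_all add: band_dilation_def band_scale_def J_def[symmetric])
        (simp add: J powr_minus_divide powr_realpow)
    have fac: "atom_factor CARD('n) j = (2 ^ (2 * J)) powr (- real CARD('n) / 2) * (1 / 2 powr (real J * real CARD('n) / 2))"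
    proof -
      have "atom_factor CARD('n) j = (2 powr (- real J)) powr (- real CARD('n) / 2) / (2 powr (2 * real J)) ^ CARD('n)"
        by (simp add: atom_factor_def b powr_minus_divide powr_realpow[symmetric])
      also have "\<dots> = 2 powr (real J * real CARD('n) / 2) / 2 powr (2 * real J * real CARD('n))"
        by (simp add: powr_powr powr_realpow[symmetric])
      also have "\<dots> = 2 powr (real J * real CARD('n) / 2 - 2 * real J * real CARD('n))"
        by (simp only: powr_diff)
      also have "real J * real CARD('n) / 2 - 2 * real J * real CARD('n) =
        2 * real J * (- real CARD('n) / 2) - real J * real CARD('n) / 2" by (simp add: field_simps)
      also have "(2::real) powr \<dots> = (2 powr (2 * real J)) powr (- real CARD('n) / 2) / 2 powr (real J * real CARD('n) / 2)"
        by (simp only: powr_powr powr_diff)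
      finally show ?thesis by (simp add: powr_realpow[symmetric])
    qed
    have "atom I \<phi> j k l t = complex_of_real ((2 ^ (2 * J)) powr (- real CARD('n) / 2)) *
       (complex_of_real (1 / 2 powr (real J * real CARD('n) / 2)) *
        (\<Sum>\<eta>\<in>lattice_points I J k. wave \<eta> ((t - 2 ^ J *\<^sub>R l) /\<^sub>R 2 ^ (2 * J)) * \<phi> ((t - 2 ^ J *\<^sub>R l) /\<^sub>R 2 ^ (2 * J))))"
      using False unfolding atom_def by (simp add: J atom_nat_def translation_def dilation_def w)
    also have "\<dots> = packet (of_real (atom_factor CARD('n) j)) (band_dilation j) (l /\<^sub>R band_scale j)
      (lattice_points I (nat \<bar>j\<bar>) k) \<phi> t"
      unfolding packet_def fac b J(2) by simp
    finally show ?thesis .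
  qed
qed

lemma packet_cong_AE:
  assumes ae: "AE x in lborel. \<phi> x = \<phi>0 x" and b: "0 < b"
  shows "AE t in lborel. packet c b x0 S \<phi> t = packet c b x0 S \<phi>0 t"
proof -
  have "AE t in lborel. \<phi> ((- (1/b) *\<^sub>R x0) + (1 / b) *\<^sub>R t) = \<phi>0 ((- (1/b) *\<^sub>R x0) + (1 / b) *\<^sub>R t)"
    using AE_lborel_affine[OF ae, of "1/b" "- (1/b) *\<^sub>R x0"] b by simp
  then show ?thesis
  proof eventually_elim
    fix t assume "\<phi> ((- (1/b) *\<^sub>R x0) + (1 / b) *\<^sub>R t) = \<phi>0 ((- (1/b) *\<^sub>R x0) + (1 / b) *\<^sub>R t)"
    moreover have "(- (1/b) *\<^sub>R x0) + (1 / b) *\<^sub>R t = (t - x0) /\<^sub>R b"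
      by (simp add: scaleR_diff_right divide_inverse)
    ultimately show "packet c b x0 S \<phi> t = packet c b x0 S \<phi>0 t" by (simp add: packet_def)
  qed
qed

text \<open>The function \<open>\<Phi>\<^sub>j\<^sub>,\<^sub>k\<close> with a Borel representative
  \<open>\<psi>\<close> of the transform of \<open>\<phi>\<close>.\<close>

definition band_sum :: "(nat \<Rightarrow> 'k \<Rightarrow> (real^'n) set) \<Rightarrow> (real^'n \<Rightarrow> complex) \<Rightarrow> int \<Rightarrow> 'k \<Rightarrow> real^'n \<Rightarrow> complex" where
  "band_sum I \<psi> j k \<omega> = (\<Sum>\<eta>\<in>lattice_points I (nat \<bar>j\<bar>) k. \<psi> (band_dilation j *\<^sub>R \<omega> - \<eta>))"

lemma band_sum_eq_packet_hat: "band_sum I \<psi> j k = packet_hat (of_real (1 / band_dilation j ^ CARD('n))) (band_dilation j) (0::real^'n)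
    (lattice_points I (nat \<bar>j\<bar>) k) \<psi>"
  using band_dilation_pos[of j] by (auto simp: fun_eq_iff band_sum_def packet_hat_def)

lemma finite_energy_band_sum: "finite_energy \<psi> \<Longrightarrow> finite_energy (band_sum I \<psi> j k)"
  unfolding band_sum_eq_packet_hat by (intro finite_energy_packet(2) band_dilation_pos)

lemma Phi_eq_band_sum_AE:
  assumes ae: "AE x in lborel. fourier \<phi> x = \<psi> x"
  shows "AE \<omega> in lborel. Phi I \<phi> j k \<omega> = band_sum I \<psi> j k \<omega>"
proof (cases "finite (lattice_points I (nat \<bar>j\<bar>) k)")
  case True
  have "AE \<omega> in lborel. \<forall>\<eta>\<in>lattice_points I (nat \<bar>j\<bar>) k.
      fourier \<phi> ((- \<eta>) + band_dilation j *\<^sub>R \<omega>) = \<psi> ((- \<eta>) + band_dilation j *\<^sub>R \<omega>)"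
    using True band_dilation_pos[of j] by (intro AE_finite_allI AE_lborel_affine[OF ae]) auto
  then show ?thesis
    by eventually_elim (auto simp: Phi_eq_sum band_sum_def)
qed (simp add: Phi_eq_sum band_sum_def)

text \<open>After a complex conjugation, which does not affect the modulus, the inner product is a
  Fourier coefficient, with a formula that does not distinguish the signs of \<open>j\<close>.\<close>

lemma L2_inner_atom:
  fixes f \<phi> :: "real^'n \<Rightarrow> complex"
  assumes f: "finite_energy f0" "AE x in lborel. f x = f0 x" "fourier_L2 f0 F"
    and \<phi>: "finite_energy \<phi>0" "AE x in lborel. \<phi> x = \<phi>0 x" "fourier_L2 \<phi>0 \<psi>"
  shows "(cmod (L2_inner f (atom I \<phi> j k l)))\<^sup>2 =
    band_scale j powr (- real CARD('n)) *
     (cmod (LINT \<omega>|lborel. (cnj (F \<omega>) * band_sum I \<psi> j k \<omega>) * wave (- l) (\<omega> /\<^sub>R band_scale j)))\<^sup>2"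
proof -
  let ?c = "of_real (atom_factor CARD('n) j) :: complex" and ?b = "band_dilation j" and ?x = "l /\<^sub>R band_scale j"
    and ?S = "lattice_points I (nat \<bar>j\<bar>) k"
  have "L2_inner f (atom I \<phi> j k l) = pairing f0 (packet ?c ?b ?x ?S \<phi>0)"
    unfolding atom_eq_packet
    by (intro L2_inner_eq_pairing f finite_energy_packet \<phi> band_dilation_pos packet_cong_AE)
  also have "\<dots> = pairing F (packet_hat ?c ?b ?x ?S \<psi>)"
    by (intro pairing_packet f \<phi> band_dilation_pos)
  also have "\<dots> = cnj (LINT \<omega>|lborel. cnj (F \<omega> * cnj (packet_hat ?c ?b ?x ?S \<psi> \<omega>)))"
    unfolding pairing_def by (simp only: Bochner_Integration.integral_cnj complex_cnj_cnj)
  also have "(LINT \<omega>|lborel. cnj (F \<omega> * cnj (packet_hat ?c ?b ?x ?S \<psi> \<omega>))) =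
     (LINT \<omega>|lborel. of_real (band_scale j powr (- real CARD('n) / 2)) *
        ((cnj (F \<omega>) * band_sum I \<psi> j k \<omega>) * wave (- l) (\<omega> /\<^sub>R band_scale j)))"
  proof (intro Bochner_Integration.integral_cong refl)
    fix \<omega> :: "real^'n"
    have "wave (- \<omega>) ?x = wave (- l) (\<omega> /\<^sub>R band_scale j)"
      by (simp add: wave_def inner_commute)
    moreover have "?c * of_real (?b ^ CARD('n)) = of_real (band_scale j powr (- real CARD('n) / 2))"
    proof -
      have "atom_factor CARD('n) j * ?b ^ CARD('n) = band_scale j powr (- real CARD('n) / 2)"
        using band_dilation_pos[of j] by (simp add: atom_factor_def)
      then show ?thesis by (metis of_real_mult)
    qed
    ultimately show "cnj (F \<omega> * cnj (packet_hat ?c ?b ?x ?S \<psi> \<omega>)) =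
       of_real (band_scale j powr (- real CARD('n) / 2)) *
        ((cnj (F \<omega>) * band_sum I \<psi> j k \<omega>) * wave (- l) (\<omega> /\<^sub>R band_scale j))"
      by (simp add: packet_hat_def band_sum_def ac_simps)
  qed
  also have "\<dots> = of_real (band_scale j powr (- real CARD('n) / 2)) *
     (LINT \<omega>|lborel. (cnj (F \<omega>) * band_sum I \<psi> j k \<omega>) * wave (- l) (\<omega> /\<^sub>R band_scale j))"
    by simp
  finally have "cmod (L2_inner f (atom I \<phi> j k l)) = band_scale j powr (- real CARD('n) / 2) *
     cmod (LINT \<omega>|lborel. (cnj (F \<omega>) * band_sum I \<psi> j k \<omega>) * wave (- l) (\<omega> /\<^sub>R band_scale j))"
    by (simp add: norm_mult)
  moreover have "(band_scale j powr (- real CARD('n) / 2))\<^sup>2 = band_scale j powr (- real CARD('n))"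
    by (simp add: power2_eq_square flip: powr_add)
  ultimately show ?thesis by (simp add: power_mult_distrib)
qed

section \<open>Lattice sums\<close>

lemma nn_integral_count_space_le_finite_sums:
  fixes f :: "'a \<Rightarrow> real"
  assumes nn: "\<And>x. x \<in> A \<Longrightarrow> 0 \<le> f x" and le: "\<And>S. finite S \<Longrightarrow> S \<subseteq> A \<Longrightarrow> sum f S \<le> B"
  shows "(\<integral>\<^sup>+x. ennreal (f x) \<partial>count_space A) \<le> ennreal B"
proof -
  have "bdd_above (sum f ` {S. S \<subseteq> A \<and> finite S})" using le by (intro bdd_aboveI[of _ B]) auto
  from nonneg_bdd_above_summable_on[OF nn this] have sm: "f summable_on A" by simp
  then have "(f has_sum infsum f A) A" by (rule has_sum_infsum)
  then have "(\<integral>\<^sup>+x. ennreal (f x) \<partial>count_space A) = ennreal (infsum f A)"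
    using nn by (rule has_sum_imp_nn_integral_count_space)
  also have "\<dots> \<le> ennreal B" by (intro ennreal_leI infsum_le_finite_sums sm le)
  finally show ?thesis .
qed

lemma int_abs_sum_le:
  fixes h :: "nat \<Rightarrow> real"
  assumes h: "summable h" and h0: "\<And>n. 0 \<le> h n" and S: "finite S"
  shows "(\<Sum>m\<in>S. h (nat \<bar>m :: int\<bar>)) \<le> 2 * suminf h"
proof -
  have *: "(\<Sum>m\<in>S. h (nat \<bar>m\<bar>)) \<le> suminf h" if S: "finite S" "inj_on (\<lambda>m :: int. nat \<bar>m\<bar>) S" for S
  proof -
    have "(\<Sum>m\<in>S. h (nat \<bar>m\<bar>)) = sum h ((\<lambda>m. nat \<bar>m\<bar>) ` S)"
      using S(2) by (simp add: sum.reindex)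
    also have "\<dots> \<le> suminf h" using S h h0 by (intro sum_le_suminf) auto
    finally show ?thesis .
  qed
  have "(\<Sum>m\<in>S. h (nat \<bar>m\<bar>)) = (\<Sum>m\<in>S \<inter> {0..}. h (nat \<bar>m\<bar>)) + (\<Sum>m\<in>S \<inter> {..<0}. h (nat \<bar>m\<bar>))"
    using S by (subst sum.union_disjoint[symmetric]) (auto intro!: sum.cong)
  also have "\<dots> \<le> suminf h + suminf h"
    using S by (intro add_mono *) (auto simp: inj_on_def)
  finally show ?thesis by simp
qed

lemma int_power_sums_bounded:
  fixes q :: real
  assumes "1 < q"
  shows "\<exists>Z\<ge>0. \<forall>S. finite S \<longrightarrow> (\<Sum>m\<in>S. (1 + \<bar>real_of_int m\<bar>) powr (- q)) \<le> Z"
proof -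
  define h where "h = (\<lambda>n::nat. real (Suc n) powr (- q))"
  have "summable (\<lambda>n. real n powr (- q))" using assms by (simp add: summable_real_powr_iff)
  then have h: "summable h" unfolding h_def by (subst summable_Suc_iff)
  have h0: "0 \<le> h n" for n by (simp add: h_def)
  have "(1 + \<bar>real_of_int m\<bar>) powr (- q) = h (nat \<bar>m\<bar>)" for m
    by (simp add: h_def add.commute)
  with int_abs_sum_le[OF h h0] suminf_nonneg[OF h h0] show ?thesis
    by (intro exI[of _ "2 * suminf h"]) auto
qed

text \<open>For \<open>n \<noteq> 0\<close> every coordinate satisfies \<open>1 + |n\<^sub>i| \<le> 4 |y
  + n|\<close>. So the summand is at most a constant times the product over the coordinates of \<open>(1
  + |n\<^sub>i|)\<^bsup>-\<beta>/d\<^esup>\<close>, and the sum of these products is a power of a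
  convergent series because \<open>\<beta>/d > 1\<close>.\<close>

lemma lattice_tail_bound:
  fixes \<beta> :: real
  assumes \<beta>: "real CARD('n) < \<beta>"
  shows "\<exists>\<Lambda>\<ge>0. \<forall>y\<in>unit_cell. (\<integral>\<^sup>+n. ennreal (norm (y + n) powr (- \<beta>)) \<partial>count_space (int_lattice - {0 :: real^'n})) \<le> ennreal \<Lambda>"
proof -
  let ?d = "CARD('n)"
  define q where "q = \<beta> / real ?d"
  have q: "1 < q" using \<beta> by (simp add: q_def field_simps)
  from int_power_sums_bounded[OF q] obtain Z where Z: "0 \<le> Z"
    "\<And>S. finite S \<Longrightarrow> (\<Sum>m\<in>S. (1 + \<bar>real_of_int m\<bar>) powr (- q)) \<le> Z" by blast
  have \<beta>0: "0 < \<beta>" using \<beta> by (rule le_less_trans[rotated]) simp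
  show ?thesis
  proof (intro exI[of _ "4 powr \<beta> * Z ^ ?d"] conjI ballI)
    show "0 \<le> 4 powr \<beta> * Z ^ ?d" using Z by simp
    fix y :: "real^'n" assume y: "y \<in> unit_cell"
    show "(\<integral>\<^sup>+n. ennreal (norm (y + n) powr (- \<beta>)) \<partial>count_space (int_lattice - {0})) \<le> ennreal (4 powr \<beta> * Z ^ ?d)"
    proof (rule nn_integral_count_space_le_finite_sums)
      fix S :: "(real^'n) set" assume S: "finite S" "S \<subseteq> int_lattice - {0}"
      define fl where "fl = (\<lambda>(n :: real^'n) i. \<lfloor>n $ i\<rfloor>)"
      have fl: "real_of_int (fl n i) = n $ i" if "n \<in> S" for n i
        using S that by (force simp: fl_def int_lattice_def elim!: Ints_cases)
      have term_le: "norm (y + n) powr (- \<beta>) \<le> 4 powr \<beta> * (\<Prod>i\<in>UNIV. (1 + \<bar>real_of_int (fl n i)\<bar>) powr (- q))"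
        if n: "n \<in> S" for n
      proof -
        have nl: "n \<in> int_lattice" "n \<noteq> 0" using S n by auto
        have half: "1/2 \<le> norm (y + n)" by (rule norm_lattice_translate[OF y nl])
        have comp: "1 + \<bar>n $ i\<bar> \<le> 4 * norm (y + n)" for i
        proof -
          have "\<bar>y $ i\<bar> \<le> 1/2" using y by (auto simp: unit_cell_def abs_le_iff less_imp_le) (smt (verit) field_sum_of_halves)
          moreover have "\<bar>y $ i + n $ i\<bar> \<le> norm (y + n)" using component_le_norm_cart[of "y + n" i] by simp
          ultimately have "\<bar>n $ i\<bar> \<le> norm (y + n) + 1/2" by linarith
          then show ?thesis using half by linarith
        qed
        have pos: "0 < norm (y + n)" using half by linarith
        have "(\<Prod>i\<in>(UNIV :: 'n set). (4 * norm (y + n)) powr (- q)) \<le> (\<Prod>i\<in>UNIV. (1 + \<bar>real_of_int (fl n i)\<bar>) powr (- q))"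
        proof (intro prod_mono conjI)
          fix i :: 'n
          show "(4 * norm (y + n)) powr (- q) \<le> (1 + \<bar>real_of_int (fl n i)\<bar>) powr (- q)"
            using comp[of i] q unfolding fl[OF n] by (intro powr_mono2') auto
        qed auto
        moreover have "(\<Prod>i\<in>(UNIV :: 'n set). (4 * norm (y + n)) powr (- q)) = (4 * norm (y + n)) powr (- \<beta>)"
          using pos by (simp add: powr_power q_def)
        moreover have "norm (y + n) powr (- \<beta>) = 4 powr \<beta> * (4 * norm (y + n)) powr (- \<beta>)"
          using pos by (simp add: powr_mult powr_minus_divide)
        ultimately show ?thesis by (simp only:) (intro mult_left_mono, auto)
      qed
      define B where "B = (\<Union>i. (\<lambda>n. fl n i) ` S)"
      have B: "finite B" using S by (simp add: B_def)
      have inj: "inj_on fl S"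
      proof (rule inj_onI)
        fix m n assume mn: "m \<in> S" "n \<in> S" and eq: "fl m = fl n"
        have "m $ i = n $ i" for i using fl[OF mn(1), of i] fl[OF mn(2), of i] eq by simp
        then show "m = n" by (simp add: vec_eq_iff)
      qed
      have "(\<Sum>n\<in>S. norm (y + n) powr (- \<beta>)) \<le> (\<Sum>n\<in>S. 4 powr \<beta> * (\<Prod>i\<in>UNIV. (1 + \<bar>real_of_int (fl n i)\<bar>) powr (- q)))"
        by (rule sum_mono[OF term_le])
      also have "\<dots> = 4 powr \<beta> * (\<Sum>g\<in>fl ` S. \<Prod>i\<in>UNIV. (1 + \<bar>real_of_int (g i)\<bar>) powr (- q))"
        using inj by (simp add: sum_distrib_left sum.reindex)
      also have "(\<Sum>g\<in>fl ` S. \<Prod>i\<in>UNIV. (1 + \<bar>real_of_int (g i)\<bar>) powr (- q)) \<le>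
        (\<Sum>g\<in>PiE UNIV (\<lambda>_::'n. B). \<Prod>i\<in>UNIV. (1 + \<bar>real_of_int (g i)\<bar>) powr (- q))"
        using B by (intro sum_mono2 finite_PiE) (auto simp: B_def intro!: prod_nonneg)
      also have "\<dots> = (\<Prod>i\<in>(UNIV::'n set). \<Sum>m\<in>B. (1 + \<bar>real_of_int m\<bar>) powr (- q))"
        using B by (intro prod_sum_PiE[symmetric]) auto
      also have "\<dots> \<le> (\<Prod>i\<in>(UNIV::'n set). Z)"
        using Z(2)[OF B] by (intro prod_mono conjI sum_nonneg) auto
      finally show "(\<Sum>n\<in>S. norm (y + n) powr (- \<beta>)) \<le> 4 powr \<beta> * Z ^ ?d"
        by (simp add: mult_left_mono)
    qed auto
  qed
qed

section \<open>The sum over translations in one band\<close>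

lemma AE_cell_lattice:
  fixes P :: "real^'n \<Rightarrow> bool"
  assumes "AE x in lborel. P x" and p: "0 < p"
  shows "AE y in cell_measure. \<forall>n\<in>int_lattice. P (p *\<^sub>R (y + n))"
proof -
  have "AE y in lborel. \<forall>n\<in>int_lattice. P (p *\<^sub>R n + p *\<^sub>R y)"
    using p by (intro AE_ball_countable[THEN iffD2] countable_int_lattice ballI AE_lborel_affine assms) auto
  then have "AE y in lborel. \<forall>n\<in>int_lattice. P (p *\<^sub>R (y + n))"
    by eventually_elim (simp add: scaleR_add_right add.commute)
  then show ?thesis by (subst AE_restrict_space_iff) auto
qed

lemma nn_integral_tiling_scaled:
  fixes h :: "real^'n \<Rightarrow> ennreal"
  assumes [measurable]: "h \<in> borel_measurable borel" and p: "0 < p"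
  shows "(\<integral>\<^sup>+x. h x \<partial>lborel) = ennreal (p ^ CARD('n)) *
    (\<integral>\<^sup>+y. (\<integral>\<^sup>+n. h (p *\<^sub>R (y + n)) \<partial>count_space int_lattice) \<partial>cell_measure)"
proof -
  have "(\<integral>\<^sup>+x. h x \<partial>lborel) = ennreal (p ^ CARD('n)) * (\<integral>\<^sup>+x. h (p *\<^sub>R x) \<partial>lborel)"
    using nn_integral_lborel_affine[of h p 0] p by simp
  also have "(\<integral>\<^sup>+x. h (p *\<^sub>R x) \<partial>lborel) =
     (\<integral>\<^sup>+y. (\<integral>\<^sup>+n. h (p *\<^sub>R (y + n)) \<partial>count_space int_lattice) \<partial>cell_measure)"
    by (rule nn_integral_tiling) measurable
  finally show ?thesis .
qed

text \<open>\<open>T\<close> is the integral over a period of the squared periodization of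
  \<open>G\<close>, up to a power of \<open>p\<close>. The term \<open>n = 0\<close> of the
  periodization contributes the values of \<open>G\<close> on the central period. For the terms \<open>n
  \<noteq> 0\<close> the variable has norm at least \<open>p/2 = r/(2\<nu>)\<close>, where
  \<open>G\<close> is dominated by \<open>\<kappa> \<nu>\<^sup>\<alpha> E\<close> times \<open>|y +
  n|\<^bsup>-\<alpha>\<^esup>\<close>. The Cauchy--Schwarz inequality over \<open>n\<close> needs the
  latter factor only in \<open>\<ell>\<^sup>2\<close>, hence \<open>\<alpha> > d/2\<close> suffices, and
  integration over the cell turns the sum of \<open>E\<^sup>2\<close> over the translates into its
  integral over the space. The two claims compare the periodization with its central term by \<open>|a +
  b|\<^sup>2 \<le> 2|a|\<^sup>2 + 2|b|\<^sup>2\<close> in both directions.\<close>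

lemma band_estimate:
  fixes G :: "real^'n \<Rightarrow> complex" and E :: "real^'n \<Rightarrow> real"
  assumes G: "integrable lborel G"
    and E[measurable]: "E \<in> borel_measurable borel" and E0: "\<And>\<omega>. 0 \<le> E \<omega>"
    and Efin: "(\<integral>\<^sup>+\<omega>. ennreal ((E \<omega>)\<^sup>2) \<partial>lborel) < \<infinity>"
    and all: "AE \<omega> in lborel. cmod (G \<omega>) \<le> M * E \<omega>" and M: "0 \<le> M"
    and far: "AE \<omega> in lborel. R * r \<le> norm \<omega> \<longrightarrow> cmod (G \<omega>) \<le> \<kappa> * E \<omega> * (norm \<omega> / r) powr (- \<alpha>)"
    and \<kappa>: "0 \<le> \<kappa>" and r: "0 < r" and \<nu>: "0 < \<nu>" and R: "R \<le> 1 / (2 * \<nu>)"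
    and \<Lambda>: "\<And>y. y \<in> unit_cell \<Longrightarrow>
      (\<integral>\<^sup>+n. ennreal (norm (y + n) powr (- (2 * \<alpha>))) \<partial>count_space (int_lattice - {0 :: real^'n})) \<le> ennreal \<Lambda>"
    and \<Lambda>0: "0 \<le> \<Lambda>"
  defines "p \<equiv> r / \<nu>"
  defines "T \<equiv> (sq_integral (count_space int_lattice) (\<lambda>m. lattice_coeff p G m))"
    and "D \<equiv> ennreal (\<kappa>\<^sup>2 * \<nu> powr (2 * \<alpha>) * \<Lambda>) * (\<integral>\<^sup>+\<omega>. ennreal ((E \<omega>)\<^sup>2) \<partial>lborel)"
  shows "T \<le> ennreal (p ^ CARD('n)) * (2 * energy G + 2 * D)"
    and "ennreal (p ^ CARD('n)) * (\<integral>\<^sup>+\<omega>. ennreal ((cmod (G \<omega>))\<^sup>2) * indicator unit_cell (\<omega> /\<^sub>R p) \<partial>lborel)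
       \<le> 2 * T + ennreal (p ^ CARD('n)) * (2 * D)"
proof -
  let ?N = "\<integral>\<^sup>+\<omega>. ennreal ((E \<omega>)\<^sup>2) \<partial>lborel"
  have p: "0 < p" using r \<nu> by (simp add: p_def)
  have [measurable]: "G \<in> borel_measurable borel" using G by auto
  define H where "H = (\<lambda>y. periodic_sum p G y)"
  \<comment> \<open>the sum over the translates other than the central one\<close>
  define b where "b = (\<lambda>y. H y - G (p *\<^sub>R y))"
  have Gp: "integrable lborel (\<lambda>x. G (p *\<^sub>R x))" by (rule integrable_lborel_dilation[OF G p])
  have Hm[measurable]: "H \<in> borel_measurable cell_measure"
    using borel_measurable_integrable[OF integral_tiling(1)[OF Gp]] by (simp add: H_def)
  have bm[measurable]: "b \<in> borel_measurable cell_measure" unfolding b_def by measurable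

  have int_ae: "AE y in cell_measure. integrable (count_space int_lattice) (\<lambda>n. G (p *\<^sub>R (y + n)))"
  proof -
    have "ennreal (p ^ CARD('n)) * (\<integral>\<^sup>+y. (\<integral>\<^sup>+n. ennreal (cmod (G (p *\<^sub>R (y + n)))) \<partial>count_space int_lattice) \<partial>cell_measure) < \<infinity>"
      using G p by (subst nn_integral_tiling_scaled[symmetric]) (auto simp: integrable_iff_bounded)
    then have fin: "(\<integral>\<^sup>+y. (\<integral>\<^sup>+n. ennreal (cmod (G (p *\<^sub>R (y + n)))) \<partial>count_space int_lattice) \<partial>cell_measure) < \<infinity>"
      using p by (auto simp: ennreal_mult_less_top)
    interpret sigma_finite_measure "count_space (int_lattice :: (real^'n) set)"
      by (rule sigma_finite_int_lattice)
    have "(\<lambda>(y, n). ennreal (cmod (G (p *\<^sub>R (y + n))))) \<in> borel_measurable (cell_measure \<Otimes>\<^sub>M count_space int_lattice)"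
      by (rule measurable_count_lattice) measurable
    from borel_measurable_nn_integral[OF this]
    have "(\<lambda>y. \<integral>\<^sup>+n. ennreal (cmod (G (p *\<^sub>R (y + n)))) \<partial>count_space int_lattice) \<in> borel_measurable cell_measure" .
    from nn_integral_PInf_AE[OF this] fin
    have "AE y in cell_measure. (\<integral>\<^sup>+n. ennreal (cmod (G (p *\<^sub>R (y + n)))) \<partial>count_space int_lattice) \<noteq> \<infinity>" by simp
    then show ?thesis by eventually_elim (auto intro!: integrableI_bounded simp: less_top)
  qed
  have b_ae: "AE y in cell_measure. ennreal ((cmod (b y))\<^sup>2) \<le>
      (\<integral>\<^sup>+n. ennreal ((E (p *\<^sub>R (y + n)))\<^sup>2) \<partial>count_space int_lattice) * ennreal (\<kappa>\<^sup>2 * \<nu> powr (2 * \<alpha>) * \<Lambda>)"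
    using int_ae AE_cell_lattice[OF far p] AE_space
  proof eventually_elim
    fix y :: "real^'n" assume I: "integrable (count_space int_lattice) (\<lambda>n. G (p *\<^sub>R (y + n)))"
      and fr: "\<forall>n\<in>int_lattice. R * r \<le> norm (p *\<^sub>R (y + n)) \<longrightarrow>
          cmod (G (p *\<^sub>R (y + n))) \<le> \<kappa> * E (p *\<^sub>R (y + n)) * (norm (p *\<^sub>R (y + n)) / r) powr (- \<alpha>)"
      and "y \<in> space cell_measure"
    then have y: "y \<in> unit_cell" by (simp add: space_restrict_space)
    let ?L = "count_space (int_lattice :: (real^'n) set)"
    let ?v = "\<lambda>n. indicator (- {0}) n * ennreal (\<kappa> * \<nu> powr \<alpha> * norm (y + n) powr (- \<alpha>))"
    have I0: "integrable ?L (\<lambda>n. indicator {0} n *\<^sub>R G (p *\<^sub>R (y + n)))"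
      by (rule Bochner_Integration.integrable_bound[OF I]) (auto simp: indicator_def)
    have "(LINT n|?L. indicator {0} n *\<^sub>R G (p *\<^sub>R (y + n))) = (LINT n|?L. indicator {0} n *\<^sub>R G (p *\<^sub>R y))"
      by (intro Bochner_Integration.integral_cong) (auto simp: indicator_def)
    also have "\<dots> = (LINT n|?L. indicator {0} n :: real) *\<^sub>R G (p *\<^sub>R y)"
      by (rule integral_scaleR_left) (auto simp: int_lattice_0)
    also have "\<dots> = G (p *\<^sub>R y)" by (simp add: int_lattice_0)
    finally have beq: "b y = (LINT n|?L. G (p *\<^sub>R (y + n)) - indicator {0} n *\<^sub>R G (p *\<^sub>R (y + n)))"
      using I I0 by (simp add: b_def H_def)
    have bI: "integrable ?L (\<lambda>n. G (p *\<^sub>R (y + n)) - indicator {0} n *\<^sub>R G (p *\<^sub>R (y + n)))"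
      using I I0 by (rule Bochner_Integration.integrable_diff)
    have "ennreal (cmod (b y)) \<le> (\<integral>\<^sup>+n. ennreal (cmod (G (p *\<^sub>R (y + n)) - indicator {0} n *\<^sub>R G (p *\<^sub>R (y + n)))) \<partial>?L)"
      unfolding beq by (rule integral_norm_bound_ennreal[OF bI])
    also have "\<dots> \<le> (\<integral>\<^sup>+n. ennreal (E (p *\<^sub>R (y + n))) * ?v n \<partial>?L)"
    proof (intro nn_integral_mono)
      fix n :: "real^'n" assume "n \<in> space ?L"
      then have n: "n \<in> int_lattice" by simp
      show "ennreal (cmod (G (p *\<^sub>R (y + n)) - indicator {0} n *\<^sub>R G (p *\<^sub>R (y + n)))) \<le> ennreal (E (p *\<^sub>R (y + n))) * ?v n"
      proof (cases "n = 0")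
        case False
        have half: "1/2 \<le> norm (y + n)" by (rule norm_lattice_translate[OF y n False])
        have nx: "norm (p *\<^sub>R (y + n)) / r = norm (y + n) / \<nu>" using r \<nu> by (simp add: p_def)
        have "R * r \<le> (1 / (2 * \<nu>)) * r" using R r by (intro mult_right_mono) auto
        also have "\<dots> = p * (1/2)" by (simp add: p_def)
        also have "\<dots> \<le> p * norm (y + n)" using half p by (intro mult_left_mono) auto
        finally have "R * r \<le> norm (p *\<^sub>R (y + n))" using p by simp
        from fr[rule_format, OF n this] have "cmod (G (p *\<^sub>R (y + n))) \<le> \<kappa> * E (p *\<^sub>R (y + n)) * (norm (y + n) / \<nu>) powr (- \<alpha>)"
          unfolding nx .
        also have "(norm (y + n) / \<nu>) powr (- \<alpha>) = \<nu> powr \<alpha> * norm (y + n) powr (- \<alpha>)"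
          using \<nu> by (simp add: powr_divide powr_minus_divide)
        finally have "cmod (G (p *\<^sub>R (y + n))) \<le> E (p *\<^sub>R (y + n)) * (\<kappa> * \<nu> powr \<alpha> * norm (y + n) powr (- \<alpha>))"
          by (simp add: mult_ac)
        then have "ennreal (cmod (G (p *\<^sub>R (y + n)))) \<le> ennreal (E (p *\<^sub>R (y + n))) * ennreal (\<kappa> * \<nu> powr \<alpha> * norm (y + n) powr (- \<alpha>))"
        proof -
          assume "cmod (G (p *\<^sub>R (y + n))) \<le> E (p *\<^sub>R (y + n)) * (\<kappa> * \<nu> powr \<alpha> * norm (y + n) powr (- \<alpha>))"
          then have "ennreal (cmod (G (p *\<^sub>R (y + n)))) \<le> ennreal (E (p *\<^sub>R (y + n)) * (\<kappa> * \<nu> powr \<alpha> * norm (y + n) powr (- \<alpha>)))"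
            by (rule ennreal_leI)
          also have "\<dots> = ennreal (E (p *\<^sub>R (y + n))) * ennreal (\<kappa> * \<nu> powr \<alpha> * norm (y + n) powr (- \<alpha>))"
            by (rule ennreal_mult) (use E0 \<kappa> in auto)
          finally show ?thesis .
        qed
        then show ?thesis using False by simp
      qed simp
    qed
    finally have "(ennreal (cmod (b y)))\<^sup>2 \<le> (\<integral>\<^sup>+n. ennreal (E (p *\<^sub>R (y + n))) * ?v n \<partial>?L)\<^sup>2"
      by (intro power_mono) auto
    also have "\<dots> \<le> (\<integral>\<^sup>+n. (ennreal (E (p *\<^sub>R (y + n))))\<^sup>2 \<partial>?L) * (\<integral>\<^sup>+n. (?v n)\<^sup>2 \<partial>?L)"
      by (rule Cauchy_Schwarz_nn_integral) auto
    also have "(\<integral>\<^sup>+n. (?v n)\<^sup>2 \<partial>?L) = (\<integral>\<^sup>+n. ennreal (\<kappa>\<^sup>2 * \<nu> powr (2 * \<alpha>)) * (ennreal (norm (y + n) powr (- (2 * \<alpha>))) * indicator (int_lattice - {0}) n) \<partial>?L)"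
    proof (intro nn_integral_cong)
      fix n :: "real^'n" assume "n \<in> space ?L"
      then have n: "n \<in> int_lattice" by simp
      have sq: "(\<kappa> * \<nu> powr \<alpha> * norm (y + n) powr (- \<alpha>))\<^sup>2 = \<kappa>\<^sup>2 * \<nu> powr (2 * \<alpha>) * norm (y + n) powr (- (2 * \<alpha>))"
      proof -
        have "(x powr c)\<^sup>2 = x powr (2 * c)" for x c :: real
          by (simp add: power2_eq_square powr_add[symmetric])
        from this[of _ \<alpha>] this[of _ "- \<alpha>"] show ?thesis by (simp add: power_mult_distrib)
      qed
      have "(ennreal (\<kappa> * \<nu> powr \<alpha> * norm (y + n) powr (- \<alpha>)))\<^sup>2 =
          ennreal (\<kappa>\<^sup>2 * \<nu> powr (2 * \<alpha>)) * ennreal (norm (y + n) powr (- (2 * \<alpha>)))"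
        using \<kappa> by (subst ennreal_power) (auto simp: sq ennreal_mult)
      with n show "(?v n)\<^sup>2 = ennreal (\<kappa>\<^sup>2 * \<nu> powr (2 * \<alpha>)) * (ennreal (norm (y + n) powr (- (2 * \<alpha>))) * indicator (int_lattice - {0}) n)"
        by (cases "n = 0") auto
    qed
    also have "\<dots> = ennreal (\<kappa>\<^sup>2 * \<nu> powr (2 * \<alpha>)) * (\<integral>\<^sup>+n. ennreal (norm (y + n) powr (- (2 * \<alpha>))) \<partial>count_space (int_lattice - {0}))"
    proof -
      have "restrict_space ?L (int_lattice - {0}) = count_space (int_lattice - {0})"
        unfolding restrict_count_space by (rule arg_cong[where f=count_space]) auto
      then have "(\<integral>\<^sup>+n. ennreal (norm (y + n) powr (- (2 * \<alpha>))) * indicator (int_lattice - {0}) n \<partial>?L) =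
        (\<integral>\<^sup>+n. ennreal (norm (y + n) powr (- (2 * \<alpha>))) \<partial>count_space (int_lattice - {0}))"
        using nn_integral_restrict_space[of "int_lattice - {0}" ?L "\<lambda>n. ennreal (norm (y + n) powr (- (2 * \<alpha>)))"]
        by simp
      then show ?thesis by (subst nn_integral_cmult) auto
    qed
    also have "\<dots> \<le> ennreal (\<kappa>\<^sup>2 * \<nu> powr (2 * \<alpha>)) * ennreal \<Lambda>"
      by (intro mult_left_mono \<Lambda> y) auto
    also have "\<dots> = ennreal (\<kappa>\<^sup>2 * \<nu> powr (2 * \<alpha>) * \<Lambda>)" using \<Lambda>0 by (simp add: ennreal_mult)
    finally show "ennreal ((cmod (b y))\<^sup>2) \<le>
      (\<integral>\<^sup>+n. ennreal ((E (p *\<^sub>R (y + n)))\<^sup>2) \<partial>count_space int_lattice) * ennreal (\<kappa>\<^sup>2 * \<nu> powr (2 * \<alpha>) * \<Lambda>)"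
      using E0 by (simp add: ennreal_power mult_left_mono)
  qed
  have b_le: "ennreal (p ^ CARD('n)) * (sq_integral cell_measure b) \<le> D"
  proof -
    interpret sigma_finite_measure "count_space (int_lattice :: (real^'n) set)"
      by (rule sigma_finite_int_lattice)
    have "(\<lambda>(y, n). ennreal ((E (p *\<^sub>R (y + n)))\<^sup>2)) \<in> borel_measurable (cell_measure \<Otimes>\<^sub>M count_space int_lattice)"
      by (rule measurable_count_lattice) measurable
    from borel_measurable_nn_integral[OF this]
    have [measurable]: "(\<lambda>y. \<integral>\<^sup>+n. ennreal ((E (p *\<^sub>R (y + n)))\<^sup>2) \<partial>count_space int_lattice) \<in> borel_measurable cell_measure" .
    have "(sq_integral cell_measure b) \<le>
      (\<integral>\<^sup>+y. (\<integral>\<^sup>+n. ennreal ((E (p *\<^sub>R (y + n)))\<^sup>2) \<partial>count_space int_lattice) * ennreal (\<kappa>\<^sup>2 * \<nu> powr (2 * \<alpha>) * \<Lambda>) \<partial>cell_measure)"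
      by (rule nn_integral_mono_AE[OF b_ae])
    also have "\<dots> = (\<integral>\<^sup>+y. (\<integral>\<^sup>+n. ennreal ((E (p *\<^sub>R (y + n)))\<^sup>2) \<partial>count_space int_lattice) \<partial>cell_measure) * ennreal (\<kappa>\<^sup>2 * \<nu> powr (2 * \<alpha>) * \<Lambda>)"
      by (rule nn_integral_multc) measurable
    finally have "ennreal (p ^ CARD('n)) * (sq_integral cell_measure b) \<le>
      ennreal (p ^ CARD('n)) * ((\<integral>\<^sup>+y. (\<integral>\<^sup>+n. ennreal ((E (p *\<^sub>R (y + n)))\<^sup>2) \<partial>count_space int_lattice) \<partial>cell_measure) * ennreal (\<kappa>\<^sup>2 * \<nu> powr (2 * \<alpha>) * \<Lambda>))"
      by (rule mult_left_mono) simp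
    also have "\<dots> = D"
    proof -
      have "?N = ennreal (p ^ CARD('n)) * (\<integral>\<^sup>+y. (\<integral>\<^sup>+n. ennreal ((E (p *\<^sub>R (y + n)))\<^sup>2) \<partial>count_space int_lattice) \<partial>cell_measure)"
        using p by (intro nn_integral_tiling_scaled) measurable
      then show ?thesis unfolding D_def by (simp only: mult_ac)
    qed
    finally show ?thesis .
  qed
  have a_eq: "ennreal (p ^ CARD('n)) * (sq_integral cell_measure (\<lambda>y. G (p *\<^sub>R y))) =
     (\<integral>\<^sup>+\<omega>. ennreal ((cmod (G \<omega>))\<^sup>2) * indicator unit_cell (\<omega> /\<^sub>R p) \<partial>lborel)"
    using nn_integral_lborel_affine[of "\<lambda>\<omega>. ennreal ((cmod (G \<omega>))\<^sup>2) * indicator unit_cell (\<omega> /\<^sub>R p)" p 0] p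
    by (simp add: nn_integral_restrict_space)
  have a_le: "(\<integral>\<^sup>+\<omega>. ennreal ((cmod (G \<omega>))\<^sup>2) * indicator unit_cell (\<omega> /\<^sub>R p) \<partial>lborel) \<le> energy G"
    unfolding energy_def by (intro nn_integral_mono) (auto simp: indicator_def)
  have sum_le: "ennreal (p ^ CARD('n)) * (sq_integral cell_measure H) \<le> 2 * energy G + 2 * D"
  proof -
    have "(sq_integral cell_measure (\<lambda>y. G (p *\<^sub>R y) + b y)) \<le>
      2 * (sq_integral cell_measure (\<lambda>y. G (p *\<^sub>R y))) + 2 * (sq_integral cell_measure b)"
      by (rule nn_integral_sq_add_le) measurable
    then have "ennreal (p ^ CARD('n)) * (sq_integral cell_measure H) \<le>
      ennreal (p ^ CARD('n)) * (2 * (sq_integral cell_measure (\<lambda>y. G (p *\<^sub>R y))) + 2 * (sq_integral cell_measure b))"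
      by (intro mult_left_mono) (auto simp: b_def)
    also have "\<dots> = 2 * (\<integral>\<^sup>+\<omega>. ennreal ((cmod (G \<omega>))\<^sup>2) * indicator unit_cell (\<omega> /\<^sub>R p) \<partial>lborel) +
      2 * (ennreal (p ^ CARD('n)) * (sq_integral cell_measure b))"
      unfolding a_eq[symmetric] by (simp add: distrib_left mult_ac)
    also have "\<dots> \<le> 2 * energy G + 2 * D"
      by (intro add_mono mult_left_mono a_le b_le) auto
    finally show ?thesis .
  qed
  have Dfin: "D < \<infinity>" using Efin by (simp add: D_def ennreal_mult_less_top)
  have Gfin: "energy G < \<infinity>"
  proof -
    have "energy G \<le> (\<integral>\<^sup>+\<omega>. ennreal (M\<^sup>2) * ennreal ((E \<omega>)\<^sup>2) \<partial>lborel)"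
      unfolding energy_def
    proof (rule nn_integral_mono_AE)
      show "AE \<omega> in lborel. ennreal ((cmod (G \<omega>))\<^sup>2) \<le> ennreal (M\<^sup>2) * ennreal ((E \<omega>)\<^sup>2)"
        using all
      proof eventually_elim
        fix \<omega> assume "cmod (G \<omega>) \<le> M * E \<omega>"
        then have "(cmod (G \<omega>))\<^sup>2 \<le> (M * E \<omega>)\<^sup>2" by (intro power_mono) auto
        then show "ennreal ((cmod (G \<omega>))\<^sup>2) \<le> ennreal (M\<^sup>2) * ennreal ((E \<omega>)\<^sup>2)"
          by (simp add: power_mult_distrib ennreal_leI flip: ennreal_mult)
      qed
    qed
    also have "\<dots> = ennreal (M\<^sup>2) * ?N" by (rule nn_integral_cmult) measurable
    also have "\<dots> < \<infinity>" using Efin by (simp add: ennreal_mult_less_top)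
    finally show ?thesis .
  qed
  have Hfin: "(sq_integral cell_measure H) < \<infinity>"
  proof -
    have "2 * energy G + 2 * D < \<infinity>" using Dfin Gfin by (auto simp: ennreal_mult_less_top)
    from le_less_trans[OF sum_le this] show ?thesis using p by (auto simp: ennreal_mult_less_top)
  qed
  have T_eq: "T = ennreal (p ^ CARD('n)) * (ennreal (p ^ CARD('n)) * (sq_integral cell_measure H))"
    using periodization[OF G p] Hfin p unfolding T_def H_def
    by (simp add: mult_2 power_add ennreal_mult mult.assoc)
  show "T \<le> ennreal (p ^ CARD('n)) * (2 * energy G + 2 * D)"
    unfolding T_eq by (intro mult_left_mono sum_le) auto
  have Hb: "H y + - b y = G (p *\<^sub>R y)" for y by (simp add: b_def)
  have "(sq_integral cell_measure (\<lambda>y. H y + - b y)) \<le>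
      2 * (sq_integral cell_measure H) + 2 * (sq_integral cell_measure (\<lambda>y. - b y))"
    by (rule nn_integral_sq_add_le) measurable
  then have "(sq_integral cell_measure (\<lambda>y. G (p *\<^sub>R y))) \<le>
      2 * (sq_integral cell_measure H) + 2 * (sq_integral cell_measure b)"
    by (simp only: Hb norm_minus_cancel)
  then have "ennreal (p ^ CARD('n)) * (ennreal (p ^ CARD('n)) * (sq_integral cell_measure (\<lambda>y. G (p *\<^sub>R y)))) \<le>
      ennreal (p ^ CARD('n)) * (ennreal (p ^ CARD('n)) * (2 * (sq_integral cell_measure H) + 2 * (sq_integral cell_measure b)))"
    by (intro mult_left_mono) auto
  also have "\<dots> = 2 * T + ennreal (p ^ CARD('n)) * (2 * (ennreal (p ^ CARD('n)) * (sq_integral cell_measure b)))"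
    unfolding T_eq by (simp add: distrib_left mult_ac)
  also have "\<dots> \<le> 2 * T + ennreal (p ^ CARD('n)) * (2 * D)"
    by (intro add_mono mult_left_mono b_le) auto
  finally show "ennreal (p ^ CARD('n)) * (\<integral>\<^sup>+\<omega>. ennreal ((cmod (G \<omega>))\<^sup>2) * indicator unit_cell (\<omega> /\<^sub>R p) \<partial>lborel)
       \<le> 2 * T + ennreal (p ^ CARD('n)) * (2 * D)"
    unfolding a_eq .
qed

section \<open>Decay of the functions \<open>\<Phi>\<close> across the bands\<close>

lemma infdist_annulus_ge:
  fixes z :: "'a::real_normed_vector"
  assumes "A \<noteq> {}" and "\<And>w. w \<in> A \<Longrightarrow> \<delta> \<le> \<bar>norm w - norm z\<bar>"
  shows "\<delta> \<le> infdist z A"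
  unfolding infdist_notempty[OF assms(1)]
proof (rule cINF_greatest[OF assms(1)])
  fix w assume "w \<in> A"
  then have "\<delta> \<le> \<bar>norm w - norm z\<bar>" by (rule assms)
  also have "\<dots> \<le> norm (w - z)" by (rule norm_triangle_ineq3)
  also have "\<dots> = dist z w" by (simp add: dist_norm norm_minus_commute)
  finally show "\<delta> \<le> dist z w" .
qed

text \<open>A point of norm below half the inner radius, or above twice the outer radius, of the annulus
  that contains \<open>A\<close> has a distance from \<open>A\<close> at least of order \<open>max
  (2\<^sup>J) |z|\<close>. The numerator \<open>min 1 |z|\<close> is estimated by \<open>|z|\<close> for
  small \<open>z\<close>, which produces the factor \<open>x\<^sup>s\<close>, and by 1 for large
  \<open>z\<close>; in both cases the powers of \<open>2\<^sup>J\<close> combine to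
  \<open>2\<^bsup>-J(\<alpha>-e)\<^esup>\<close>. For large \<open>x\<close> the surplus
  \<open>x\<^bsup>-2s\<^esup>\<close> is given away.\<close>

lemma decay_pointwise:
  fixes z :: "real^'n" and A :: "(real^'n) set"
  assumes s: "0 \<le> s" and \<alpha>: "0 < \<alpha>" and C: "0 < C" and cm: "0 < cmin" "0 < cmax"
    and A: "A \<noteq> {}" "\<And>w. w \<in> A \<Longrightarrow> cmin < norm w / 2 ^ J \<and> norm w / 2 ^ J < cmax"
    and out: "z \<notin> A \<Longrightarrow> P \<le> C * (2 powr (real J * e) * (min 1 (norm z)) powr s / (1 + infdist z A) powr (\<alpha> + s))"
    and P: "P \<le> C" and z: "z \<noteq> 0"
  defines "x \<equiv> norm z / 2 ^ J"
  shows "cmin / 2 \<le> x \<Longrightarrow> P \<le> C * (cmin / 2) powr (- s) * x powr s"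
    and "x < cmin / 2 \<Longrightarrow> P \<le> C * (cmin / 2) powr (- (\<alpha> + s)) * 2 powr (- (real J * (\<alpha> - e))) * x powr s"
    and "2 * cmax \<le> x \<Longrightarrow> P \<le> C * (2 powr (\<alpha> + s) * (2 * cmax) powr (- (2 * s))) * 2 powr (- (real J * (\<alpha> - e))) * x powr s * x powr (- \<alpha>)"
proof -
  have x: "0 < x" using z by (simp add: x_def)
  have nz: "norm z = 2 powr (real J) * x" by (simp add: x_def powr_realpow)
  have A': "cmin * 2 powr (real J) < norm w" "norm w < cmax * 2 powr (real J)" if "w \<in> A" for w
    using A(2)[OF that] by (simp_all add: field_simps powr_realpow)
  show "P \<le> C * (cmin / 2) powr (- s) * x powr s" if "cmin / 2 \<le> x"
  proof -
    have "(cmin / 2) powr s \<le> x powr s" using that s cm by (intro powr_mono2) auto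
    then have "1 \<le> (cmin / 2) powr (- s) * x powr s"
      using cm by (simp add: powr_minus_divide field_simps)
    then have "C * 1 \<le> C * ((cmin / 2) powr (- s) * x powr s)" using C by (intro mult_left_mono) auto
    with P show ?thesis by (simp add: mult.assoc)
  qed
  show "P \<le> C * (cmin / 2) powr (- (\<alpha> + s)) * 2 powr (- (real J * (\<alpha> - e))) * x powr s" if small: "x < cmin / 2"
  proof -
    have zlt: "norm z < cmin / 2 * 2 powr (real J)" using small by (simp add: nz mult.commute)
    have "z \<notin> A" using A'(1)[of z] zlt cm by (auto simp: field_simps) (smt (verit) norm_ge_zero)
    have d: "cmin / 2 * 2 powr (real J) \<le> infdist z A"
    proof (rule infdist_annulus_ge[OF A(1)])
      fix w assume "w \<in> A"
      then show "cmin / 2 * 2 powr (real J) \<le> \<bar>norm w - norm z\<bar>" using A'(1)[of w] zlt by linarith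
    qed
    have "P \<le> C * (2 powr (real J * e) * (min 1 (norm z)) powr s / (1 + infdist z A) powr (\<alpha> + s))"
      by (rule out) fact
    also have "\<dots> \<le> C * (2 powr (real J * e) * (norm z) powr s / (cmin / 2 * 2 powr (real J)) powr (\<alpha> + s))"
      using d C s \<alpha> cm by (intro mult_left_mono frac_le mult_nonneg_nonneg powr_mono2) auto
    also have "\<dots> = C * (cmin / 2) powr (- (\<alpha> + s)) * 2 powr (- (real J * (\<alpha> - e))) * x powr s"
    proof -
      have 1: "(cmin / 2 * 2 powr real J) powr (\<alpha> + s) = (cmin / 2) powr (\<alpha> + s) * 2 powr (real J * (\<alpha> + s))"
        using cm by (simp only: powr_mult powr_powr)
      have 2: "(norm z) powr s = 2 powr (real J * s) * x powr s"
        unfolding nz by (simp only: powr_mult powr_powr)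
      have 3: "2 powr (real J * e) * 2 powr (real J * s) / 2 powr (real J * (\<alpha> + s)) = 2 powr (- (real J * (\<alpha> - e)))"
        by (simp add: powr_add[symmetric] powr_diff[symmetric] algebra_simps)
      have "C * (2 powr (real J * e) * (2 powr (real J * s) * x powr s) / ((cmin / 2) powr (\<alpha> + s) * 2 powr (real J * (\<alpha> + s)))) =
        C * (1 / (cmin / 2) powr (\<alpha> + s)) * (2 powr (real J * e) * 2 powr (real J * s) / 2 powr (real J * (\<alpha> + s))) * x powr s"
        by simp
      then show ?thesis unfolding 1 2 3 by (simp only: powr_minus_divide)
    qed
    finally show ?thesis .
  qed
  show "P \<le> C * (2 powr (\<alpha> + s) * (2 * cmax) powr (- (2 * s))) * 2 powr (- (real J * (\<alpha> - e))) * x powr s * x powr (- \<alpha>)"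
    if big: "2 * cmax \<le> x"
  proof -
    have zge: "2 * cmax * 2 powr (real J) \<le> norm z" using big by (simp add: nz mult.commute)
    have "0 < cmax * 2 powr (real J)" using cm by simp
    then have "z \<notin> A" using A'(2)[of z] zge by auto
    have d: "norm z / 2 \<le> infdist z A"
    proof (rule infdist_annulus_ge[OF A(1)])
      fix w assume "w \<in> A"
      then show "norm z / 2 \<le> \<bar>norm w - norm z\<bar>" using A'(2)[of w] zge by linarith
    qed
    have "P \<le> C * (2 powr (real J * e) * (min 1 (norm z)) powr s / (1 + infdist z A) powr (\<alpha> + s))"
      by (rule out) fact
    also have "\<dots> \<le> C * (2 powr (real J * e) * 1 powr s / (norm z / 2) powr (\<alpha> + s))"
      using d C s \<alpha> z by (intro mult_left_mono frac_le mult_nonneg_nonneg powr_mono2) auto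
    also have "\<dots> = C * 2 powr (\<alpha> + s) * (2 powr (- (real J * (\<alpha> - e))) * 2 powr (- (real J * s))) * x powr (- (\<alpha> + s))"
    proof -
      have 1: "(norm z / 2) powr (\<alpha> + s) = 2 powr (real J * (\<alpha> + s)) * x powr (\<alpha> + s) / 2 powr (\<alpha> + s)"
        unfolding nz using x by (simp add: powr_mult powr_powr powr_divide)
      have 3: "2 powr (real J * e) / 2 powr (real J * (\<alpha> + s)) = 2 powr (- (real J * (\<alpha> - e))) * 2 powr (- (real J * s))"
        by (simp add: powr_add[symmetric] powr_diff[symmetric] algebra_simps)
      have "C * (2 powr (real J * e) * 1 powr s / (2 powr (real J * (\<alpha> + s)) * x powr (\<alpha> + s) / 2 powr (\<alpha> + s))) =
        C * 2 powr (\<alpha> + s) * (2 powr (real J * e) / 2 powr (real J * (\<alpha> + s))) * (1 / x powr (\<alpha> + s))"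
        by simp
      then show ?thesis unfolding 1 3 by (simp only: powr_minus_divide)
    qed
    also have "\<dots> \<le> C * 2 powr (\<alpha> + s) * (2 powr (- (real J * (\<alpha> - e))) * 1) * ((2 * cmax) powr (- (2 * s)) * x powr s * x powr (- \<alpha>))"
    proof (intro mult_mono)
      show "2 powr (- (real J * s)) \<le> (1::real)" using s powr_mono[of "- (real J * s)" 0 2] by simp
      have "x powr (- (\<alpha> + s)) = x powr (- (2 * s)) * x powr s * x powr (- \<alpha>)"
      proof -
        have "- (\<alpha> + s) = (- (2 * s) + s) + - \<alpha>" by simp
        then show ?thesis by (simp only: powr_add)
      qed
      also have "\<dots> \<le> (2 * cmax) powr (- (2 * s)) * x powr s * x powr (- \<alpha>)"
        using big cm s by (intro mult_right_mono powr_mono2') auto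
      finally show "x powr (- (\<alpha> + s)) \<le> (2 * cmax) powr (- (2 * s)) * x powr s * x powr (- \<alpha>)" .
    qed (use C in auto)
    finally show ?thesis by (simp add: mult_ac)
  qed
qed

text \<open>The size of \<open>g\<close> relative to \<open>e\<close> as a function of the rescaled
  frequency norm \<open>x\<close>: bounded by \<open>M\<close> in the band, by \<open>\<kappa>\<close>
  off the band, with the additional decay \<open>x\<^bsup>-\<alpha>\<^esup>\<close> above it.\<close>

definition band_bounded :: "real \<Rightarrow> real \<Rightarrow> real \<Rightarrow> real \<Rightarrow> real \<Rightarrow> real \<Rightarrow> real \<Rightarrow> real \<Rightarrow> bool" where
  "band_bounded \<alpha> M \<kappa> c1 c2 x e g \<longleftrightarrow>
     (c1 \<le> x \<and> x < c2 \<longrightarrow> g \<le> M * e) \<and>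
     (x < c1 \<or> c2 \<le> x \<longrightarrow> g \<le> \<kappa> * e) \<and>
     (c2 \<le> x \<longrightarrow> g \<le> \<kappa> * e * x powr (- \<alpha>))"

lemma band_bounded_scale:
  assumes "band_bounded \<alpha> M \<kappa> c1 c2 x e g" "0 \<le> t"
  shows "band_bounded \<alpha> M \<kappa> c1 c2 x (e * t) (g * t)"
proof -
  have "g * t \<le> A * (e * t) * y" if "g \<le> A * e * y" for A y
    using mult_right_mono[OF that assms(2)] by (simp add: mult_ac)
  from this[of _ 1] this[of _ "x powr (- \<alpha>)"] assms(1) show ?thesis
    unfolding band_bounded_def by simp
qed

text \<open>In the variable \<open>x = |\<omega>| / 2\<^sup>j\<close> the bands \<open>j\<close> and
  \<open>-j\<close> obey the same bounds, since \<open>\<Phi>\<close> at \<open>\<omega>\<close> is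
  \<open>Phi_nat\<close> with index \<open>|j|\<close> at a point of norm
  \<open>2\<^bsup>|j|\<^esup>x\<close>.\<close>

lemma band_decay:
  fixes I :: "nat \<Rightarrow> 'k \<Rightarrow> (real^'n) set"
  assumes part: "admissible_partition K I I\<^sub>0" and s: "0 \<le> s" and adm: "sobolev_admissible s K I \<phi>"
  shows "\<exists>\<alpha> M \<kappa> q c1 c2. real CARD('n) / 2 < \<alpha> \<and> 0 \<le> M \<and> 0 \<le> \<kappa> \<and> 0 < q \<and> q < 1 \<and> 0 < c1 \<and> c1 < c2 \<and>
    (\<forall>j. \<forall>k\<in>K. AE \<omega> in lborel.
      band_bounded \<alpha> M (\<kappa> * q ^ nat \<bar>j\<bar>) c1 c2 (norm \<omega> / band_scale j) (norm \<omega> powr s)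
        (band_scale j powr s * cmod (Phi I \<phi> j k \<omega>))) \<and>
    (\<forall>j. \<forall>k\<in>K. \<forall>\<omega>\<in>extended_set I j k. norm \<omega> / band_scale j < c2 / 2)"
proof -
  obtain cmin cmax0 where cm0: "0 < cmin" "0 < cmax0"
    and I0: "\<And>j k \<omega>. k \<in> K \<Longrightarrow> \<omega> \<in> I j k \<Longrightarrow> cmin < norm \<omega> / 2 ^ j \<and> norm \<omega> / 2 ^ j < cmax0"
    using part unfolding admissible_partition_def by metis
  \<comment> \<open>enlarging the outer radius makes the annulus nonempty even if \<open>K\<close> is empty\<close>
  define cmax where "cmax = cmax0 + cmin"
  have cm: "0 < cmin" "0 < cmax" using cm0 by (auto simp: cmax_def)
  have I: "cmin < norm \<omega> / 2 ^ j \<and> norm \<omega> / 2 ^ j < cmax" if "k \<in> K" "\<omega> \<in> I j k" for j k \<omega>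
    using I0[OF that] cm0 by (simp add: cmax_def)
  have ne: "I j k \<noteq> {}" if "k \<in> K" for j k
    using part that by (auto simp: admissible_partition_def)
  let ?e = "real CARD('n) / 2"
  obtain \<alpha> C where \<alpha>: "?e < \<alpha>" and C: "0 < C" and dec0: "\<And>j k. k \<in> K \<Longrightarrow> AE \<omega> in lebesgue.
        (\<omega> \<notin> I j k \<longrightarrow> cmod (Phi_nat I \<phi> j k \<omega>) \<le>
             C * (2 powr (real j * real CARD('n) / 2) * (min 1 (norm \<omega>)) powr s / (1 + infdist \<omega> (I j k)) powr (\<alpha> + s))) \<and>
        cmod (Phi_nat I \<phi> j k \<omega>) \<le> C"
  proof -
    from adm[unfolded sobolev_admissible_def, THEN conjunct1]
    obtain \<alpha> C where "?e < \<alpha>" "0 < C" "\<forall>j::nat. \<forall>k\<in>K. AE \<omega> in lebesgue.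
        (\<omega> \<notin> I j k \<longrightarrow> cmod (Phi_nat I \<phi> j k \<omega>) \<le>
             C * (2 powr (real j * real CARD('n) / 2) * (min 1 (norm \<omega>)) powr s / (1 + infdist \<omega> (I j k)) powr (\<alpha> + s))) \<and>
        cmod (Phi_nat I \<phi> j k \<omega>) \<le> C" by (elim exE conjE)
    then show ?thesis by (intro that[of \<alpha> C]) auto
  qed
  have dec: "AE \<omega> in lborel.
        (\<omega> \<notin> I j k \<longrightarrow> cmod (Phi_nat I \<phi> j k \<omega>) \<le>
             C * (2 powr (real j * ?e) * (min 1 (norm \<omega>)) powr s / (1 + infdist \<omega> (I j k)) powr (\<alpha> + s))) \<and>
        cmod (Phi_nat I \<phi> j k \<omega>) \<le> C" if "k \<in> K" for j k
    using dec0[OF that, of j] by (simp add: AE_completion_iff)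
  have \<alpha>0: "0 < \<alpha>" using \<alpha> by (rule le_less_trans[rotated]) simp
  define c1 where "c1 = cmin / 2"
  define c2 where "c2 = 2 * cmax"
  define M where "M = C * c1 powr (- s)"
  define \<kappa>1 where "\<kappa>1 = C * c1 powr (- (\<alpha> + s))"
  define \<kappa>2 where "\<kappa>2 = C * (2 powr (\<alpha> + s) * c2 powr (- (2 * s)))"
  define \<kappa> where "\<kappa> = \<kappa>1 + \<kappa>2 * (1 + c2 powr (- \<alpha>))"
  define q where "q = 2 powr (- (\<alpha> - ?e))"
  have nn: "0 \<le> \<kappa>1" "0 \<le> \<kappa>2" using C by (simp_all add: \<kappa>1_def \<kappa>2_def)
  have \<kappa>0: "0 \<le> \<kappa>" "\<kappa>1 \<le> \<kappa>" "\<kappa>2 \<le> \<kappa>" "\<kappa>2 * c2 powr (- \<alpha>) \<le> \<kappa>"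
    using nn by (auto simp: \<kappa>_def distrib_left)
  have q: "0 < q" "q < 1" using \<alpha> by (auto simp: q_def powr_less_one)
  have qJ: "2 powr (- (real J * (\<alpha> - ?e))) = q ^ J" for J
    unfolding q_def by (subst powr_power, simp, simp only: mult_minus_right)
  have c: "0 < c1" "c1 < c2" using cm0 by (simp_all add: c1_def c2_def cmax_def)
  show ?thesis
  proof (rule exI[of _ \<alpha>], rule exI[of _ M], rule exI[of _ \<kappa>], rule exI[of _ q], rule exI[of _ c1], rule exI[of _ c2],
      intro conjI allI ballI)
    show "0 \<le> M" using C by (simp add: M_def)
    fix j :: int and k assume k: "k \<in> K"
    let ?J = "nat \<bar>j\<bar>" and ?b = "band_dilation j" and ?r = "band_scale j"
    have pos: "0 < ?b" "0 < ?r" by (rule band_dilation_pos, rule band_scale_pos)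
    have x_eq: "norm (?b *\<^sub>R \<omega>) / 2 ^ ?J = norm \<omega> / ?r" for \<omega> :: "real^'n"
      unfolding band_dilation_scale[symmetric] using pos by simp
    have rx: "?r powr s * (norm \<omega> / ?r) powr s = norm \<omega> powr s" for \<omega> :: "real^'n"
      using pos by (simp flip: powr_mult)
    have ae: "AE \<omega> in lborel.
        (?b *\<^sub>R \<omega> \<notin> I ?J k \<longrightarrow> cmod (Phi_nat I \<phi> ?J k (?b *\<^sub>R \<omega>)) \<le>
             C * (2 powr (real ?J * ?e) * (min 1 (norm (?b *\<^sub>R \<omega>))) powr s / (1 + infdist (?b *\<^sub>R \<omega>) (I ?J k)) powr (\<alpha> + s))) \<and>
        cmod (Phi_nat I \<phi> ?J k (?b *\<^sub>R \<omega>)) \<le> C"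
      using AE_lborel_affine[OF dec[OF k, of ?J], of ?b 0] pos by simp
    show "AE \<omega> in lborel. band_bounded \<alpha> M (\<kappa> * q ^ ?J) c1 c2 (norm \<omega> / ?r) (norm \<omega> powr s)
        (?r powr s * cmod (Phi I \<phi> j k \<omega>))"
      using ae AE_lborel_singleton[of 0]
    proof eventually_elim
      fix \<omega> :: "real^'n"
      assume H: "(?b *\<^sub>R \<omega> \<notin> I ?J k \<longrightarrow> cmod (Phi_nat I \<phi> ?J k (?b *\<^sub>R \<omega>)) \<le>
             C * (2 powr (real ?J * ?e) * (min 1 (norm (?b *\<^sub>R \<omega>))) powr s / (1 + infdist (?b *\<^sub>R \<omega>) (I ?J k)) powr (\<alpha> + s))) \<and>
        cmod (Phi_nat I \<phi> ?J k (?b *\<^sub>R \<omega>)) \<le> C" and \<omega>: "\<omega> \<noteq> 0"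
      let ?P = "cmod (Phi I \<phi> j k \<omega>)" and ?x = "norm \<omega> / ?r"
      have bw: "?b *\<^sub>R \<omega> \<noteq> 0" using pos \<omega> by simp
      note D = decay_pointwise[OF s \<alpha>0 C cm ne[OF k] I[OF k] H[THEN conjunct1, rule_format] H[THEN conjunct2] bw,
          unfolded x_eq, folded Phi_eq_Phi_nat c1_def c2_def, folded M_def \<kappa>1_def \<kappa>2_def, unfolded qJ]
      have up: "?r powr s * ?P \<le> A * norm \<omega> powr s" if "?P \<le> A * ?x powr s" for A
      proof -
        have "?r powr s * ?P \<le> ?r powr s * (A * ?x powr s)" using that by (intro mult_left_mono) auto
        also have "\<dots> = A * norm \<omega> powr s" using rx[of \<omega>] by (simp add: mult_ac)
        finally show ?thesis .
      qed
      have near: "?r powr s * ?P \<le> M * norm \<omega> powr s" if "c1 \<le> ?x"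
        by (rule up, rule D(1)[OF _ _ that])
      have small: "?r powr s * ?P \<le> \<kappa> * q ^ ?J * norm \<omega> powr s" if "?x < c1"
      proof -
        have "?r powr s * ?P \<le> \<kappa>1 * q ^ ?J * norm \<omega> powr s"
          by (rule up, rule D(2)[OF _ _ that])
        also have "\<dots> \<le> \<kappa> * q ^ ?J * norm \<omega> powr s" using \<kappa>0 q by (intro mult_right_mono) auto
        finally show ?thesis .
      qed
      have big: "?r powr s * ?P \<le> \<kappa>2 * q ^ ?J * norm \<omega> powr s * ?x powr (- \<alpha>)" if "c2 \<le> ?x"
      proof -
        have "?P \<le> (\<kappa>2 * q ^ ?J * ?x powr (- \<alpha>)) * ?x powr s" using D(3)[OF _ _ that] by (simp add: mult_ac)
        from up[OF this] show ?thesis by (simp add: mult_ac)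
      qed
      have big1: "?r powr s * ?P \<le> \<kappa> * q ^ ?J * norm \<omega> powr s" if "c2 \<le> ?x"
      proof -
        have "?x powr (- \<alpha>) \<le> c2 powr (- \<alpha>)" using that c \<alpha>0 by (intro powr_mono2') auto
        then have "\<kappa>2 * q ^ ?J * norm \<omega> powr s * ?x powr (- \<alpha>) \<le> \<kappa>2 * q ^ ?J * norm \<omega> powr s * c2 powr (- \<alpha>)"
          using nn q by (intro mult_left_mono) auto
        also have "\<dots> = (\<kappa>2 * c2 powr (- \<alpha>)) * (q ^ ?J * norm \<omega> powr s)" by (simp add: mult_ac)
        also have "\<dots> \<le> \<kappa> * (q ^ ?J * norm \<omega> powr s)" using \<kappa>0 q by (intro mult_right_mono) auto
        finally show ?thesis using big[OF that] by (simp add: mult_ac)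
      qed
      have big2: "?r powr s * ?P \<le> \<kappa> * q ^ ?J * norm \<omega> powr s * ?x powr (- \<alpha>)" if "c2 \<le> ?x"
      proof -
        have "\<kappa>2 * q ^ ?J * norm \<omega> powr s * ?x powr (- \<alpha>) \<le> \<kappa> * q ^ ?J * norm \<omega> powr s * ?x powr (- \<alpha>)"
          using \<kappa>0 q by (intro mult_right_mono) auto
        with big[OF that] show ?thesis by linarith
      qed
      show "band_bounded \<alpha> M (\<kappa> * q ^ ?J) c1 c2 ?x (norm \<omega> powr s) (?r powr s * ?P)"
        unfolding band_bounded_def using near small big1 big2 by blast
    qed
    fix \<omega> assume "\<omega> \<in> extended_set I j k"
    then have "?b *\<^sub>R \<omega> \<in> I ?J k" by (simp add: extended_set_iff)
    from I[OF k this] show "norm \<omega> / ?r < c2 / 2" unfolding x_eq by (simp add: c2_def)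
  qed (use \<alpha> \<kappa>0 q c in auto)
qed

section \<open>Summation over the bands\<close>

lemma nn_integral_count_space_Times:
  assumes "countable A" "countable B"
  shows "(\<integral>\<^sup>+z. f z \<partial>count_space (A \<times> B)) = (\<integral>\<^sup>+x. (\<integral>\<^sup>+y. f (x, y) \<partial>count_space B) \<partial>count_space A)"
proof -
  interpret sigma_finite_measure "count_space B"
    by (rule sigma_finite_measure_count_space_countable) fact
  have "(\<integral>\<^sup>+x. (\<integral>\<^sup>+y. f (x, y) \<partial>count_space B) \<partial>count_space A) = (\<integral>\<^sup>+z. f z \<partial>(count_space A \<Otimes>\<^sub>M count_space B))"
    using assms by (intro nn_integral_fst) (simp add: pair_measure_countable)
  then show ?thesis using assms by (simp add: pair_measure_countable)
qed

lemma nn_integral_geometric_int: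
  assumes "0 \<le> q" "q < 1"
  shows "\<exists>Q\<ge>0. (\<integral>\<^sup>+j. ennreal (q ^ nat \<bar>j\<bar>) \<partial>count_space (UNIV :: int set)) \<le> ennreal Q"
proof (intro exI conjI)
  have sm: "summable (\<lambda>n. q ^ n)" using assms by (intro summable_geometric) auto
  show "(\<integral>\<^sup>+j. ennreal (q ^ nat \<bar>j\<bar>) \<partial>count_space (UNIV :: int set)) \<le> ennreal (2 * (\<Sum>n. q ^ n))"
    using assms by (intro nn_integral_count_space_le_finite_sums int_abs_sum_le sm) auto
  show "0 \<le> 2 * (\<Sum>n. q ^ n)" using suminf_nonneg[OF sm] assms by simp
qed

text \<open>The condition confines \<open>j\<close> to the half-open interval from \<open>log\<^sub>2
  (w/c2)\<close> to \<open>log\<^sub>2 (w/c1)\<close>, whose length does not depend on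
  \<open>w\<close>.\<close>

lemma nn_integral_near_bands:
  fixes w :: real
  assumes c: "0 < c1" "c1 < c2" and w: "0 < w"
  shows "(\<integral>\<^sup>+j. indicator {j. c1 \<le> w / band_scale j \<and> w / band_scale j < c2} j \<partial>count_space (UNIV :: int set)) \<le>
    ennreal (log 2 (c2 / c1) + 1)"
proof -
  let ?S = "{j :: int. c1 \<le> w / band_scale j \<and> w / band_scale j < c2}"
  define u v where "u = log 2 (w / c2)" and "v = log 2 (w / c1)"
  have sub: "?S \<subseteq> {\<lfloor>u\<rfloor> + 1 .. \<lfloor>v\<rfloor>}"
  proof
    fix j assume "j \<in> ?S"
    then have "2 powr (real_of_int j) \<le> w / c1" "w / c2 < 2 powr (real_of_int j)"
      using c w by (auto simp: band_scale_def field_simps)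
    then have "real_of_int j \<le> v" "u < real_of_int j"
      using c w by (auto simp: u_def v_def le_log_iff log_less_iff)
    then show "j \<in> {\<lfloor>u\<rfloor> + 1 .. \<lfloor>v\<rfloor>}" by (auto simp: le_floor_iff floor_less_iff add1_zle_eq)
  qed
  have vu: "v - u = log 2 (c2 / c1)" using c w by (simp add: u_def v_def log_divide)
  have pos: "0 < log 2 (c2 / c1)" using c by simp
  have "(\<integral>\<^sup>+j. indicator ?S j \<partial>count_space (UNIV :: int set)) \<le> (\<integral>\<^sup>+j. indicator {\<lfloor>u\<rfloor> + 1 .. \<lfloor>v\<rfloor>} j \<partial>count_space (UNIV :: int set))"
    using sub by (intro nn_integral_mono) (auto simp: indicator_def)
  also have "\<dots> = of_nat (card {\<lfloor>u\<rfloor> + 1 .. \<lfloor>v\<rfloor>})" by simp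
  also have "\<dots> = ennreal (real (nat (\<lfloor>v\<rfloor> - \<lfloor>u\<rfloor>)))" by (simp add: ennreal_of_nat_eq_real_of_nat)
  also have "\<dots> \<le> ennreal (log 2 (c2 / c1) + 1)"
    using vu pos by (intro ennreal_leI) linarith
  finally show ?thesis .
qed

text \<open>The left-hand side is finite because \<open>|\<omega>|\<^bsup>2s\<^esup> \<le> (1 +
  |\<omega>|\<^sup>2)\<^sup>s\<close>, so that it agrees with the Bochner integral in the
  seminorm.\<close>

lemma nn_integral_weighted_fourier:
  fixes f :: "real^'n \<Rightarrow> complex"
  assumes f: "f \<in> sobolev_space s" and s: "0 \<le> s"
    and F: "finite_energy F" "AE \<omega> in lborel. fourier f \<omega> = F \<omega>"
  shows "(\<integral>\<^sup>+\<omega>. ennreal ((norm \<omega> powr s * cmod (F \<omega>))\<^sup>2) \<partial>lborel) = ennreal ((sobolev_seminorm s f)\<^sup>2)"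
proof -
  note [measurable] = finite_energy_measurable[OF F(1)]
  define E where "E = (\<lambda>\<omega>. norm \<omega> powr s * cmod (F \<omega>))"
  have [measurable]: "E \<in> borel_measurable borel" unfolding E_def by measurable
  have fI: "integrable lebesgue (\<lambda>\<omega>. (1 + (norm \<omega>)\<^sup>2) powr s * (cmod (fourier f \<omega>))\<^sup>2)"
    using f by (auto simp: sobolev_space_def)
  define N where "N = (LINT \<omega>|lborel. (E \<omega>)\<^sup>2)"
  have N0: "0 \<le> N" by (simp add: N_def)
  have Efin: "(\<integral>\<^sup>+\<omega>. ennreal ((E \<omega>)\<^sup>2) \<partial>lborel) < \<infinity>"
  proof -
    have "(\<integral>\<^sup>+\<omega>. ennreal ((E \<omega>)\<^sup>2) \<partial>lborel) \<le>
      (\<integral>\<^sup>+\<omega>. ennreal ((1 + (norm \<omega>)\<^sup>2) powr s * (cmod (fourier f \<omega>))\<^sup>2) \<partial>lborel)"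
    proof (rule nn_integral_mono_AE)
      show "AE \<omega> in lborel. ennreal ((E \<omega>)\<^sup>2) \<le> ennreal ((1 + (norm \<omega>)\<^sup>2) powr s * (cmod (fourier f \<omega>))\<^sup>2)"
        using F(2)
      proof eventually_elim
        fix \<omega> assume eq: "fourier f \<omega> = F \<omega>"
        have "(norm \<omega> powr s)\<^sup>2 = norm \<omega> powr (2 * s)" by (simp add: power2_eq_square powr_add[symmetric])
        also have "\<dots> = (norm \<omega> powr 2) powr s" by (simp only: powr_powr)
        also have "\<dots> \<le> (1 + (norm \<omega>)\<^sup>2) powr s" using s by (intro powr_mono2) auto
        finally show "ennreal ((E \<omega>)\<^sup>2) \<le> ennreal ((1 + (norm \<omega>)\<^sup>2) powr s * (cmod (fourier f \<omega>))\<^sup>2)"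
          unfolding E_def eq power_mult_distrib by (intro ennreal_leI mult_right_mono) auto
      qed
    qed
    also have "\<dots> = (\<integral>\<^sup>+\<omega>. ennreal ((1 + (norm \<omega>)\<^sup>2) powr s * (cmod (fourier f \<omega>))\<^sup>2) \<partial>lebesgue)"
      by (rule nn_integral_completion[symmetric])
    also have "\<dots> < \<infinity>" using fI by (simp add: integrable_iff_bounded)
    finally show ?thesis .
  qed
  have NE: "(\<integral>\<^sup>+\<omega>. ennreal ((E \<omega>)\<^sup>2) \<partial>lborel) = ennreal N"
    unfolding N_def using Efin by (intro nn_integral_eq_integral integrableI_bounded) auto
  have semi: "(sobolev_seminorm s f)\<^sup>2 = N"
  proof -
    have m: "(\<lambda>\<omega>. (E \<omega>)\<^sup>2) \<in> borel_measurable lborel" by measurable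
    have ae: "AE \<omega> in lebesgue. (E \<omega>)\<^sup>2 = (cmod (of_real (norm \<omega> powr s) * fourier f \<omega>))\<^sup>2"
      using AE_completion[OF F(2)] by eventually_elim (simp add: E_def norm_mult)
    have "(LINT \<omega>|lebesgue. (cmod (of_real (norm \<omega> powr s) * fourier f \<omega>))\<^sup>2) = (LINT \<omega>|lebesgue. (E \<omega>)\<^sup>2)"
      using ae m by (intro integral_cong_AE borel_measurable_AE[OF _ ae] measurable_completion) (auto elim: AE_mp)
    also have "\<dots> = N" unfolding N_def by (rule integral_completion[OF m])
    finally show ?thesis using N0 by (simp add: sobolev_seminorm_def L2_norm_def)
  qed
  show ?thesis unfolding semi NE[symmetric] by (simp add: E_def)
qed

text \<open>The normalization of the frame elements and the volume of a period combine to the density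
  \<open>\<nu>\<^bsup>-d\<^esup>\<close> of the translation lattice, the same for all bands.\<close>

lemma band_scale_density:
  assumes \<nu>: "0 < \<nu>"
  shows "ennreal (band_scale j powr (- real d)) * ennreal ((band_scale j / \<nu>) ^ d) = ennreal (\<nu> powr (- real d))"
proof -
  have "band_scale j powr (- real d) * (band_scale j / \<nu>) ^ d = \<nu> powr (- real d)"
    using band_scale_pos[of j] \<nu> by (simp add: powr_realpow[symmetric] powr_divide powr_minus_divide)
  then show ?thesis using band_scale_pos[of j] \<nu> by (simp flip: ennreal_mult)
qed

text \<open>For \<open>\<lambda> = \<nu>m\<close> the character in the formula for the inner product
  belongs to the dual lattice of the period \<open>2\<^sup>j/\<nu>\<close>.\<close>

lemma atom_lattice_sum:
  fixes f \<phi> :: "real^'n \<Rightarrow> complex"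
  assumes f: "finite_energy f0" "AE x in lborel. f x = f0 x" "fourier_L2 f0 F"
    and \<phi>: "finite_energy \<phi>0" "AE x in lborel. \<phi> x = \<phi>0 x" "fourier_L2 \<phi>0 \<psi>"
    and \<nu>: "0 < \<nu>"
  shows "(\<integral>\<^sup>+l. ennreal (2 powr (2 * real_of_int j * s) * (cmod (L2_inner f (atom I \<phi> j k l)))\<^sup>2) \<partial>count_space (scaled_lattice \<nu>)) =
    ennreal (band_scale j powr (- real CARD('n))) *
    (\<integral>\<^sup>+m. ennreal ((cmod (LINT x|lborel. of_real (band_scale j powr s) * (cnj (F x) * band_sum I \<psi> j k x) *
        wave (- m) (x /\<^sub>R (band_scale j / \<nu>))))\<^sup>2) \<partial>count_space int_lattice)"
proof -
  let ?d = "real CARD('n)"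
  define G where "G = (\<lambda>j k \<omega>. of_real (band_scale j powr s) * (cnj (F \<omega>) * band_sum I \<psi> j k \<omega>))"
  have inj: "inj_on (\<lambda>\<eta> :: real^'n. \<nu> *\<^sub>R \<eta>) int_lattice" using \<nu> by (auto simp: inj_on_def)
  have "(\<integral>\<^sup>+l. ennreal (2 powr (2 * real_of_int j * s) * (cmod (L2_inner f (atom I \<phi> j k l)))\<^sup>2) \<partial>count_space (scaled_lattice \<nu>)) = (\<integral>\<^sup>+m. ennreal (2 powr (2 * real_of_int j * s) * (cmod (L2_inner f (atom I \<phi> j k (\<nu> *\<^sub>R m))))\<^sup>2) \<partial>count_space int_lattice)"
    unfolding scaled_lattice_def
    by (rule nn_integral_bij_count_space[symmetric]) (rule inj_on_imp_bij_betw[OF inj])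
  also have "\<dots> = (\<integral>\<^sup>+m. ennreal (band_scale j powr (- ?d)) *
     ennreal ((cmod (lattice_coeff (band_scale j / \<nu>) (G j k) m))\<^sup>2) \<partial>count_space int_lattice)"
  proof (intro nn_integral_cong)
    fix m :: "real^'n"
    have w: "wave (- (\<nu> *\<^sub>R m)) (x /\<^sub>R band_scale j) = wave (- m) (x /\<^sub>R (band_scale j / \<nu>))" for x
      using \<nu> by (simp add: wave_def field_simps)
    have "(lattice_coeff (band_scale j / \<nu>) (G j k) m) =
       of_real (band_scale j powr s) * (LINT x|lborel. (cnj (F x) * band_sum I \<psi> j k x) * wave (- (\<nu> *\<^sub>R m)) (x /\<^sub>R band_scale j))"
      unfolding w G_def by (simp add: mult.assoc)
    then have "(cmod (lattice_coeff (band_scale j / \<nu>) (G j k) m))\<^sup>2 =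
       2 powr (2 * real_of_int j * s) * (cmod (LINT x|lborel. (cnj (F x) * band_sum I \<psi> j k x) * wave (- (\<nu> *\<^sub>R m)) (x /\<^sub>R band_scale j)))\<^sup>2"
    proof -
      have "(band_scale j powr s)\<^sup>2 = 2 powr (2 * real_of_int j * s)"
        by (simp add: band_scale_def power2_eq_square powr_powr powr_add[symmetric] mult_ac)
      then show ?thesis
        unfolding \<open>(lattice_coeff (band_scale j / \<nu>) (G j k) m) = _\<close>
        by (simp add: norm_mult power_mult_distrib)
    qed
    then have "2 powr (2 * real_of_int j * s) * (cmod (L2_inner f (atom I \<phi> j k (\<nu> *\<^sub>R m))))\<^sup>2 =
      band_scale j powr (- ?d) * (cmod (lattice_coeff (band_scale j / \<nu>) (G j k) m))\<^sup>2"
      using L2_inner_atom[OF f \<phi>, of I j k "\<nu> *\<^sub>R m"] by (simp add: mult_ac)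
    then show "ennreal (2 powr (2 * real_of_int j * s) * (cmod (L2_inner f (atom I \<phi> j k (\<nu> *\<^sub>R m))))\<^sup>2) =
      ennreal (band_scale j powr (- ?d)) * ennreal ((cmod (lattice_coeff (band_scale j / \<nu>) (G j k) m))\<^sup>2)"
      by (simp add: ennreal_mult)
  qed
  also have "\<dots> = ennreal (band_scale j powr (- ?d)) *
    (sq_integral (count_space int_lattice) (\<lambda>m. lattice_coeff (band_scale j / \<nu>) (G j k) m))"
    by (rule nn_integral_cmult) simp
  finally show ?thesis by (simp only: G_def)
qed

lemma nn_integral_bands:
  fixes h :: "int \<Rightarrow> 'k \<Rightarrow> ennreal"
  assumes "finite K"
  shows "(\<integral>\<^sup>+(j, k). h j k \<partial>count_space (UNIV \<times> K)) = (\<integral>\<^sup>+j. (\<Sum>k\<in>K. h j k) \<partial>count_space UNIV)"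
  using assms by (subst nn_integral_count_space_Times) (auto simp: countable_finite nn_integral_count_space_finite)

text \<open>For a fixed frequency of norm \<open>w\<close>, boundedly many bands are near it and
  contribute at most \<open>M\<^sup>2e\<^sup>2\<close> each; the others form a geometric series.\<close>

lemma band_square_sum:
  fixes x :: "int \<Rightarrow> 'k \<Rightarrow> real"
  assumes K: "finite K" and c: "0 < c1" "c1 < c2" and w: "0 < w"
    and Q: "(\<integral>\<^sup>+j. ennreal ((q ^ nat \<bar>j :: int\<bar>)\<^sup>2) \<partial>count_space UNIV) \<le> ennreal Q" and Q0: "0 \<le> Q"
    and x0: "\<And>j k. 0 \<le> x j k"
    and bnd: "\<And>j k. k \<in> K \<Longrightarrow> band_bounded \<alpha> M (\<kappa> * q ^ nat \<bar>j\<bar>) c1 c2 (w / band_scale j) e (x j k)"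
  shows "(\<integral>\<^sup>+(j, k). ennreal ((x j k)\<^sup>2) \<partial>count_space (UNIV \<times> K)) \<le>
    ennreal (real (card K) * (M\<^sup>2 * (log 2 (c2 / c1) + 1) + \<kappa>\<^sup>2 * Q)) * ennreal (e\<^sup>2)"
proof -
  define cK where "cK = real (card K)"
  have cK: "0 \<le> cK" by (simp add: cK_def)
  define n0 where "n0 = log 2 (c2 / c1) + 1"
  have n0: "0 \<le> n0" using c by (simp add: n0_def add_nonneg_nonneg less_imp_le)
  define CU where "CU = cK * (M\<^sup>2 * n0 + \<kappa>\<^sup>2 * Q)"
  let ?I = "\<lambda>j. indicator {j. c1 \<le> w / band_scale j \<and> w / band_scale j < c2} j :: ennreal"
  let ?e = "ennreal (e\<^sup>2)"
  have term_le: "ennreal ((x j k)\<^sup>2) \<le> (ennreal (M\<^sup>2) * ?I j + ennreal (\<kappa>\<^sup>2) * ennreal ((q ^ nat \<bar>j\<bar>)\<^sup>2)) * ?e"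
    if k: "k \<in> K" for j k
  proof (cases "c1 \<le> w / band_scale j \<and> w / band_scale j < c2")
    case True
    with bnd[OF k] have "x j k \<le> M * e" by (auto simp: band_bounded_def)
    then have "(x j k)\<^sup>2 \<le> (M * e)\<^sup>2" using x0 by (intro power_mono) auto
    then have "ennreal ((x j k)\<^sup>2) \<le> ennreal (M\<^sup>2) * ?e"
      by (simp add: power_mult_distrib ennreal_leI flip: ennreal_mult)
    also have "\<dots> \<le> (ennreal (M\<^sup>2) * ?I j + ennreal (\<kappa>\<^sup>2) * ennreal ((q ^ nat \<bar>j\<bar>)\<^sup>2)) * ?e"
      using True by (intro mult_right_mono) auto
    finally show ?thesis .
  next
    case False
    with bnd[OF k] have "x j k \<le> \<kappa> * q ^ nat \<bar>j\<bar> * e" by (auto simp: band_bounded_def not_le not_less)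
    then have "(x j k)\<^sup>2 \<le> (\<kappa> * q ^ nat \<bar>j\<bar> * e)\<^sup>2" using x0 by (intro power_mono) auto
    also have "\<dots> = \<kappa>\<^sup>2 * (q ^ nat \<bar>j\<bar>)\<^sup>2 * e\<^sup>2" by (simp only: power_mult_distrib)
    finally have "ennreal ((x j k)\<^sup>2) \<le> ennreal (\<kappa>\<^sup>2 * (q ^ nat \<bar>j\<bar>)\<^sup>2 * e\<^sup>2)" by (rule ennreal_leI)
    also have "\<dots> = ennreal (\<kappa>\<^sup>2) * ennreal ((q ^ nat \<bar>j\<bar>)\<^sup>2) * ?e" by (simp only: ennreal_mult mult_nonneg_nonneg zero_le_power2)
    also have "\<dots> \<le> (ennreal (M\<^sup>2) * ?I j + ennreal (\<kappa>\<^sup>2) * ennreal ((q ^ nat \<bar>j\<bar>)\<^sup>2)) * ?e"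
      by (intro mult_right_mono) auto
    finally show ?thesis .
  qed
  have "(\<integral>\<^sup>+(j, k). ennreal ((x j k)\<^sup>2) \<partial>count_space (UNIV \<times> K)) \<le>
    (\<integral>\<^sup>+j. ennreal cK * ((ennreal (M\<^sup>2) * ?I j + ennreal (\<kappa>\<^sup>2) * ennreal ((q ^ nat \<bar>j\<bar>)\<^sup>2)) * ?e) \<partial>count_space UNIV)"
    unfolding nn_integral_bands[OF K]
  proof (intro nn_integral_mono)
    fix j
    have "(\<Sum>k\<in>K. ennreal ((x j k)\<^sup>2)) \<le> (\<Sum>k\<in>K. (ennreal (M\<^sup>2) * ?I j + ennreal (\<kappa>\<^sup>2) * ennreal ((q ^ nat \<bar>j\<bar>)\<^sup>2)) * ?e)"
      by (intro sum_mono term_le)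
    also have "\<dots> = ennreal cK * ((ennreal (M\<^sup>2) * ?I j + ennreal (\<kappa>\<^sup>2) * ennreal ((q ^ nat \<bar>j\<bar>)\<^sup>2)) * ?e)"
      by (simp add: cK_def ennreal_of_nat_eq_real_of_nat)
    finally show "(\<Sum>k\<in>K. ennreal ((x j k)\<^sup>2)) \<le> ennreal cK * ((ennreal (M\<^sup>2) * ?I j + ennreal (\<kappa>\<^sup>2) * ennreal ((q ^ nat \<bar>j\<bar>)\<^sup>2)) * ?e)" .
  qed
  also have "\<dots> = ennreal cK * ((ennreal (M\<^sup>2) * (\<integral>\<^sup>+j. ?I j \<partial>count_space UNIV) +
      ennreal (\<kappa>\<^sup>2) * (\<integral>\<^sup>+j. ennreal ((q ^ nat \<bar>j\<bar>)\<^sup>2) \<partial>count_space UNIV)) * ?e)"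
    by (simp add: nn_integral_cmult nn_integral_multc nn_integral_add del: nn_integral_indicator)
  also have "\<dots> \<le> ennreal cK * ((ennreal (M\<^sup>2) * ennreal n0 + ennreal (\<kappa>\<^sup>2) * ennreal Q) * ?e)"
    using nn_integral_near_bands[OF c w] Q
    by (intro mult_left_mono mult_right_mono add_mono) (auto simp: n0_def)
  also have "\<dots> = ennreal CU * ?e"
  proof -
    have "ennreal CU = ennreal cK * (ennreal (M\<^sup>2) * ennreal n0 + ennreal (\<kappa>\<^sup>2) * ennreal Q)"
      unfolding CU_def using cK n0 Q0 by (simp add: ennreal_mult ennreal_plus)
    then show ?thesis by (simp only: mult.assoc)
  qed
  finally show ?thesis by (simp only: CU_def cK_def n0_def)
qed

text \<open>Summing the band estimates, the central terms lie between \<open>A0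
  |f|\<^sub>s\<^sup>2\<close> and \<open>CU |f|\<^sub>s\<^sup>2\<close> and the errors are at most
  \<open>c0 \<nu>\<^bsup>2\<alpha>\<^esup> |f|\<^sub>s\<^sup>2\<close>, all with the common factor
  \<open>\<nu>\<^bsup>-d\<^esup>\<close>. The bound \<open>\<nu>\<^sub>0\<close> makes the errors at
  most a quarter of \<open>A0 |f|\<^sub>s\<^sup>2\<close>.\<close>

theorem theorem4:
  fixes K :: "'k set"
    and I :: "nat \<Rightarrow> 'k \<Rightarrow> (real^'n) set"
    and I\<^sub>0 :: "(real^'n) set"
    and s :: real
    and \<phi> :: "real^'n \<Rightarrow> complex"
  assumes "admissible_partition K I I\<^sub>0"
    and "0 \<le> s"
    and "\<phi> \<in> L2"
    and "sobolev_admissible s K I \<phi>"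
  shows "\<exists>\<nu>\<^sub>0>0. \<forall>\<nu>. 0 < \<nu> \<and> \<nu> < \<nu>\<^sub>0 \<longrightarrow>
    (\<exists>A>0. \<exists>B>0. \<forall>f\<in>sobolev_space s.
       (\<lambda>(j, k, l). 2 powr (2 * real_of_int j * s) * (cmod (L2_inner f (atom I \<phi> j k l)))\<^sup>2)
         summable_on (UNIV \<times> K \<times> scaled_lattice \<nu>) \<and>
       A * (sobolev_seminorm s f)\<^sup>2 \<le>
         (\<Sum>\<^sub>\<infinity>(j, k, l)\<in>UNIV \<times> K \<times> scaled_lattice \<nu>.
            2 powr (2 * real_of_int j * s) * (cmod (L2_inner f (atom I \<phi> j k l)))\<^sup>2) \<and>
       (\<Sum>\<^sub>\<infinity>(j, k, l)\<in>UNIV \<times> K \<times> scaled_lattice \<nu>.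
            2 powr (2 * real_of_int j * s) * (cmod (L2_inner f (atom I \<phi> j k l)))\<^sup>2) \<le>
         B * (sobolev_seminorm s f)\<^sup>2)"
proof -
  have K: "finite K" using assms(1) by (simp add: admissible_partition_def)
  obtain \<alpha> M \<kappa> q c1 c2 where \<alpha>: "real CARD('n) / 2 < \<alpha>" and M: "0 \<le> M" and \<kappa>: "0 \<le> \<kappa>"
    and q: "0 < q" "q < 1" and c: "0 < c1" "c1 < c2"
    and decay': "\<forall>j. \<forall>k\<in>K. AE \<omega> in lborel.
      band_bounded \<alpha> M (\<kappa> * q ^ nat \<bar>j\<bar>) c1 c2 (norm \<omega> / band_scale j) (norm \<omega> powr s)
        (band_scale j powr s * cmod (Phi I \<phi> j k \<omega>))"
    and ext': "\<forall>j. \<forall>k\<in>K. \<forall>\<omega>\<in>extended_set I j k. norm \<omega> / band_scale j < c2 / 2"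
    using band_decay[OF assms(1,2,4)] by (elim exE conjE) (rule that)
  note decay = decay'[THEN spec, THEN bspec]
  have ext: "norm \<omega> / band_scale j < c2 / 2" if "k \<in> K" "\<omega> \<in> extended_set I j k" for j k \<omega>
    using ext' that by blast
  obtain a where a: "0 < a" and cover: "AE \<omega> in lebesgue. \<exists>j::int. \<exists>k\<in>K.
        \<omega> \<in> extended_set I j k \<and> a \<le> cmod (Phi I \<phi> j k \<omega>)"
    using assms(4)[unfolded sobolev_admissible_def, THEN conjunct2] by blast
  have \<alpha>0: "0 < \<alpha>" using \<alpha> by (rule le_less_trans[rotated]) simp
  obtain \<Lambda> where \<Lambda>0: "0 \<le> \<Lambda>" and \<Lambda>: "\<And>y. y \<in> unit_cell \<Longrightarrow>
      (\<integral>\<^sup>+n. ennreal (norm (y + n) powr (- (2 * \<alpha>))) \<partial>count_space (int_lattice - {0 :: real^'n})) \<le> ennreal \<Lambda>"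
    using lattice_tail_bound[where 'n='n, of "2 * \<alpha>"] \<alpha> by (auto simp: field_simps)
  obtain Q where Q0: "0 \<le> Q" and Q: "(\<integral>\<^sup>+j. ennreal ((q\<^sup>2) ^ nat \<bar>j\<bar>) \<partial>count_space (UNIV :: int set)) \<le> ennreal Q"
    using nn_integral_geometric_int[of "q\<^sup>2"] q by (auto simp: power_less_one_iff)
  define n0 where "n0 = log 2 (c2 / c1) + 1"
  have n0: "0 \<le> n0" using c by (simp add: n0_def add_nonneg_nonneg less_imp_le)
  define cK where "cK = real (card K)"
  have cK: "0 \<le> cK" by (simp add: cK_def)
  define CU where "CU = cK * (M\<^sup>2 * n0 + \<kappa>\<^sup>2 * Q)"
  have CU: "0 \<le> CU" using n0 Q0 cK by (simp add: CU_def)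
  define c0 where "c0 = cK * Q * (\<kappa>\<^sup>2 * \<Lambda>)"
  have c0: "0 \<le> c0" using cK Q0 \<Lambda>0 by (simp add: c0_def)
  define A0 where "A0 = (a * (c2 / 2) powr (- s))\<^sup>2"
  have A0: "0 < A0" using a c by (simp add: A0_def)
  \<comment> \<open>the first bound places each band inside its central period, the second one absorbs the errors\<close>
  define \<nu>0 where "\<nu>0 = min (1 / (2 * c2)) ((A0 / (4 * (c0 + 1))) powr (1 / (2 * \<alpha>)))"
  have \<nu>0: "0 < \<nu>0" using c A0 c0 by (simp add: \<nu>0_def)

  obtain \<phi>0 where \<phi>0: "finite_energy \<phi>0" "AE x in lborel. \<phi> x = \<phi>0 x"
    using L2_Borel_version[OF assms(3)] by blast
  obtain \<psi> where \<psi>: "finite_energy \<psi>" "fourier_L2 \<phi>0 \<psi>" "AE x in lborel. fourier \<phi> x = \<psi> x"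
    using fourier_Borel_version[OF \<phi>0] by blast

  have main: "\<exists>S. ((\<lambda>(j, k, l). 2 powr (2 * real_of_int j * s) * (cmod (L2_inner f (atom I \<phi> j k l)))\<^sup>2) has_sum S)
         (UNIV \<times> K \<times> scaled_lattice \<nu>) \<and>
      \<nu> powr (- real CARD('n)) * A0 / 4 * (sobolev_seminorm s f)\<^sup>2 \<le> S \<and>
      S \<le> \<nu> powr (- real CARD('n)) * (2 * CU + A0 + 1) * (sobolev_seminorm s f)\<^sup>2"
    if f: "f \<in> sobolev_space s" and \<nu>: "0 < \<nu>" "\<nu> < \<nu>0" for f \<nu>
  proof -
    let ?d = "real CARD('n)"
    have fL: "f \<in> L2" using f by (simp add: sobolev_space_def)
    obtain f0 where f0: "finite_energy f0" "AE x in lborel. f x = f0 x"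
      using L2_Borel_version[OF fL] by blast
    obtain F where F: "finite_energy F" "fourier_L2 f0 F" "AE x in lborel. fourier f x = F x"
      using fourier_Borel_version[OF f0] by blast
    note Fm[measurable] = finite_energy_measurable[OF F(1)]
    define E where "E = (\<lambda>\<omega>. norm \<omega> powr s * cmod (F \<omega>))"
    have E[measurable]: "E \<in> borel_measurable borel" unfolding E_def by measurable
    have E0: "0 \<le> E \<omega>" for \<omega> by (simp add: E_def)
    define N where "N = (sobolev_seminorm s f)\<^sup>2"
    have N0: "0 \<le> N" by (simp add: N_def)
    have NE: "(\<integral>\<^sup>+\<omega>. ennreal ((E \<omega>)\<^sup>2) \<partial>lborel) = ennreal N"
      unfolding E_def N_def by (rule nn_integral_weighted_fourier[OF f assms(2) F(1,3)])
    have Efin: "(\<integral>\<^sup>+\<omega>. ennreal ((E \<omega>)\<^sup>2) \<partial>lborel) < \<infinity>" by (simp add: NE)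
    define G where "G = (\<lambda>j k \<omega>. of_real (band_scale j powr s) * (cnj (F \<omega>) * band_sum I \<psi> j k \<omega>))"
    have bs: "finite_energy (band_sum I \<psi> j k)" for j k by (rule finite_energy_band_sum[OF \<psi>(1)])
    have GI: "integrable lborel (G j k)" for j k
      unfolding G_def using integrable_cnj[OF pairing_integrable[OF F(1) bs[of j k]]]
      by (intro integrable_mult_right) simp
    have Gm[measurable]: "G j k \<in> borel_measurable borel" for j k using GI[of j k] by auto
    have G_eq: "cmod (G j k \<omega>) = (band_scale j powr s * cmod (band_sum I \<psi> j k \<omega>)) * cmod (F \<omega>)" for j k \<omega>
      by (simp add: G_def norm_mult)
    define J where "J = (\<lambda>j :: int. nat \<bar>j\<bar>)"
    have dec: "AE \<omega> in lborel. band_bounded \<alpha> M (\<kappa> * q ^ J j) c1 c2 (norm \<omega> / band_scale j) (E \<omega>) (cmod (G j k \<omega>))" if k: "k \<in> K" for j k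
      using decay[OF k, of j] Phi_eq_band_sum_AE[OF \<psi>(3), of I j k]
    proof eventually_elim
      fix \<omega> :: "real^'n"
      assume H: "band_bounded \<alpha> M (\<kappa> * q ^ nat \<bar>j\<bar>) c1 c2 (norm \<omega> / band_scale j) (norm \<omega> powr s)
        (band_scale j powr s * cmod (Phi I \<phi> j k \<omega>))"
        and eq: "Phi I \<phi> j k \<omega> = band_sum I \<psi> j k \<omega>"
      show "band_bounded \<alpha> M (\<kappa> * q ^ J j) c1 c2 (norm \<omega> / band_scale j) (E \<omega>) (cmod (G j k \<omega>))"
        using band_bounded_scale[OF H, of "cmod (F \<omega>)"] by (simp only: eq G_eq E_def J_def norm_ge_zero)
    qed
    define D where "D = (\<lambda>j. (\<kappa> * q ^ J j)\<^sup>2 * \<nu> powr (2 * \<alpha>) * \<Lambda> * N)"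
    have D0: "0 \<le> D j" for j using \<Lambda>0 N0 by (simp add: D_def)
    define \<tau> where "\<tau> = (\<lambda>j k. \<integral>\<^sup>+l. ennreal (2 powr (2 * real_of_int j * s) * (cmod (L2_inner f (atom I \<phi> j k l)))\<^sup>2) \<partial>count_space (scaled_lattice \<nu>))"
    have \<nu>c2: "c2 \<le> 1 / (2 * \<nu>)"
    proof -
      have "\<nu> < 1 / (2 * c2)" using \<nu> by (simp add: \<nu>0_def)
      then show ?thesis using c \<nu> by (simp add: field_simps)
    qed
    let ?V = "\<nu> powr (- ?d)"
    have tau_eq: "\<tau> j k = ennreal (band_scale j powr (- ?d)) *
      (\<integral>\<^sup>+m. ennreal ((cmod (lattice_coeff (band_scale j / \<nu>) (G j k) m))\<^sup>2) \<partial>count_space int_lattice)" for j k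
      unfolding \<tau>_def G_def by (rule atom_lattice_sum[OF f0 F(2) \<phi>0 \<psi>(2) \<nu>(1)])
    have scale: "ennreal (band_scale j powr (- ?d)) * ennreal ((band_scale j / \<nu>) ^ CARD('n)) = ennreal ?V" for j
      by (rule band_scale_density[OF \<nu>(1)])
    have band: "\<tau> j k \<le> ennreal ?V * (2 * energy (G j k) + 2 * ennreal (D j))"
      "ennreal ?V * (\<integral>\<^sup>+\<omega>. ennreal ((cmod (G j k \<omega>))\<^sup>2) * indicator unit_cell (\<omega> /\<^sub>R (band_scale j / \<nu>)) \<partial>lborel) \<le>
         2 * \<tau> j k + ennreal ?V * (2 * ennreal (D j))" if k: "k \<in> K" for j k
    proof -
      have all: "AE \<omega> in lborel. cmod (G j k \<omega>) \<le> (M + \<kappa> * q ^ J j) * E \<omega>"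
        using dec[OF k, of j]
      proof eventually_elim
        fix \<omega>
        assume H: "band_bounded \<alpha> M (\<kappa> * q ^ J j) c1 c2 (norm \<omega> / band_scale j) (E \<omega>) (cmod (G j k \<omega>))"
        have "0 \<le> M * E \<omega>" "0 \<le> \<kappa> * q ^ J j * E \<omega>" using M \<kappa> q E0 by simp_all
        then show "cmod (G j k \<omega>) \<le> (M + \<kappa> * q ^ J j) * E \<omega>"
          using H unfolding band_bounded_def
          by (cases "c1 \<le> norm \<omega> / band_scale j \<and> norm \<omega> / band_scale j < c2") (auto simp: distrib_right)
      qed
      have far: "AE \<omega> in lborel. c2 * band_scale j \<le> norm \<omega> \<longrightarrow>
          cmod (G j k \<omega>) \<le> (\<kappa> * q ^ J j) * E \<omega> * (norm \<omega> / band_scale j) powr (- \<alpha>)"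
        using dec[OF k, of j] band_scale_pos[of j] by (auto elim!: eventually_mono simp: band_bounded_def field_simps)
      have kq: "0 \<le> \<kappa> * q ^ J j" "0 \<le> M + \<kappa> * q ^ J j" using M \<kappa> q by simp_all
      note BE = band_estimate[OF GI E E0 Efin all kq(2) far kq(1) band_scale_pos \<nu>(1) \<nu>c2 \<Lambda> \<Lambda>0]
      have D_eq: "ennreal ((\<kappa> * q ^ J j)\<^sup>2 * \<nu> powr (2 * \<alpha>) * \<Lambda>) * (\<integral>\<^sup>+\<omega>. ennreal ((E \<omega>)\<^sup>2) \<partial>lborel) = ennreal (D j)"
        unfolding NE D_def using \<Lambda>0 N0 by (subst ennreal_mult) auto
      let ?T = "\<integral>\<^sup>+m. ennreal ((cmod (lattice_coeff (band_scale j / \<nu>) (G j k) m))\<^sup>2) \<partial>count_space int_lattice"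
      let ?p = "ennreal ((band_scale j / \<nu>) ^ CARD('n))" and ?r = "ennreal (band_scale j powr (- ?d))"
      have "?r * ?T \<le> ?r * (?p * (2 * energy (G j k) + 2 * ennreal (D j)))"
        using BE(1) unfolding D_eq by (intro mult_left_mono) auto
      then show "\<tau> j k \<le> ennreal ?V * (2 * energy (G j k) + 2 * ennreal (D j))"
        unfolding tau_eq scale[of j, symmetric] by (simp only: mult.assoc)
      have "?r * (?p * (\<integral>\<^sup>+\<omega>. ennreal ((cmod (G j k \<omega>))\<^sup>2) * indicator unit_cell (\<omega> /\<^sub>R (band_scale j / \<nu>)) \<partial>lborel)) \<le>
         ?r * (2 * ?T + ?p * (2 * ennreal (D j)))"
        using BE(2) unfolding D_eq by (intro mult_left_mono) auto
      then show "ennreal ?V * (\<integral>\<^sup>+\<omega>. ennreal ((cmod (G j k \<omega>))\<^sup>2) * indicator unit_cell (\<omega> /\<^sub>R (band_scale j / \<nu>)) \<partial>lborel) \<le>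
         2 * \<tau> j k + ennreal ?V * (2 * ennreal (D j))"
        unfolding tau_eq scale[of j, symmetric] by (simp only: mult.assoc distrib_left mult.left_commute[of ?r 2])
    qed
    let ?S = "(UNIV :: int set) \<times> K"
    have cS: "countable ?S" using K by (simp add: countable_finite)
    define Tot where "Tot = (\<integral>\<^sup>+(j, k). \<tau> j k \<partial>count_space ?S)"
    note sumS = nn_integral_bands[OF K]
    have QJ: "(\<integral>\<^sup>+j. ennreal ((q ^ J j)\<^sup>2) \<partial>count_space UNIV) \<le> ennreal Q"
      using Q by (simp add: J_def power_mult[symmetric] mult.commute)
    have sumD: "(\<integral>\<^sup>+(j, k). ennreal (D j) \<partial>count_space ?S) \<le> ennreal (c0 * \<nu> powr (2 * \<alpha>) * N)"
    proof -
      have "(\<integral>\<^sup>+(j, k). ennreal (D j) \<partial>count_space ?S) = (\<integral>\<^sup>+j. ennreal (cK * (\<kappa>\<^sup>2 * \<nu> powr (2 * \<alpha>) * \<Lambda> * N)) * ennreal ((q ^ J j)\<^sup>2) \<partial>count_space UNIV)"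
        unfolding sumS
      proof (intro nn_integral_cong)
        fix j
        have "(\<Sum>k\<in>K. ennreal (D j)) = ennreal cK * ennreal (D j)" by (simp add: cK_def ennreal_of_nat_eq_real_of_nat)
        also have "\<dots> = ennreal (cK * D j)" using cK D0 by (simp add: ennreal_mult)
        also have "cK * D j = (cK * (\<kappa>\<^sup>2 * \<nu> powr (2 * \<alpha>) * \<Lambda> * N)) * (q ^ J j)\<^sup>2"
          by (simp add: D_def power_mult_distrib mult_ac)
        finally show "(\<Sum>k\<in>K. ennreal (D j)) = ennreal (cK * (\<kappa>\<^sup>2 * \<nu> powr (2 * \<alpha>) * \<Lambda> * N)) * ennreal ((q ^ J j)\<^sup>2)"
          using cK \<Lambda>0 N0 by (simp only: ennreal_mult mult_nonneg_nonneg zero_le_power2 powr_ge_zero)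
      qed
      also have "\<dots> = ennreal (cK * (\<kappa>\<^sup>2 * \<nu> powr (2 * \<alpha>) * \<Lambda> * N)) * (\<integral>\<^sup>+j. ennreal ((q ^ J j)\<^sup>2) \<partial>count_space UNIV)"
        by (rule nn_integral_cmult) simp
      also have "\<dots> \<le> ennreal (cK * (\<kappa>\<^sup>2 * \<nu> powr (2 * \<alpha>) * \<Lambda> * N)) * ennreal Q"
        by (intro mult_left_mono QJ) simp
      also have "\<dots> = ennreal (c0 * \<nu> powr (2 * \<alpha>) * N)"
        using cK \<Lambda>0 N0 Q0 by (simp flip: ennreal_mult add: c0_def mult_ac)
      finally show ?thesis .
    qed
    have dec_all: "AE \<omega> in lborel. \<forall>(j, k)\<in>?S. band_bounded \<alpha> M (\<kappa> * q ^ J j) c1 c2 (norm \<omega> / band_scale j) (E \<omega>) (cmod (G j k \<omega>))"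
      by (subst AE_ball_countable[OF cS]) (use dec in \<open>auto elim!: eventually_mono\<close>)
    have sumG: "(\<integral>\<^sup>+(j, k). energy (G j k) \<partial>count_space ?S) \<le> ennreal (CU * N)"
    proof -
      have "(\<integral>\<^sup>+(j, k). energy (G j k) \<partial>count_space ?S) =
         (\<integral>\<^sup>+\<omega>. (\<integral>\<^sup>+(j, k). ennreal ((cmod (G j k \<omega>))\<^sup>2) \<partial>count_space ?S) \<partial>lborel)"
        unfolding energy_def case_prod_unfold
        by (rule nn_integral_count_space_nn_integral[OF cS, symmetric]) measurable
      also have "\<dots> \<le> (\<integral>\<^sup>+\<omega>. ennreal CU * ennreal ((E \<omega>)\<^sup>2) \<partial>lborel)"
      proof (rule nn_integral_mono_AE)
        show "AE \<omega> in lborel. (\<integral>\<^sup>+(j, k). ennreal ((cmod (G j k \<omega>))\<^sup>2) \<partial>count_space ?S) \<le> ennreal CU * ennreal ((E \<omega>)\<^sup>2)"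
          using dec_all AE_lborel_singleton[of 0]
        proof eventually_elim
          fix \<omega> :: "real^'n"
          assume H: "\<forall>(j, k)\<in>?S. band_bounded \<alpha> M (\<kappa> * q ^ J j) c1 c2 (norm \<omega> / band_scale j) (E \<omega>) (cmod (G j k \<omega>))"
            and \<omega>: "\<omega> \<noteq> 0"
          show "(\<integral>\<^sup>+(j, k). ennreal ((cmod (G j k \<omega>))\<^sup>2) \<partial>count_space ?S) \<le> ennreal CU * ennreal ((E \<omega>)\<^sup>2)"
            unfolding CU_def cK_def n0_def
            by (rule band_square_sum[OF K c _ QJ[unfolded J_def] Q0]) (use H \<omega> in \<open>auto simp: J_def\<close>)
        qed
      qed
      also have "\<dots> = ennreal CU * ennreal N" by (subst nn_integral_cmult) (auto simp: NE)
      also have "\<dots> = ennreal (CU * N)" using CU N0 by (simp add: ennreal_mult)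
      finally show ?thesis .
    qed
    have low: "ennreal (A0 * N) \<le> (\<integral>\<^sup>+(j, k). (\<integral>\<^sup>+\<omega>. ennreal ((cmod (G j k \<omega>))\<^sup>2) * indicator unit_cell (\<omega> /\<^sub>R (band_scale j / \<nu>)) \<partial>lborel) \<partial>count_space ?S)"
    proof -
      have cov: "AE \<omega> in lborel. \<exists>j::int. \<exists>k\<in>K. \<omega> \<in> extended_set I j k \<and> a \<le> cmod (Phi I \<phi> j k \<omega>)"
        using cover by (simp add: AE_completion_iff)
      have eqs: "AE \<omega> in lborel. \<forall>(j, k)\<in>?S. Phi I \<phi> j k \<omega> = band_sum I \<psi> j k \<omega>"
        by (subst AE_ball_countable[OF cS]) (use Phi_eq_band_sum_AE[OF \<psi>(3)] in auto)
      have "ennreal (A0 * N) = (\<integral>\<^sup>+\<omega>. ennreal A0 * ennreal ((E \<omega>)\<^sup>2) \<partial>lborel)"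
        using A0 N0 by (subst nn_integral_cmult) (auto simp: NE ennreal_mult)
      also have "\<dots> \<le> (\<integral>\<^sup>+\<omega>. (\<integral>\<^sup>+(j, k). ennreal ((cmod (G j k \<omega>))\<^sup>2) * indicator unit_cell (\<omega> /\<^sub>R (band_scale j / \<nu>)) \<partial>count_space ?S) \<partial>lborel)"
      proof (rule nn_integral_mono_AE)
        show "AE \<omega> in lborel. ennreal A0 * ennreal ((E \<omega>)\<^sup>2) \<le>
          (\<integral>\<^sup>+(j, k). ennreal ((cmod (G j k \<omega>))\<^sup>2) * indicator unit_cell (\<omega> /\<^sub>R (band_scale j / \<nu>)) \<partial>count_space ?S)"
          using cov eqs AE_lborel_singleton[of 0]
        proof eventually_elim
          fix \<omega> :: "real^'n"
          assume "\<exists>j::int. \<exists>k\<in>K. \<omega> \<in> extended_set I j k \<and> a \<le> cmod (Phi I \<phi> j k \<omega>)"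
            and eq: "\<forall>(j, k)\<in>?S. Phi I \<phi> j k \<omega> = band_sum I \<psi> j k \<omega>" and \<omega>: "\<omega> \<noteq> 0"
          then obtain j k where k: "k \<in> K" and j: "\<omega> \<in> extended_set I j k" "a \<le> cmod (Phi I \<phi> j k \<omega>)" by blast
          let ?r = "band_scale j"
          have r: "0 < ?r" by (rule band_scale_pos)
          have x: "norm \<omega> / ?r < c2 / 2" by (rule ext[OF k j(1)])
          have x0: "0 < norm \<omega> / ?r" using \<omega> r by simp
          have "norm (\<omega> /\<^sub>R (?r / \<nu>)) = norm \<omega> / ?r * \<nu>" using r \<nu> by (simp add: field_simps)
          also have "\<dots> \<le> c2 / 2 * \<nu>" using x \<nu> by (intro mult_right_mono) auto
          also have "\<dots> < 1/2" using \<nu>c2 \<nu> c by (simp add: field_simps)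
          finally have cell: "\<omega> /\<^sub>R (?r / \<nu>) \<in> unit_cell" by (rule unit_cell_iff_norm)
          have "(c2 / 2) powr (- s) \<le> (norm \<omega> / ?r) powr (- s)"
            using x x0 assms(2) by (intro powr_mono2') auto
          also have "\<dots> * norm \<omega> powr s = ?r powr s"
            using r \<omega> by (simp add: powr_divide powr_minus_divide)
          finally have "(c2 / 2) powr (- s) * norm \<omega> powr s \<le> ?r powr s" by (simp add: mult_right_mono)
          then have "a * ((c2 / 2) powr (- s) * norm \<omega> powr s) \<le> cmod (Phi I \<phi> j k \<omega>) * ?r powr s"
            using j(2) a by (intro mult_mono) auto
          then have "(a * ((c2 / 2) powr (- s) * norm \<omega> powr s)) * cmod (F \<omega>) \<le> (cmod (Phi I \<phi> j k \<omega>) * ?r powr s) * cmod (F \<omega>)"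
            by (intro mult_right_mono) auto
          also have "(cmod (Phi I \<phi> j k \<omega>) * ?r powr s) * cmod (F \<omega>) = cmod (G j k \<omega>)"
            using eq k by (auto simp: G_eq mult_ac)
          finally have "(a * (c2 / 2) powr (- s)) * E \<omega> \<le> cmod (G j k \<omega>)" by (simp add: E_def mult_ac)
          then have "((a * (c2 / 2) powr (- s)) * E \<omega>)\<^sup>2 \<le> (cmod (G j k \<omega>))\<^sup>2"
            using a E0 by (intro power_mono) auto
          then have "A0 * (E \<omega>)\<^sup>2 \<le> (cmod (G j k \<omega>))\<^sup>2" unfolding A0_def by (simp only: power_mult_distrib)
          then have "ennreal (A0 * (E \<omega>)\<^sup>2) \<le> ennreal ((cmod (G j k \<omega>))\<^sup>2)" by (rule ennreal_leI)
          then have "ennreal A0 * ennreal ((E \<omega>)\<^sup>2) \<le> ennreal ((cmod (G j k \<omega>))\<^sup>2)"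
            using A0 by (simp add: ennreal_mult)
          also have "\<dots> = (case (j, k) of (j, k) \<Rightarrow> ennreal ((cmod (G j k \<omega>))\<^sup>2) * indicator unit_cell (\<omega> /\<^sub>R (band_scale j / \<nu>)))"
            using cell by simp
          also have "\<dots> \<le> (\<integral>\<^sup>+(j, k). ennreal ((cmod (G j k \<omega>))\<^sup>2) * indicator unit_cell (\<omega> /\<^sub>R (band_scale j / \<nu>)) \<partial>count_space ?S)"
            using k by (intro nn_integral_ge_point) simp
          finally show "ennreal A0 * ennreal ((E \<omega>)\<^sup>2) \<le>
            (\<integral>\<^sup>+(j, k). ennreal ((cmod (G j k \<omega>))\<^sup>2) * indicator unit_cell (\<omega> /\<^sub>R (band_scale j / \<nu>)) \<partial>count_space ?S)" .
        qed
      qed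
      also have "\<dots> = (\<integral>\<^sup>+(j, k). (\<integral>\<^sup>+\<omega>. ennreal ((cmod (G j k \<omega>))\<^sup>2) * indicator unit_cell (\<omega> /\<^sub>R (band_scale j / \<nu>)) \<partial>lborel) \<partial>count_space ?S)"
        unfolding case_prod_unfold
        by (rule nn_integral_count_space_nn_integral[OF cS]) measurable
      finally show ?thesis .
    qed
    let ?W = "?V * (c0 * \<nu> powr (2 * \<alpha>) * N)"
    have small: "c0 * \<nu> powr (2 * \<alpha>) \<le> A0 / 4"
    proof -
      have "\<nu> powr (2 * \<alpha>) \<le> ((A0 / (4 * (c0 + 1))) powr (1 / (2 * \<alpha>))) powr (2 * \<alpha>)"
        using \<nu> \<alpha>0 by (intro powr_mono2) (auto simp: \<nu>0_def)
      also have "\<dots> = A0 / (4 * (c0 + 1))" using \<alpha>0 A0 c0 by (simp add: powr_powr)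
      finally have "(c0 + 1) * \<nu> powr (2 * \<alpha>) \<le> (c0 + 1) * (A0 / (4 * (c0 + 1)))"
        using c0 by (intro mult_left_mono) auto
      also have "\<dots> = A0 / 4" using c0 by (simp add: field_simps)
      finally have "c0 * \<nu> powr (2 * \<alpha>) + \<nu> powr (2 * \<alpha>) \<le> A0 / 4" by (simp only: distrib_right mult_1)
      moreover have "0 \<le> \<nu> powr (2 * \<alpha>)" by simp
      ultimately show ?thesis by linarith
    qed
    have upper: "Tot \<le> ennreal (?V * (2 * CU * N + 2 * (c0 * \<nu> powr (2 * \<alpha>) * N)))"
    proof -
      have "Tot \<le> (\<integral>\<^sup>+(j, k). ennreal ?V * (2 * energy (G j k) + 2 * ennreal (D j)) \<partial>count_space ?S)"
        unfolding Tot_def using band(1) by (intro nn_integral_mono) auto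
      also have "\<dots> = ennreal ?V * (2 * (\<integral>\<^sup>+(j, k). energy (G j k) \<partial>count_space ?S) + 2 * (\<integral>\<^sup>+(j, k). ennreal (D j) \<partial>count_space ?S))"
        unfolding case_prod_unfold by (simp add: nn_integral_cmult nn_integral_add)
      also have "\<dots> \<le> ennreal ?V * (2 * ennreal (CU * N) + 2 * ennreal (c0 * \<nu> powr (2 * \<alpha>) * N))"
        by (intro mult_left_mono add_mono sumG sumD) auto
      also have "\<dots> = ennreal (?V * (2 * CU * N + 2 * (c0 * \<nu> powr (2 * \<alpha>) * N)))"
        using CU N0 c0 by (simp add: ennreal_mult ennreal_plus mult.assoc)
      finally show ?thesis .
    qed
    have lower: "ennreal (?V * (A0 * N)) \<le> 2 * Tot + ennreal (?V * (2 * (c0 * \<nu> powr (2 * \<alpha>) * N)))"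
    proof -
      have "ennreal (?V * (A0 * N)) = ennreal ?V * ennreal (A0 * N)" using A0 N0 by (simp add: ennreal_mult)
      also have "\<dots> \<le> ennreal ?V * (\<integral>\<^sup>+(j, k). (\<integral>\<^sup>+\<omega>. ennreal ((cmod (G j k \<omega>))\<^sup>2) * indicator unit_cell (\<omega> /\<^sub>R (band_scale j / \<nu>)) \<partial>lborel) \<partial>count_space ?S)"
        by (intro mult_left_mono low) simp
      also have "\<dots> = (\<integral>\<^sup>+(j, k). ennreal ?V * (\<integral>\<^sup>+\<omega>. ennreal ((cmod (G j k \<omega>))\<^sup>2) * indicator unit_cell (\<omega> /\<^sub>R (band_scale j / \<nu>)) \<partial>lborel) \<partial>count_space ?S)"
        unfolding case_prod_unfold by (rule nn_integral_cmult[symmetric]) simp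
      also have "\<dots> \<le> (\<integral>\<^sup>+(j, k). 2 * \<tau> j k + ennreal ?V * (2 * ennreal (D j)) \<partial>count_space ?S)"
        using band(2) by (intro nn_integral_mono) auto
      also have "\<dots> = 2 * Tot + ennreal ?V * (2 * (\<integral>\<^sup>+(j, k). ennreal (D j) \<partial>count_space ?S))"
        unfolding Tot_def case_prod_unfold by (simp add: nn_integral_cmult nn_integral_add)
      also have "\<dots> \<le> 2 * Tot + ennreal ?V * (2 * ennreal (c0 * \<nu> powr (2 * \<alpha>) * N))"
        by (intro add_left_mono mult_left_mono sumD) auto
      also have "\<dots> = 2 * Tot + ennreal (?V * (2 * (c0 * \<nu> powr (2 * \<alpha>) * N)))"
        using N0 c0 by (simp add: ennreal_mult)
      finally show ?thesis .
    qed
    define S where "S = enn2real Tot"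
    have Tfin: "Tot < \<infinity>" using upper by (rule le_less_trans) simp
    have TS: "Tot = ennreal S" using Tfin by (simp add: S_def)
    have S0: "0 \<le> S" by (simp add: S_def)
    have hs: "((\<lambda>(j, k, l). 2 powr (2 * real_of_int j * s) * (cmod (L2_inner f (atom I \<phi> j k l)))\<^sup>2) has_sum S)
         (UNIV \<times> K \<times> scaled_lattice \<nu>)"
    proof (rule nn_integral_count_space_imp_has_sum)
      have cl: "countable (scaled_lattice \<nu> :: (real^'n) set)"
        unfolding scaled_lattice_def by (intro countable_image countable_int_lattice)
      have "(\<integral>\<^sup>+z. ennreal (case z of (j, k, l) \<Rightarrow> 2 powr (2 * real_of_int j * s) * (cmod (L2_inner f (atom I \<phi> j k l)))\<^sup>2)
         \<partial>count_space (UNIV \<times> K \<times> scaled_lattice \<nu>)) =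
        (\<integral>\<^sup>+j. (\<integral>\<^sup>+k. \<tau> j k \<partial>count_space K) \<partial>count_space UNIV)"
        using K cl by (simp add: nn_integral_count_space_Times countable_finite \<tau>_def)
      also have "\<dots> = Tot"
        unfolding Tot_def using K by (subst nn_integral_count_space_Times) (auto simp: countable_finite)
      finally show "(\<integral>\<^sup>+z. ennreal (case z of (j, k, l) \<Rightarrow> 2 powr (2 * real_of_int j * s) * (cmod (L2_inner f (atom I \<phi> j k l)))\<^sup>2)
         \<partial>count_space (UNIV \<times> K \<times> scaled_lattice \<nu>)) = ennreal S" using TS by simp
    qed (use S0 in auto)
    have V0: "0 \<le> ?V" by simp
    have smallN: "c0 * \<nu> powr (2 * \<alpha>) * N \<le> A0 / 4 * N" using small N0 by (rule mult_right_mono)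
    have "S \<le> ?V * (2 * CU * N + 2 * (c0 * \<nu> powr (2 * \<alpha>) * N))"
      using upper unfolding TS using CU c0 N0 by (subst (asm) ennreal_le_iff) auto
    also have "\<dots> \<le> ?V * ((2 * CU + A0 + 1) * N)"
    proof (intro mult_left_mono V0)
      have "0 \<le> A0 * N" using A0 N0 by simp
      then show "2 * CU * N + 2 * (c0 * \<nu> powr (2 * \<alpha>) * N) \<le> (2 * CU + A0 + 1) * N"
        using smallN N0 by (simp add: distrib_right)
    qed
    finally have U: "S \<le> ?V * (2 * CU + A0 + 1) * N" by (simp only: mult.assoc)
    have "ennreal (?V * (A0 * N)) \<le> ennreal (2 * S + ?V * (2 * (c0 * \<nu> powr (2 * \<alpha>) * N)))"
      using lower unfolding TS using S0 c0 N0 by (simp add: ennreal_plus ennreal_mult)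
    then have "?V * (A0 * N) \<le> 2 * S + ?V * (2 * (c0 * \<nu> powr (2 * \<alpha>) * N))"
      using S0 c0 N0 by (subst (asm) ennreal_le_iff) auto
    also have "\<dots> \<le> 2 * S + ?V * (A0 / 2 * N)"
      using smallN by (intro add_left_mono mult_left_mono V0) simp
    finally have "?V * (A0 * N) \<le> 2 * S + (?V * (A0 * N)) / 2" by simp
    then have L: "?V * A0 / 4 * N \<le> S" by simp
    show ?thesis using hs L U unfolding N_def by blast
  qed
  show ?thesis
  proof (rule exI[of _ \<nu>0], intro conjI allI impI \<nu>0)
    fix \<nu> :: real assume \<nu>: "0 < \<nu> \<and> \<nu> < \<nu>0"
    let ?V = "\<nu> powr (- real CARD('n))"
    show "\<exists>A>0. \<exists>B>0. \<forall>f\<in>sobolev_space s.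
       (\<lambda>(j, k, l). 2 powr (2 * real_of_int j * s) * (cmod (L2_inner f (atom I \<phi> j k l)))\<^sup>2)
         summable_on (UNIV \<times> K \<times> scaled_lattice \<nu>) \<and>
       A * (sobolev_seminorm s f)\<^sup>2 \<le>
         (\<Sum>\<^sub>\<infinity>(j, k, l)\<in>UNIV \<times> K \<times> scaled_lattice \<nu>.
            2 powr (2 * real_of_int j * s) * (cmod (L2_inner f (atom I \<phi> j k l)))\<^sup>2) \<and>
       (\<Sum>\<^sub>\<infinity>(j, k, l)\<in>UNIV \<times> K \<times> scaled_lattice \<nu>.
            2 powr (2 * real_of_int j * s) * (cmod (L2_inner f (atom I \<phi> j k l)))\<^sup>2) \<le>
         B * (sobolev_seminorm s f)\<^sup>2"
    proof (rule exI[of _ "?V * A0 / 4"], intro conjI, goal_cases)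
      case 1 show ?case using \<nu> A0 by simp
    next
      case 2
      show ?case
      proof (rule exI[of _ "?V * (2 * CU + A0 + 1)"], intro conjI ballI, goal_cases)
        case 1 show ?case using \<nu> A0 CU by (simp add: add_nonneg_pos add_pos_pos)
      next
        case (2 f)
        with main[OF 2, of \<nu>] \<nu> show ?case using has_sum_imp_summable by blast
      next
        case (3 f)
        with main[OF 3, of \<nu>] \<nu> show ?case by (auto dest!: infsumI)
      next
        case (4 f)
        with main[OF 4, of \<nu>] \<nu> show ?case by (auto dest!: infsumI)
      qed
    qed
  qed
qed

end
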